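(* Let $t\in[1/2,1)$ and write $\lambda_{[n,n+k]}=\lambda^{(t)}_{n+k-1}\circ\cdots\circ\lambda^{(t)}_n$. (1) For all $n\ge 0$ and $x\in M_3(\mathbb C)^{\otimes n}\otimes\mathbb C^3$, the sequence $\lambda_{[n,n+k]}(x)$ has a norm limit in $\mathrm{UHF}(3^\infty)$ as $k\to\infty$. Denote this limit by $\lambda_{[n,\infty)}(x)$. (2) $\lambda_{[n,\infty)}$ is a completely positive contraction which sends $\mathcal A_n$ into $\mathcal A_\infty$. (3) For $b\in\mathcal A_n$, $\lambda_{[n,\infty)}(b)$ is an extension of $b$ in the sense that $\rho_n\big(\lambda_{[n,\infty)}(b)\big)=b$.
   Context: Indices $j\in\{1,2,3\}$ are taken mod $3$. $M_3(\mathbb C)$ has matrix units $e_{ij}$, and $\mathbb C^3$ is identified with its diagonal subalgebra. $\mathrm{UHF}(3^\infty)$ is the $C^*$-inductive limit of $M_3(\mathbb C)^{\otimes n}$ under $x\mapsto x\otimes I_3$; each $M_3(\mathbb C)^{\otimes n}$ is regarded as a unital subalgebra of it. For $n\ge0$ put $\alpha^n_j=e_{jj}\otimes e_{22}^{\otimes n}\in M_3(\mathbb C)^{\otimes(n+1)}$, and for $k\ge1$ put $\beta^k_j=(e_{jj}\otimes e_{11}+e_{j+2,j+2}\otimes e_{33})\otimes e_{22}^{\otimes(k-1)}\in M_3(\mathbb C)^{\otimes(k+1)}$. The finite-dimensional $*$-algebra $\mathcal A_n\subset M_3(\mathbb C)^{\otimes n}\otimes\mathbb C^3\subset M_3(\mathbb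 C)^{\otimes(n+1)}$ is the linear span of the $\alpha^n_j$ and of the $x\otimes\beta^k_j$ with $j=1,2,3$, $k=1,\dots,n$, $x\in M_3(\mathbb C)^{\otimes(n-k)}$. $\mathcal A_\infty$ is the $C^*$-subalgebra of $\mathrm{UHF}(3^\infty)$ of all norm limits $\lim_n a_n$ with $a_n\in\mathcal A_n$. The slice map $\rho_n:\mathrm{UHF}(3^\infty)\to M_3(\mathbb C)^{\otimes(n+1)}$ is the identity on the first $n+1$ tensor factors and applies the state $m\mapsto m_{22}$ to each of the others. For $t\in[1/2,1)$, $\lambda^{(t)}:\mathbb C^3\to\mathbb C^3\otimes\mathbb C^3$ is the unital positive linear map with $\lambda^{(t)}(\alpha^0_j)=\alpha^1_j+(1-t)\beta^1_j+(1-t)\beta^1_{j+1}+(2t-1)\beta^1_{j-1}$, and $\lambda^{(t)}_n=id_n\otimes\lambda^{(t)}:M_3(\mathbb C)^{\otimes n}\otimes\mathbb C^3\to M_3(\mathbb C)^{\otimes n}\otimes\mathbb C^3\otimes\mathbb C^3\subset M_3(\mathbb C)^{\otimes(n+1)}\otimes\mathbb C^3$, where $id_n$ is the identity of $M_3(\mathbb C)^{\otimes n}$. *)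

theory Defs
  imports "HOL-Analysis.Analysis" "HOL-Library.Function_Algebras"
begin

section \<open>Matrices over tensor powers of the three-dimensional space\<close>

text \<open>
  The standard basis of the \<open>n\<close>-th tensor power of \<open>\<complex>\<^sup>3\<close> is indexed by the words of length \<open>n\<close>
  over the letters \<open>1, 2, 3 :: 3\<close>, so that a member of the \<open>n\<close>-th tensor power of \<open>M\<^sub>3(\<complex>)\<close> is a
  matrix indexed by such words, extended by \<open>0\<close> to all words. In the type \<open>3\<close> arithmetic is modulo
  three, and \<open>3 = 0\<close>. Sums and differences of matrices are the pointwise ones of
  \<^theory>\<open>HOL-Library.Function_Algebras\<close>; the pointwise product of that theory is not used.
\<close>

type_synonym tmat = "3 list \<Rightarrow> 3 list \<Rightarrow> complex"

definition words :: "nat \<Rightarrow> 3 list set" where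
  "words n = {w. length w = n}"

definition Mat :: "nat \<Rightarrow> tmat set" where
  "Mat n = {x. \<forall>u v. x u v \<noteq> 0 \<longrightarrow> u \<in> words n \<and> v \<in> words n}"

definition mscale :: "complex \<Rightarrow> tmat \<Rightarrow> tmat" where
  "mscale c x = (\<lambda>u v. c * x u v)"

definition mmul :: "nat \<Rightarrow> tmat \<Rightarrow> tmat \<Rightarrow> tmat" where
  "mmul n x y = (\<lambda>u v. \<Sum>w\<in>words n. x u w * y w v)"

definition mone :: "nat \<Rightarrow> tmat" where
  "mone n = (\<lambda>u v. if u = v \<and> u \<in> words n then 1 else 0)"

definition mstar :: "tmat \<Rightarrow> tmat" where
  "mstar x = (\<lambda>u v. cnj (x v u))"

definition vnorm :: "nat \<Rightarrow> (3 list \<Rightarrow> complex) \<Rightarrow> real" where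
  "vnorm n \<xi> = L2_set (\<lambda>u. cmod (\<xi> u)) (words n)"

definition mapp :: "nat \<Rightarrow> tmat \<Rightarrow> (3 list \<Rightarrow> complex) \<Rightarrow> 3 list \<Rightarrow> complex" where
  "mapp n x \<xi> = (\<lambda>u. \<Sum>v\<in>words n. x u v * \<xi> v)"

definition mnorm :: "nat \<Rightarrow> tmat \<Rightarrow> real" where
  "mnorm n x = (SUP \<xi>\<in>{\<xi>. vnorm n \<xi> \<le> 1}. vnorm n (mapp n x \<xi>))"

text \<open>The tensor product of \<open>x\<close> in \<open>Mat n\<close> with \<open>y\<close> in \<open>Mat m\<close>, a member of \<open>Mat (n + m)\<close>.\<close>

definition tensor :: "nat \<Rightarrow> tmat \<Rightarrow> tmat \<Rightarrow> tmat" where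
  "tensor n x y = (\<lambda>u v. x (take n u) (take n v) * y (drop n u) (drop n v))"

definition munit :: "3 \<Rightarrow> 3 \<Rightarrow> tmat" where
  "munit i j = (\<lambda>u v. if u = [i] \<and> v = [j] then 1 else 0)"

text \<open>Tensor powers of members of \<open>Mat 1\<close>.\<close>

primrec tpow :: "tmat \<Rightarrow> nat \<Rightarrow> tmat" where
  "tpow x 0 = mone 0"
| "tpow x (Suc n) = tensor 1 x (tpow x n)"

text \<open>The iterated connecting map \<open>x \<mapsto> x \<otimes> I\<close> from \<open>Mat n\<close> to \<open>Mat m\<close>, where \<open>n \<le> m\<close>.\<close>

definition amp :: "nat \<Rightarrow> nat \<Rightarrow> tmat \<Rightarrow> tmat" where
  "amp n m x = tensor n x (mone (m - n))"

lemma mscale_vector_space: "vector_space mscale"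
  by unfold_locales (auto simp: mscale_def fun_eq_iff algebra_simps)

global_interpretation tmat: vector_space mscale
  by (rule mscale_vector_space)

lemma finite_words [simp]: "finite (words n)"
  using finite_lists_length_eq[of "UNIV :: 3 set" n] by (simp add: words_def)

lemma words_nonempty [simp]: "words n \<noteq> {}"
  by (auto simp: words_def intro: exI[of _ "replicate n 1"])

lemma sum_words_add: "(\<Sum>w\<in>words (m + k). f w) = (\<Sum>a\<in>words m. \<Sum>b\<in>words k. f (a @ b))"
proof -
  have "bij_betw (\<lambda>(a, b). a @ b) (words m \<times> words k) (words (m + k))"
    unfolding bij_betw_def
  proof
    show "inj_on (\<lambda>(a, b). a @ b) (words m \<times> words k)"
      by (auto simp: inj_on_def words_def)
    show "(\<lambda>(a, b). a @ b) ` (words m \<times> words k) = words (m + k)"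
    proof (intro equalityI subsetI)
      fix w assume "w \<in> words (m + k)"
      then have "w = (\<lambda>(a, b). a @ b) (take m w, drop m w)" "(take m w, drop m w) \<in> words m \<times> words k"
        by (auto simp: words_def)
      then show "w \<in> (\<lambda>(a, b). a @ b) ` (words m \<times> words k)"
        by (metis imageI)
    qed (auto simp: words_def)
  qed
  then have "(\<Sum>w\<in>words (m + k). f w) = (\<Sum>(a, b)\<in>words m \<times> words k. f (a @ b))"
    by (subst sum.reindex_bij_betw[symmetric]) (auto intro!: sum.cong)
  then show ?thesis
    by (simp add: sum.cartesian_product)
qed

lemma Mat_zero [simp]: "0 \<in> Mat n"
  by (simp add: Mat_def)

lemma Mat_add: "x \<in> Mat n \<Longrightarrow> y \<in> Mat n \<Longrightarrow> x + y \<in> Mat n"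
  unfolding Mat_def by (simp, metis add.right_neutral)

lemma Mat_diff: "x \<in> Mat n \<Longrightarrow> y \<in> Mat n \<Longrightarrow> x - y \<in> Mat n"
  unfolding Mat_def by (simp, metis diff_self)

lemma Mat_uminus: "x \<in> Mat n \<Longrightarrow> - x \<in> Mat n"
  unfolding Mat_def by simp

lemma Mat_mscale: "x \<in> Mat n \<Longrightarrow> mscale c x \<in> Mat n"
  unfolding Mat_def mscale_def by auto

lemma Mat_mstar: "x \<in> Mat n \<Longrightarrow> mstar x \<in> Mat n"
  unfolding Mat_def mstar_def by simp

lemma Mat_mone [simp]: "mone n \<in> Mat n"
  unfolding Mat_def mone_def by simp

lemma Mat_mmul: "x \<in> Mat n \<Longrightarrow> y \<in> Mat n \<Longrightarrow> mmul n x y \<in> Mat n"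
  unfolding Mat_def mmul_def
  by (simp, metis (mono_tags, lifting) mult_zero_left mult_zero_right sum.neutral)

lemma Mat_tensor: "x \<in> Mat n \<Longrightarrow> y \<in> Mat m \<Longrightarrow> tensor n x y \<in> Mat (n + m)"
  unfolding Mat_def tensor_def words_def by (simp, fastforce)

lemma Mat_amp: "x \<in> Mat n \<Longrightarrow> n \<le> m \<Longrightarrow> amp n m x \<in> Mat m"
  using Mat_tensor[of x n "mone (m - n)" "m - n"] by (simp add: amp_def)

lemma Mat_outside: "x \<in> Mat n \<Longrightarrow> u \<notin> words n \<or> v \<notin> words n \<Longrightarrow> x u v = 0"
  unfolding Mat_def by blast

lemma Mat_eqI:
  assumes "x \<in> Mat n" "y \<in> Mat n" "\<And>u v. u \<in> words n \<Longrightarrow> v \<in> words n \<Longrightarrow> x u v = y u v"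
  shows "x = y"
  using assms by (metis (no_types, opaque_lifting) Mat_outside ext)

lemma mmul_assoc: "mmul n (mmul n x y) z = mmul n x (mmul n y z)"
proof (intro ext)
  fix u v
  have "(\<Sum>w\<in>words n. \<Sum>w'\<in>words n. x u w' * (y w' w * z w v)) =
      (\<Sum>w'\<in>words n. \<Sum>w\<in>words n. x u w' * (y w' w * z w v))"
    by (rule sum.swap)
  then show "mmul n (mmul n x y) z u v = mmul n x (mmul n y z) u v"
    by (simp add: mmul_def sum_distrib_left sum_distrib_right mult.assoc)
qed

lemma mmul_add_left: "mmul n (x + y) z = mmul n x z + mmul n y z"
  and mmul_add_right: "mmul n z (x + y) = mmul n z x + mmul n z y"
  and mmul_diff_left: "mmul n (x - y) z = mmul n x z - mmul n y z"
  and mmul_diff_right: "mmul n z (x - y) = mmul n z x - mmul n z y"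
  and mmul_mscale_left: "mmul n (mscale c x) z = mscale c (mmul n x z)"
  and mmul_mscale_right: "mmul n z (mscale c x) = mscale c (mmul n z x)"
  unfolding mmul_def mscale_def fun_eq_iff
  by (simp_all add: algebra_simps sum.distrib sum_subtractf sum_distrib_left)

lemma mmul_mone_left: "x \<in> Mat n \<Longrightarrow> mmul n (mone n) x = x"
proof (rule Mat_eqI[of _ n])
  fix u v assume "u \<in> words n" "v \<in> words n"
  then have "(\<Sum>w\<in>words n. (if u = w \<and> u \<in> words n then 1 else 0) * x w v) =
      (\<Sum>w\<in>words n. if u = w then x w v else 0)"
    by (intro sum.cong) auto
  then show "mmul n (mone n) x u v = x u v"
    using \<open>u \<in> words n\<close> by (simp add: mmul_def mone_def)
qed (auto intro: Mat_mmul)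

lemma mmul_mone_right: "x \<in> Mat n \<Longrightarrow> mmul n x (mone n) = x"
proof (rule Mat_eqI[of _ n])
  fix u v assume "u \<in> words n" "v \<in> words n"
  then have "(\<Sum>w\<in>words n. x u w * (if w = v \<and> w \<in> words n then 1 else 0)) =
      (\<Sum>w\<in>words n. if v = w then x u w else 0)"
    by (intro sum.cong) auto
  then show "mmul n x (mone n) u v = x u v"
    using \<open>v \<in> words n\<close> by (simp add: mmul_def mone_def)
qed (auto intro: Mat_mmul)

lemma mstar_mmul: "mstar (mmul n x y) = mmul n (mstar y) (mstar x)"
  by (auto simp: mstar_def mmul_def fun_eq_iff mult.commute)

lemma mstar_mstar [simp]: "mstar (mstar x) = x"
  by (simp add: mstar_def)

lemma mstar_add: "mstar (x + y) = mstar x + mstar y"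
  and mstar_diff: "mstar (x - y) = mstar x - mstar y"
  and mstar_mscale: "mstar (mscale c x) = mscale (cnj c) (mstar x)"
  by (auto simp: mstar_def mscale_def fun_eq_iff)

lemma amp_entry:
  assumes "a \<in> words n" "b \<in> words n"
  shows "amp n m x (a @ c) (b @ d) = (if c = d \<and> c \<in> words (m - n) then x a b else 0)"
  using assms by (auto simp: amp_def tensor_def mone_def words_def)

lemma words_splitE:
  assumes "u \<in> words m" "n \<le> m"
  obtains a c where "u = a @ c" "a \<in> words n" "c \<in> words (m - n)"
  using assms by (intro that[of "take n u" "drop n u"]) (auto simp: words_def)

lemma amp_add: "amp n m (x + y) = amp n m x + amp n m y"
  and amp_diff: "amp n m (x - y) = amp n m x - amp n m y"
  and amp_mscale: "amp n m (mscale c x) = mscale c (amp n m x)"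
  and amp_zero [simp]: "amp n m 0 = 0"
  by (auto simp: amp_def tensor_def mscale_def fun_eq_iff algebra_simps)

lemma amp_mstar: "amp n m (mstar x) = mstar (amp n m x)"
  by (auto simp: amp_def tensor_def mstar_def mone_def fun_eq_iff)

lemma amp_mone: "n \<le> m \<Longrightarrow> amp n m (mone n) = mone m"
proof (rule Mat_eqI[of _ m])
  fix u v assume "n \<le> m" "u \<in> words m" "v \<in> words m"
  from words_splitE[OF this(2,1)] words_splitE[OF this(3,1)]
  obtain a b c d where "u = a @ c" "a \<in> words n" "c \<in> words (m - n)"
      "v = b @ d" "b \<in> words n" "d \<in> words (m - n)" by metis
  then show "amp n m (mone n) u v = mone m u v"
    using \<open>n \<le> m\<close> by (auto simp: amp_entry mone_def words_def)
qed (auto intro: Mat_amp)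

lemma amp_self: "x \<in> Mat n \<Longrightarrow> amp n n x = x"
proof (rule Mat_eqI[of _ n])
  fix u v assume "u \<in> words n" "v \<in> words n"
  then show "amp n n x u v = x u v"
    using amp_entry[of u n v n x "[]" "[]"] by (simp add: words_def)
qed (auto intro: Mat_amp)

lemma amp_amp:
  assumes "x \<in> Mat n" "n \<le> m" "m \<le> k"
  shows "amp m k (amp n m x) = amp n k x"
proof (rule Mat_eqI[of _ k])
  fix u v assume uv: "u \<in> words k" "v \<in> words k"
  obtain u' c where u: "u = u' @ c" "u' \<in> words m" "c \<in> words (k - m)"
    using words_splitE[OF uv(1) assms(3)] by metis
  obtain v' d where v: "v = v' @ d" "v' \<in> words m" "d \<in> words (k - m)"
    using words_splitE[OF uv(2) assms(3)] by metis
  obtain a c' where u': "u' = a @ c'" "a \<in> words n" "c' \<in> words (m - n)"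
    using words_splitE[OF u(2) assms(2)] by metis
  obtain b d' where v': "v' = b @ d'" "b \<in> words n" "d' \<in> words (m - n)"
    using words_splitE[OF v(2) assms(2)] by metis
  have "amp n k x (a @ (c' @ c)) (b @ (d' @ d)) =
      (if c' @ c = d' @ d \<and> c' @ c \<in> words (k - n) then x a b else 0)"
    by (rule amp_entry) (fact u' v')+
  moreover have "amp m k (amp n m x) (u' @ c) (v' @ d) =
      (if c = d \<and> c \<in> words (k - m) then amp n m x u' v' else 0)"
    by (rule amp_entry) (fact u v)+
  moreover have "amp n m x u' v' = (if c' = d' \<and> c' \<in> words (m - n) then x a b else 0)"
    unfolding u'(1) v'(1) by (rule amp_entry) (fact u' v')+
  moreover have "c' @ c = d' @ d \<longleftrightarrow> c' = d' \<and> c = d"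
    using u' v' by (simp add: words_def)
  moreover have "c' @ c \<in> words (k - n)"
    using u u' assms by (auto simp: words_def)
  ultimately show "amp m k (amp n m x) u v = amp n k x u v"
    unfolding u(1) v(1) using u(3) u'(3) u'(1) v'(1) by auto
qed (use assms in \<open>auto intro!: Mat_amp\<close>)

lemma amp_mmul:
  assumes "x \<in> Mat n" "y \<in> Mat n" "n \<le> m"
  shows "amp n m (mmul n x y) = mmul m (amp n m x) (amp n m y)"
proof (rule Mat_eqI[of _ m])
  fix u v assume uv: "u \<in> words m" "v \<in> words m"
  obtain a c where u: "u = a @ c" "a \<in> words n" "c \<in> words (m - n)"
    using words_splitE[OF uv(1) assms(3)] by metis
  obtain b d where v: "v = b @ d" "b \<in> words n" "d \<in> words (m - n)"
    using words_splitE[OF uv(2) assms(3)] by metis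
  have "mmul m (amp n m x) (amp n m y) u v =
      (\<Sum>w\<in>words (n + (m - n)). amp n m x u w * amp n m y w v)"
    using assms by (simp add: mmul_def)
  also have "\<dots> = (\<Sum>p\<in>words n. \<Sum>q\<in>words (m - n). amp n m x u (p @ q) * amp n m y (p @ q) v)"
    by (rule sum_words_add)
  also have "\<dots> = (\<Sum>p\<in>words n. \<Sum>q\<in>words (m - n). if c = q then (if c = d then x a p * y p b else 0) else 0)"
    using u v by (intro sum.cong refl) (auto simp: amp_entry)
  also have "\<dots> = (\<Sum>p\<in>words n. if c = d then x a p * y p b else 0)"
    using u by simp
  also have "\<dots> = amp n m (mmul n x y) u v"
    using u v by (simp add: amp_entry mmul_def)
  finally show "amp n m (mmul n x y) u v = mmul m (amp n m x) (amp n m y) u v" by simp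
qed (use assms in \<open>auto intro!: Mat_amp Mat_mmul\<close>)

subsection \<open>The operator norm\<close>

lemma vnorm_nonneg [simp]: "0 \<le> vnorm n \<xi>"
  by (simp add: vnorm_def)

lemma vnorm_zero [simp]: "vnorm n (\<lambda>_. 0) = 0"
  by (simp add: vnorm_def L2_set_def)

lemma vnorm_power2: "(vnorm n \<xi>)\<^sup>2 = (\<Sum>u\<in>words n. (cmod (\<xi> u))\<^sup>2)"
  by (simp add: vnorm_def L2_set_def sum_nonneg)

lemma vnorm_ge: "u \<in> words n \<Longrightarrow> cmod (\<xi> u) \<le> vnorm n \<xi>"
  unfolding vnorm_def by (rule member_le_L2_set) auto

lemma vnorm_add: "vnorm n (\<lambda>u. \<xi> u + \<eta> u) \<le> vnorm n \<xi> + vnorm n \<eta>"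
proof -
  have "vnorm n (\<lambda>u. \<xi> u + \<eta> u) \<le> L2_set (\<lambda>u. cmod (\<xi> u) + cmod (\<eta> u)) (words n)"
    unfolding vnorm_def by (intro L2_set_mono) (auto intro: norm_triangle_ineq)
  also have "\<dots> \<le> vnorm n \<xi> + vnorm n \<eta>"
    unfolding vnorm_def by (rule L2_set_triangle_ineq)
  finally show ?thesis .
qed

lemma vnorm_scale: "vnorm n (\<lambda>u. c * \<xi> u) = cmod c * vnorm n \<xi>"
  unfolding vnorm_def by (simp add: norm_mult L2_set_right_distrib)

lemma vnorm_delta:
  assumes "w \<in> words n"
  shows "vnorm n (\<lambda>v. if v = w then 1 else 0) = 1"
proof -
  have "(vnorm n (\<lambda>v. if v = w then 1 else 0))\<^sup>2 = (\<Sum>u\<in>words n. if u = w then 1 else 0)"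
    unfolding vnorm_power2 by (intro sum.cong) auto
  also have "\<dots> = 1\<^sup>2"
    using assms by simp
  finally show ?thesis
    by (rule power2_eq_imp_eq) auto
qed

lemma mapp_scale: "mapp n x (\<lambda>u. c * \<xi> u) = (\<lambda>u. c * mapp n x \<xi> u)"
  by (simp add: mapp_def sum_distrib_left algebra_simps)

lemma mapp_mmul: "mapp n (mmul n x y) \<xi> = mapp n x (mapp n y \<xi>)"
proof (rule ext)
  fix u
  have "(\<Sum>w\<in>words n. \<Sum>w'\<in>words n. x u w' * (y w' w * \<xi> w)) =
      (\<Sum>w'\<in>words n. \<Sum>w\<in>words n. x u w' * (y w' w * \<xi> w))"
    by (rule sum.swap)
  then show "mapp n (mmul n x y) \<xi> u = mapp n x (mapp n y \<xi>) u"
    by (simp add: mapp_def mmul_def sum_distrib_left sum_distrib_right mult.assoc)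
qed

lemma mnorm_bdd: "bdd_above ((\<lambda>\<xi>. vnorm n (mapp n x \<xi>)) ` {\<xi>. vnorm n \<xi> \<le> 1})"
proof (rule bdd_aboveI2)
  fix \<xi> assume "\<xi> \<in> {\<xi>. vnorm n \<xi> \<le> 1}"
  then have le: "cmod (\<xi> v) \<le> 1" if "v \<in> words n" for v
    using vnorm_ge[OF that, of \<xi>] by simp
  have "vnorm n (mapp n x \<xi>) \<le> (\<Sum>u\<in>words n. cmod (mapp n x \<xi> u))"
    unfolding vnorm_def by (rule L2_set_le_sum) auto
  also have "\<dots> \<le> (\<Sum>u\<in>words n. \<Sum>v\<in>words n. cmod (x u v))"
  proof (rule sum_mono)
    fix u assume "u \<in> words n"
    have "cmod (mapp n x \<xi> u) \<le> (\<Sum>v\<in>words n. cmod (x u v * \<xi> v))"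
      unfolding mapp_def by (rule norm_sum)
    also have "\<dots> \<le> (\<Sum>v\<in>words n. cmod (x u v))"
      by (intro sum_mono) (use le in \<open>auto simp: norm_mult intro: mult_left_le\<close>)
    finally show "cmod (mapp n x \<xi> u) \<le> (\<Sum>v\<in>words n. cmod (x u v))" .
  qed
  finally show "vnorm n (mapp n x \<xi>) \<le> (\<Sum>u\<in>words n. \<Sum>v\<in>words n. cmod (x u v))" .
qed

lemma mnorm_upper: "vnorm n \<xi> \<le> 1 \<Longrightarrow> vnorm n (mapp n x \<xi>) \<le> mnorm n x"
  unfolding mnorm_def by (rule cSUP_upper[OF _ mnorm_bdd]) simp

lemma mnorm_nonneg [simp]: "0 \<le> mnorm n x"
proof -
  have "vnorm n (\<lambda>_. 0) \<le> 1" by simp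
  from mnorm_upper[OF this, of x] show ?thesis
    using vnorm_nonneg order_trans by blast
qed

lemma mnorm_bound: "vnorm n (mapp n x \<xi>) \<le> mnorm n x * vnorm n \<xi>"
proof (cases "vnorm n \<xi> = 0")
  case True
  then have "\<xi> v = 0" if "v \<in> words n" for v
    using vnorm_ge[OF that, of \<xi>] by simp
  then have "mapp n x \<xi> = (\<lambda>_. 0)"
    by (simp add: mapp_def)
  then show ?thesis
    using True by simp
next
  case False
  define r where "r = vnorm n \<xi>"
  have r: "r > 0" using False by (simp add: r_def order_less_le)
  have "vnorm n (\<lambda>u. complex_of_real (1 / r) * \<xi> u) \<le> 1"
    unfolding vnorm_scale using r by (simp add: r_def norm_divide)
  from mnorm_upper[OF this, of x]
  have "vnorm n (mapp n x \<xi>) / r \<le> mnorm n x"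
    unfolding mapp_scale vnorm_scale using r by (simp add: norm_divide)
  then show ?thesis
    using r by (simp add: r_def field_simps)
qed

lemma mnorm_least:
  assumes "0 \<le> C" "\<And>\<xi>. vnorm n (mapp n x \<xi>) \<le> C * vnorm n \<xi>"
  shows "mnorm n x \<le> C"
  unfolding mnorm_def
proof (rule cSUP_least)
  show "{\<xi>. vnorm n \<xi> \<le> 1} \<noteq> {}"
    by (auto intro!: exI[of _ "\<lambda>_. 0"])
  fix \<xi> assume "\<xi> \<in> {\<xi>. vnorm n \<xi> \<le> 1}"
  then show "vnorm n (mapp n x \<xi>) \<le> C"
    using assms by (metis (mono_tags, lifting) mem_Collect_eq mult_left_le order_trans)
qed

lemma mnorm_triangle: "mnorm n (x + y) \<le> mnorm n x + mnorm n y"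
proof (rule mnorm_least)
  fix \<xi>
  have "vnorm n (mapp n (x + y) \<xi>) = vnorm n (\<lambda>u. mapp n x \<xi> u + mapp n y \<xi> u)"
    by (simp add: mapp_def algebra_simps sum.distrib)
  also have "\<dots> \<le> vnorm n (mapp n x \<xi>) + vnorm n (mapp n y \<xi>)"
    by (rule vnorm_add)
  also have "\<dots> \<le> (mnorm n x + mnorm n y) * vnorm n \<xi>"
    using mnorm_bound[of n x \<xi>] mnorm_bound[of n y \<xi>] by (simp add: algebra_simps)
  finally show "vnorm n (mapp n (x + y) \<xi>) \<le> (mnorm n x + mnorm n y) * vnorm n \<xi>" .
qed simp

lemma mnorm_mscale_le: "mnorm n (mscale c x) \<le> cmod c * mnorm n x"
proof (rule mnorm_least)
  fix \<xi>
  have "mapp n (mscale c x) \<xi> = (\<lambda>u. c * mapp n x \<xi> u)"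
    by (simp add: mapp_def mscale_def sum_distrib_left mult.assoc)
  then show "vnorm n (mapp n (mscale c x) \<xi>) \<le> cmod c * mnorm n x * vnorm n \<xi>"
    using mnorm_bound[of n x \<xi>] by (simp add: vnorm_scale mult.assoc mult_left_mono)
qed simp

lemma mnorm_mscale: "mnorm n (mscale c x) = cmod c * mnorm n x"
proof (cases "c = 0")
  case True
  have "mnorm n (mscale c x) \<le> 0"
    using mnorm_mscale_le[of n c x] True by simp
  then show ?thesis
    using True mnorm_nonneg[of n "mscale c x"] by (simp only: norm_zero)
next
  case False
  have "mnorm n (mscale (inverse c) (mscale c x)) \<le> cmod (inverse c) * mnorm n (mscale c x)"
    by (rule mnorm_mscale_le)
  moreover have "mscale (inverse c) (mscale c x) = x"
    using False by (simp add: mscale_def fun_eq_iff)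
  ultimately have "cmod c * mnorm n x \<le> mnorm n (mscale c x)"
    using False by (simp add: norm_inverse norm_divide field_simps)
  then show ?thesis
    using mnorm_mscale_le[of n c x] by simp
qed

lemma mnorm_zero [simp]: "mnorm n 0 = 0"
  using mnorm_mscale[of n 0 0] by simp

lemma mnorm_uminus: "mnorm n (- x) = mnorm n x"
  using mnorm_mscale[of n "-1" x] by (simp add: mscale_def fun_Compl_def)

lemma mnorm_minus_commute: "mnorm n (x - y) = mnorm n (y - x)"
  using mnorm_uminus[of n "x - y"] by simp

lemma mnorm_diff_triangle: "mnorm n (x - z) \<le> mnorm n (x - y) + mnorm n (y - z)"
  using mnorm_triangle[of n "x - y" "y - z"] by simp

lemma mnorm_diff_ineq: "\<bar>mnorm n x - mnorm n y\<bar> \<le> mnorm n (x - y)"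
  using mnorm_triangle[of n "x - y" y] mnorm_triangle[of n "y - x" x]
  by (simp add: mnorm_minus_commute)

lemma mnorm_mmul: "mnorm n (mmul n x y) \<le> mnorm n x * mnorm n y"
proof (rule mnorm_least)
  fix \<xi>
  have "vnorm n (mapp n (mmul n x y) \<xi>) \<le> mnorm n x * vnorm n (mapp n y \<xi>)"
    unfolding mapp_mmul by (rule mnorm_bound)
  also have "\<dots> \<le> mnorm n x * (mnorm n y * vnorm n \<xi>)"
    by (intro mult_left_mono mnorm_bound) simp
  finally show "vnorm n (mapp n (mmul n x y) \<xi>) \<le> mnorm n x * mnorm n y * vnorm n \<xi>"
    by (simp add: mult.assoc)
qed simp

lemma mnorm_mone: "mnorm n (mone n) = 1"
proof (rule antisym)
  have app: "vnorm n (mapp n (mone n) \<xi>) = vnorm n \<xi>" for \<xi>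
    unfolding vnorm_def
  proof (rule L2_set_cong)
    fix u assume u: "u \<in> words n"
    have "mapp n (mone n) \<xi> u = (\<Sum>v\<in>words n. if u = v then \<xi> v else 0)"
      unfolding mapp_def mone_def using u by (intro sum.cong) auto
    then show "cmod (mapp n (mone n) \<xi> u) = cmod (\<xi> u)"
      using u by simp
  qed simp
  show "mnorm n (mone n) \<le> 1"
    by (rule mnorm_least) (simp_all add: app)
  obtain w where w: "w \<in> words n"
    using words_nonempty[of n] by blast
  note one = vnorm_delta[OF w]
  show "1 \<le> mnorm n (mone n)"
    using mnorm_upper[of n "\<lambda>v. if v = w then 1 else 0" "mone n"] by (simp add: app one)
qed

lemma mnorm_cstar: "mnorm n (mmul n (mstar x) x) = (mnorm n x)\<^sup>2"
  and mnorm_mstar: "mnorm n (mstar x) = mnorm n x"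
proof -
  have star_app: "mapp n (mstar x) \<eta> v = (\<Sum>u\<in>words n. cnj (x u v) * \<eta> u)" for x \<eta> v
    by (simp add: mapp_def mstar_def)
  have sq: "(mnorm n x)\<^sup>2 \<le> mnorm n (mmul n (mstar x) x)" for x
  proof -
    let ?C = "mnorm n (mmul n (mstar x) x)"
    have "vnorm n (mapp n x \<xi>) \<le> sqrt ?C * vnorm n \<xi>" for \<xi>
    proof -
      let ?\<eta> = "mapp n (mmul n (mstar x) x) \<xi>"
      have "complex_of_real ((vnorm n (mapp n x \<xi>))\<^sup>2) =
          (\<Sum>u\<in>words n. cnj (mapp n x \<xi> u) * mapp n x \<xi> u)"
        unfolding vnorm_power2 of_real_sum
        by (intro sum.cong refl) (metis complex_norm_square mult.commute of_real_power)
      also have "\<dots> = (\<Sum>u\<in>words n. \<Sum>v\<in>words n. cnj (x u v) * cnj (\<xi> v) * mapp n x \<xi> u)"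
        by (simp add: mapp_def sum_distrib_right)
      also have "\<dots> = (\<Sum>v\<in>words n. \<Sum>u\<in>words n. cnj (x u v) * cnj (\<xi> v) * mapp n x \<xi> u)"
        by (rule sum.swap)
      also have "\<dots> = (\<Sum>v\<in>words n. cnj (\<xi> v) * mapp n (mstar x) (mapp n x \<xi>) v)"
        by (simp add: star_app sum_distrib_left mult_ac)
      finally have "complex_of_real ((vnorm n (mapp n x \<xi>))\<^sup>2) = (\<Sum>v\<in>words n. cnj (\<xi> v) * ?\<eta> v)"
        by (simp add: mapp_mmul)
      then have "(vnorm n (mapp n x \<xi>))\<^sup>2 = cmod (\<Sum>v\<in>words n. cnj (\<xi> v) * ?\<eta> v)"
        by (metis norm_of_real abs_of_nonneg zero_le_power2)
      also have "\<dots> \<le> (\<Sum>v\<in>words n. cmod (\<xi> v) * cmod (?\<eta> v))"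
        by (rule order_trans[OF norm_sum]) (simp add: norm_mult)
      also have "\<dots> \<le> vnorm n \<xi> * vnorm n ?\<eta>"
        using L2_set_mult_ineq[of "\<lambda>v. cmod (\<xi> v)" "\<lambda>v. cmod (?\<eta> v)" "words n"]
        by (simp add: vnorm_def)
      also have "\<dots> \<le> vnorm n \<xi> * (?C * vnorm n \<xi>)"
        by (intro mult_left_mono mnorm_bound) simp
      also have "\<dots> = (sqrt ?C * vnorm n \<xi>)\<^sup>2"
        by (simp add: power2_eq_square)
      finally show ?thesis
        by (rule power2_le_imp_le) simp
    qed
    then have "mnorm n x \<le> sqrt ?C"
      by (intro mnorm_least) auto
    then have "(mnorm n x)\<^sup>2 \<le> (sqrt ?C)\<^sup>2"
      by (intro power_mono) auto
    then show ?thesis by simp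
  qed
  have le: "mnorm n x \<le> mnorm n (mstar x)" for x
  proof (cases "mnorm n x = 0")
    case False
    have "mnorm n x * mnorm n x \<le> mnorm n (mstar x) * mnorm n x"
      using sq[of x] mnorm_mmul[of n "mstar x" x] by (simp add: power2_eq_square)
    then show ?thesis
      using False mnorm_nonneg[of n x] by (simp add: order_less_le)
  qed simp
  show star: "mnorm n (mstar x) = mnorm n x"
    using le[of x] le[of "mstar x"] by simp
  show "mnorm n (mmul n (mstar x) x) = (mnorm n x)\<^sup>2"
    using sq[of x] mnorm_mmul[of n "mstar x" x] star by (simp add: power2_eq_square)
qed

lemma mnorm_entry:
  assumes "u \<in> words n" "v \<in> words n"
  shows "cmod (x u v) \<le> mnorm n x"
proof -
  let ?d = "\<lambda>w. if w = v then 1 else 0 :: complex"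
  note one = vnorm_delta[OF assms(2)]
  have "mapp n x ?d u = (\<Sum>w\<in>words n. if w = v then x u w else 0)"
    unfolding mapp_def by (intro sum.cong) auto
  then have "mapp n x ?d u = x u v"
    using assms by simp
  then have "cmod (x u v) \<le> vnorm n (mapp n x ?d)"
    using vnorm_ge[OF assms(1), of "mapp n x ?d"] by simp
  also have "\<dots> \<le> mnorm n x"
    by (rule mnorm_upper) (simp add: one)
  finally show ?thesis .
qed

lemma mnorm_eq_0: "x \<in> Mat n \<Longrightarrow> mnorm n x = 0 \<Longrightarrow> x = 0"
  by (rule Mat_eqI[of _ n]) (use mnorm_entry[of _ n _ x] in auto)

lemma vnorm_split: "n \<le> m \<Longrightarrow> (vnorm m \<xi>)\<^sup>2 = (\<Sum>c\<in>words (m - n). (vnorm n (\<lambda>a. \<xi> (a @ c)))\<^sup>2)"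
  using sum_words_add[of "\<lambda>w. (cmod (\<xi> w))\<^sup>2" n "m - n"]
    sum.swap[of "\<lambda>a c. (cmod (\<xi> (a @ c)))\<^sup>2" "words (m - n)" "words n"]
  by (simp add: vnorm_power2)

lemma mapp_amp:
  assumes "n \<le> m" "a \<in> words n" "c \<in> words (m - n)"
  shows "mapp m (amp n m x) \<xi> (a @ c) = mapp n x (\<lambda>b. \<xi> (b @ c)) a"
proof -
  have "mapp m (amp n m x) \<xi> (a @ c) =
      (\<Sum>b\<in>words n. \<Sum>d\<in>words (m - n). amp n m x (a @ c) (b @ d) * \<xi> (b @ d))"
    using sum_words_add[of "\<lambda>w. amp n m x (a @ c) w * \<xi> w" n "m - n"] assms by (simp add: mapp_def)
  also have "\<dots> = (\<Sum>b\<in>words n. \<Sum>d\<in>words (m - n). if c = d then x a b * \<xi> (b @ d) else 0)"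
    using assms by (intro sum.cong refl) (auto simp: amp_entry)
  also have "\<dots> = mapp n x (\<lambda>b. \<xi> (b @ c)) a"
    using assms by (simp add: mapp_def)
  finally show ?thesis .
qed

lemma mnorm_amp:
  assumes "n \<le> m"
  shows "mnorm m (amp n m x) = mnorm n x"
proof (rule antisym)
  have cut: "vnorm n (\<lambda>a. mapp m (amp n m x) \<xi> (a @ c)) = vnorm n (mapp n x (\<lambda>b. \<xi> (b @ c)))"
    if "c \<in> words (m - n)" for c \<xi>
    unfolding vnorm_def using assms that by (intro L2_set_cong refl) (simp add: mapp_amp)
  show "mnorm m (amp n m x) \<le> mnorm n x"
  proof (rule mnorm_least)
    fix \<xi>
    have "(vnorm m (mapp m (amp n m x) \<xi>))\<^sup>2 =
        (\<Sum>c\<in>words (m - n). (vnorm n (mapp n x (\<lambda>b. \<xi> (b @ c))))\<^sup>2)"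
      unfolding vnorm_split[OF assms] by (intro sum.cong refl) (simp add: cut)
    also have "\<dots> \<le> (\<Sum>c\<in>words (m - n). (mnorm n x * vnorm n (\<lambda>b. \<xi> (b @ c)))\<^sup>2)"
      by (intro sum_mono power_mono mnorm_bound) simp
    also have "\<dots> = (mnorm n x * vnorm m \<xi>)\<^sup>2"
      by (simp add: power_mult_distrib vnorm_split[OF assms] sum_distrib_left)
    finally show "vnorm m (mapp m (amp n m x) \<xi>) \<le> mnorm n x * vnorm m \<xi>"
      by (rule power2_le_imp_le) simp
  qed simp
  show "mnorm n x \<le> mnorm m (amp n m x)"
  proof (rule mnorm_least)
    fix \<xi> :: "3 list \<Rightarrow> complex"
    obtain e where e: "e \<in> words (m - n)"
      using words_nonempty[of "m - n"] by blast
    define \<zeta> where "\<zeta> w = (if drop n w = e then \<xi> (take n w) else 0)" for w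
    have z: "(\<lambda>a. \<zeta> (a @ c)) a = (if c = e then \<xi> a else 0)" if "a \<in> words n" for a c
      using that by (auto simp: \<zeta>_def words_def)
    have "(vnorm n (\<lambda>a. \<zeta> (a @ c)))\<^sup>2 = (if c = e then (vnorm n \<xi>)\<^sup>2 else 0)" for c
      unfolding vnorm_power2 by (simp add: z)
    then have "(vnorm m \<zeta>)\<^sup>2 = (vnorm n \<xi>)\<^sup>2"
      unfolding vnorm_split[OF assms] using e by simp
    then have nz: "vnorm m \<zeta> = vnorm n \<xi>"
      by (simp add: power2_eq_iff_nonneg)
    have "mapp n x (\<lambda>b. \<zeta> (b @ e)) = mapp n x \<xi>"
      by (simp add: mapp_def z)
    then have "(vnorm n (mapp n x \<xi>))\<^sup>2 \<le> (\<Sum>c\<in>words (m - n). (vnorm n (mapp n x (\<lambda>b. \<zeta> (b @ c))))\<^sup>2)"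
      using member_le_sum[of e "words (m - n)" "\<lambda>c. (vnorm n (mapp n x (\<lambda>b. \<zeta> (b @ c))))\<^sup>2"] e
      by simp
    also have "\<dots> = (vnorm m (mapp m (amp n m x) \<zeta>))\<^sup>2"
      unfolding vnorm_split[OF assms, of "mapp m (amp n m x) \<zeta>"] by (intro sum.cong refl) (simp add: cut)
    finally have "vnorm n (mapp n x \<xi>) \<le> vnorm m (mapp m (amp n m x) \<zeta>)"
      by (rule power2_le_imp_le) simp
    also have "\<dots> \<le> mnorm m (amp n m x) * vnorm n \<xi>"
      using mnorm_bound[of m "amp n m x" \<zeta>] nz by simp
    finally show "vnorm n (mapp n x \<xi>) \<le> mnorm m (amp n m x) * vnorm n \<xi>" .
  qed simp
qed


section \<open>The C*-inductive limit\<close>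

text \<open>
  \<open>UHF(3\<^sup>\<infinity>)\<close> is the completion of the inductive system of the \<open>Mat n\<close> with connecting maps
  \<open>amp n m\<close>: a point is represented by a sequence of members of the \<open>Mat n\<close> that is Cauchy along
  the connecting maps, and two sequences represent the same point if their difference is a null
  sequence.
\<close>

definition coherent :: "(nat \<Rightarrow> tmat) \<Rightarrow> bool" where
  "coherent X \<longleftrightarrow> (\<forall>n. X n \<in> Mat n) \<and>
     (\<forall>e>0. \<exists>N. \<forall>n\<ge>N. \<forall>m\<ge>n. mnorm m (X m - amp n m (X n)) < e)"

definition uhfrel :: "(nat \<Rightarrow> tmat) \<Rightarrow> (nat \<Rightarrow> tmat) \<Rightarrow> bool" where
  "uhfrel X Y \<longleftrightarrow> coherent X \<and> coherent Y \<and> (\<lambda>n. mnorm n (X n - Y n)) \<longlonglongrightarrow> 0"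

lemma uhfrel_refl_iff [simp]: "uhfrel X X \<longleftrightarrow> coherent X"
  by (simp add: uhfrel_def)

lemma coherentD:
  assumes "coherent X"
  shows "X n \<in> Mat n" "e > 0 \<Longrightarrow> \<exists>N. \<forall>n\<ge>N. \<forall>m\<ge>n. mnorm m (X m - amp n m (X n)) < e"
  using assms by (auto simp: coherent_def)

lemma coherent_const: "(\<And>n m. n \<le> m \<Longrightarrow> amp n m (X n) = X m) \<Longrightarrow> (\<And>n. X n \<in> Mat n) \<Longrightarrow> coherent X"
  by (auto simp: coherent_def)

lemma null_le:
  assumes "Y \<longlonglongrightarrow> 0" "\<And>n. mnorm n (X n) \<le> Y n"
  shows "(\<lambda>n. mnorm n (X n)) \<longlonglongrightarrow> 0"
  using assms by (intro tendsto_sandwich[OF _ _ tendsto_const assms(1)]) auto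

quotient_type uhf = "nat \<Rightarrow> tmat" / partial: uhfrel
proof (rule part_equivpI)
  show "\<exists>X. uhfrel X X"
    by (auto intro!: exI[of _ "\<lambda>_. 0"] coherent_const)
  show "symp uhfrel"
    by (auto simp: symp_def uhfrel_def mnorm_minus_commute)
  show "transp uhfrel"
  proof (rule transpI)
    fix X Y Z assume a: "uhfrel X Y" "uhfrel Y Z"
    have "(\<lambda>n. mnorm n (X n - Y n) + mnorm n (Y n - Z n)) \<longlonglongrightarrow> 0 + 0"
      using a by (intro tendsto_add) (auto simp: uhfrel_def)
    then have "(\<lambda>n. mnorm n (X n - Z n)) \<longlonglongrightarrow> 0"
      by (intro null_le[of "\<lambda>n. mnorm n (X n - Y n) + mnorm n (Y n - Z n)"])
        (auto intro: mnorm_diff_triangle)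
    with a show "uhfrel X Z" by (auto simp: uhfrel_def)
  qed
qed

lemma abs_uhf_eq_iff: "coherent X \<Longrightarrow> coherent Y \<Longrightarrow>
    abs_uhf X = abs_uhf Y \<longleftrightarrow> (\<lambda>n. mnorm n (X n - Y n)) \<longlonglongrightarrow> 0"
  using Quotient_rel[OF Quotient_uhf, of X Y] by (auto simp: uhfrel_def)

lemma uhf_rep:
  obtains X where "coherent X" "a = abs_uhf X"
  using Quotient_abs_rep[OF Quotient_uhf, of a] Quotient_rep_reflp[OF Quotient_uhf, of a]
  by (metis uhfrel_refl_iff)

lemma coherent_mnorm_Cauchy:
  assumes "coherent X"
  shows "Cauchy (\<lambda>n. mnorm n (X n))"
proof (rule CauchyI')
  fix e :: real assume "e > 0"
  then obtain N where N: "\<And>n m. n \<ge> N \<Longrightarrow> m \<ge> n \<Longrightarrow> mnorm m (X m - amp n m (X n)) < e"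
    using coherentD(2)[OF assms] by metis
  show "\<exists>M. \<forall>m\<ge>M. \<forall>n>m. dist (mnorm m (X m)) (mnorm n (X n)) < e"
  proof (intro exI[of _ N] allI impI)
    fix m n assume "m \<ge> N" "n > m"
    then show "dist (mnorm m (X m)) (mnorm n (X n)) < e"
      using N[of m n] mnorm_diff_ineq[of n "X n" "amp m n (X m)"] mnorm_amp[of m n "X m"]
      by (simp add: dist_real_def)
  qed
qed

lemma coherent_bounded:
  assumes "coherent X"
  obtains B where "B > 0" "\<And>n. mnorm n (X n) \<le> B"
proof -
  have "Bseq (\<lambda>n. mnorm n (X n))"
    using coherent_mnorm_Cauchy[OF assms] by (rule Cauchy_Bseq)
  then show ?thesis
    using that by (auto simp: Bseq_def)
qed

lemma coherent_add:
  assumes "coherent X" "coherent Y"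
  shows "coherent (\<lambda>n. X n + Y n)"
  unfolding coherent_def
proof (intro conjI allI impI)
  fix n show "X n + Y n \<in> Mat n"
    using assms by (intro Mat_add coherentD)
next
  fix e :: real assume "e > 0"
  then have "e / 2 > 0" by simp
  then obtain N M where
    N: "\<And>n m. n \<ge> N \<Longrightarrow> m \<ge> n \<Longrightarrow> mnorm m (X m - amp n m (X n)) < e / 2" and
    M: "\<And>n m. n \<ge> M \<Longrightarrow> m \<ge> n \<Longrightarrow> mnorm m (Y m - amp n m (Y n)) < e / 2"
    using coherentD(2)[OF assms(1)] coherentD(2)[OF assms(2)] by metis
  show "\<exists>N. \<forall>n\<ge>N. \<forall>m\<ge>n. mnorm m (X m + Y m - amp n m (X n + Y n)) < e"
  proof (intro exI[of _ "max N M"] allI impI)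
    fix n m assume nm: "n \<ge> max N M" "m \<ge> n"
    have "X m + Y m - amp n m (X n + Y n) = (X m - amp n m (X n)) + (Y m - amp n m (Y n))"
      by (simp add: amp_add)
    then have "mnorm m (X m + Y m - amp n m (X n + Y n)) \<le>
        mnorm m (X m - amp n m (X n)) + mnorm m (Y m - amp n m (Y n))"
      using mnorm_triangle by metis
    also have "\<dots> < e"
      using N[of n m] M[of n m] nm by simp
    finally show "mnorm m (X m + Y m - amp n m (X n + Y n)) < e" .
  qed
qed

lemma coherent_mscale:
  assumes "coherent X"
  shows "coherent (\<lambda>n. mscale c (X n))"
  unfolding coherent_def
proof (intro conjI allI impI)
  fix n show "mscale c (X n) \<in> Mat n"
    using assms by (intro Mat_mscale coherentD)
next
  fix e :: real assume "e > 0"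
  then have "e / (cmod c + 1) > 0"
    by (intro divide_pos_pos) (auto intro: add_nonneg_pos)
  then obtain N where
    N: "\<And>n m. n \<ge> N \<Longrightarrow> m \<ge> n \<Longrightarrow> mnorm m (X m - amp n m (X n)) < e / (cmod c + 1)"
    using coherentD(2)[OF assms(1)] by metis
  show "\<exists>N. \<forall>n\<ge>N. \<forall>m\<ge>n. mnorm m (mscale c (X m) - amp n m (mscale c (X n))) < e"
  proof (intro exI[of _ N] allI impI)
    fix n m assume nm: "n \<ge> N" "m \<ge> n"
    have "mscale c (X m) - amp n m (mscale c (X n)) = mscale c (X m - amp n m (X n))"
      by (simp add: amp_mscale tmat.scale_right_diff_distrib)
    then have "mnorm m (mscale c (X m) - amp n m (mscale c (X n))) =
        cmod c * mnorm m (X m - amp n m (X n))"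
      by (simp add: mnorm_mscale)
    also have "\<dots> \<le> (cmod c + 1) * mnorm m (X m - amp n m (X n))"
      by (intro mult_right_mono) auto
    also have "\<dots> < e"
    proof -
      have "0 < cmod c + 1" by (intro add_nonneg_pos) auto
      then show ?thesis
        using N[OF nm] by (simp add: field_simps)
    qed
    finally show "mnorm m (mscale c (X m) - amp n m (mscale c (X n))) < e" .
  qed
qed

lemma coherent_uminus: "coherent X \<Longrightarrow> coherent (\<lambda>n. - X n)"
  using coherent_mscale[of X "-1"] by (simp add: mscale_def fun_Compl_def)

lemma coherent_diff: "coherent X \<Longrightarrow> coherent Y \<Longrightarrow> coherent (\<lambda>n. X n - Y n)"
  using coherent_add[of X "\<lambda>n. - Y n"] coherent_uminus[of Y] by simp

lemma coherent_mstar: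
  assumes "coherent X"
  shows "coherent (\<lambda>n. mstar (X n))"
  using assms unfolding coherent_def
  by (simp add: Mat_mstar amp_mstar mnorm_mstar flip: mstar_diff)

lemma coherent_mmul:
  assumes "coherent X" "coherent Y"
  shows "coherent (\<lambda>n. mmul n (X n) (Y n))"
  unfolding coherent_def
proof (intro conjI allI impI)
  fix n show "mmul n (X n) (Y n) \<in> Mat n"
    using assms by (intro Mat_mmul coherentD)
next
  fix e :: real assume e: "e > 0"
  obtain B where B: "B > 0" "\<And>n. mnorm n (X n) \<le> B"
    using coherent_bounded[OF assms(1)] by metis
  obtain C where C: "C > 0" "\<And>n. mnorm n (Y n) \<le> C"
    using coherent_bounded[OF assms(2)] by metis
  have "e / (2 * C) > 0" "e / (2 * B) > 0" using e B C by simp_all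
  then obtain N M where
    N: "\<And>n m. n \<ge> N \<Longrightarrow> m \<ge> n \<Longrightarrow> mnorm m (X m - amp n m (X n)) < e / (2 * C)" and
    M: "\<And>n m. n \<ge> M \<Longrightarrow> m \<ge> n \<Longrightarrow> mnorm m (Y m - amp n m (Y n)) < e / (2 * B)"
    using coherentD(2)[OF assms(1)] coherentD(2)[OF assms(2)] by metis
  show "\<exists>N. \<forall>n\<ge>N. \<forall>m\<ge>n. mnorm m (mmul m (X m) (Y m) - amp n m (mmul n (X n) (Y n))) < e"
  proof (intro exI[of _ "max N M"] allI impI)
    fix n m assume nm: "n \<ge> max N M" "m \<ge> n"
    let ?x = "amp n m (X n)" and ?y = "amp n m (Y n)"
    have "mmul m (X m) (Y m) - amp n m (mmul n (X n) (Y n)) =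
        mmul m (X m) (Y m - ?y) + mmul m (X m - ?x) ?y"
      using assms nm by (simp add: amp_mmul coherentD mmul_diff_left mmul_diff_right)
    then have "mnorm m (mmul m (X m) (Y m) - amp n m (mmul n (X n) (Y n))) \<le>
        mnorm m (mmul m (X m) (Y m - ?y)) + mnorm m (mmul m (X m - ?x) ?y)"
      using mnorm_triangle by metis
    also have "\<dots> \<le> mnorm m (X m) * mnorm m (Y m - ?y) + mnorm m (X m - ?x) * mnorm m ?y"
      by (intro add_mono mnorm_mmul)
    also have "\<dots> \<le> B * mnorm m (Y m - ?y) + mnorm m (X m - ?x) * C"
      using B(2)[of m] C(2)[of n] nm by (intro add_mono mult_right_mono mult_left_mono) (auto simp: mnorm_amp)
    also have "\<dots> < B * (e / (2 * B)) + e / (2 * C) * C"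
      using N[of n m] M[of n m] nm B C
      by (intro add_strict_mono mult_strict_left_mono mult_strict_right_mono) auto
    also have "\<dots> = e"
      using B C by simp
    finally show "mnorm m (mmul m (X m) (Y m) - amp n m (mmul n (X n) (Y n))) < e" .
  qed
qed

instantiation uhf :: "{zero, one, plus, minus, uminus, times, scaleR}"
begin

lift_definition zero_uhf :: uhf is "\<lambda>_. 0"
  by (auto intro!: coherent_const)

lift_definition one_uhf :: uhf is mone
  by (auto intro!: coherent_const simp: amp_mone)

lift_definition plus_uhf :: "uhf \<Rightarrow> uhf \<Rightarrow> uhf" is "\<lambda>X Y n. X n + Y n"
proof -
  fix X X' Y Y' assume a: "uhfrel X X'" "uhfrel Y Y'"
  have "(\<lambda>n. mnorm n (X n - X' n) + mnorm n (Y n - Y' n)) \<longlonglongrightarrow> 0 + 0"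
    using a by (intro tendsto_add) (auto simp: uhfrel_def)
  moreover have "mnorm n (X n + Y n - (X' n + Y' n)) \<le> mnorm n (X n - X' n) + mnorm n (Y n - Y' n)" for n
    using mnorm_triangle[of n "X n - X' n" "Y n - Y' n"] by (simp add: algebra_simps)
  ultimately have "(\<lambda>n. mnorm n (X n + Y n - (X' n + Y' n))) \<longlonglongrightarrow> 0"
    by (intro null_le[of "\<lambda>n. mnorm n (X n - X' n) + mnorm n (Y n - Y' n)"]) simp_all
  then show "uhfrel (\<lambda>n. X n + Y n) (\<lambda>n. X' n + Y' n)"
    using a by (auto simp: uhfrel_def intro: coherent_add)
qed

lift_definition uminus_uhf :: "uhf \<Rightarrow> uhf" is "\<lambda>X n. - X n"
proof -
  fix X X' assume a: "uhfrel X X'"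
  have "mnorm n (- X n - - X' n) = mnorm n (X n - X' n)" for n
    using mnorm_minus_commute[of n "X n" "X' n"] by simp
  with a show "uhfrel (\<lambda>n. - X n) (\<lambda>n. - X' n)"
    by (auto simp: uhfrel_def intro: coherent_uminus)
qed

definition minus_uhf :: "uhf \<Rightarrow> uhf \<Rightarrow> uhf" where
  "a - b = a + (- b)" for a b :: uhf

lift_definition times_uhf :: "uhf \<Rightarrow> uhf \<Rightarrow> uhf" is "\<lambda>X Y n. mmul n (X n) (Y n)"
proof -
  fix X X' Y Y' assume a: "uhfrel X X'" "uhfrel Y Y'"
  obtain B where B: "B > 0" "\<And>n. mnorm n (X n) \<le> B"
    using coherent_bounded a unfolding uhfrel_def by metis
  obtain C where C: "C > 0" "\<And>n. mnorm n (Y' n) \<le> C"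
    using coherent_bounded a unfolding uhfrel_def by metis
  let ?d = "\<lambda>n. B * mnorm n (Y n - Y' n) + mnorm n (X n - X' n) * C"
  have "?d \<longlonglongrightarrow> B * 0 + 0 * C"
    using a by (intro tendsto_intros) (auto simp: uhfrel_def)
  moreover have "mnorm n (mmul n (X n) (Y n) - mmul n (X' n) (Y' n)) \<le> ?d n" for n
  proof -
    have "mmul n (X n) (Y n) - mmul n (X' n) (Y' n) =
        mmul n (X n) (Y n - Y' n) + mmul n (X n - X' n) (Y' n)"
      by (simp add: mmul_diff_left mmul_diff_right)
    then have "mnorm n (mmul n (X n) (Y n) - mmul n (X' n) (Y' n)) \<le>
        mnorm n (mmul n (X n) (Y n - Y' n)) + mnorm n (mmul n (X n - X' n) (Y' n))"
      using mnorm_triangle by metis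
    also have "\<dots> \<le> mnorm n (X n) * mnorm n (Y n - Y' n) + mnorm n (X n - X' n) * mnorm n (Y' n)"
      by (intro add_mono mnorm_mmul)
    also have "\<dots> \<le> ?d n"
      using B C by (intro add_mono mult_right_mono mult_left_mono) auto
    finally show ?thesis .
  qed
  ultimately have "(\<lambda>n. mnorm n (mmul n (X n) (Y n) - mmul n (X' n) (Y' n))) \<longlonglongrightarrow> 0"
    by (intro null_le[of ?d]) simp_all
  then show "uhfrel (\<lambda>n. mmul n (X n) (Y n)) (\<lambda>n. mmul n (X' n) (Y' n))"
    using a by (auto simp: uhfrel_def intro: coherent_mmul)
qed

lift_definition scaleR_uhf :: "real \<Rightarrow> uhf \<Rightarrow> uhf" is "\<lambda>r X n. mscale (complex_of_real r) (X n)"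
proof -
  fix r X X' assume a: "uhfrel X X'"
  have "mnorm n (mscale (complex_of_real r) (X n) - mscale (complex_of_real r) (X' n)) =
      cmod r * mnorm n (X n - X' n)" for n
    by (simp add: mnorm_mscale flip: tmat.scale_right_diff_distrib)
  moreover have "(\<lambda>n. cmod r * mnorm n (X n - X' n)) \<longlonglongrightarrow> cmod r * 0"
    using a by (intro tendsto_intros) (auto simp: uhfrel_def)
  ultimately show "uhfrel (\<lambda>n. mscale (complex_of_real r) (X n)) (\<lambda>n. mscale (complex_of_real r) (X' n))"
    using a by (auto simp: uhfrel_def intro: coherent_mscale)
qed

instance ..

end

lift_definition unorm :: "uhf \<Rightarrow> real" is "\<lambda>X. lim (\<lambda>n. mnorm n (X n))"
proof -
  fix X Y assume a: "uhfrel X Y"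
  then obtain l where l: "(\<lambda>n. mnorm n (X n)) \<longlonglongrightarrow> l"
    using coherent_mnorm_Cauchy Cauchy_convergent unfolding uhfrel_def convergent_def by metis
  have "(\<lambda>n. mnorm n (Y n) - mnorm n (X n)) \<longlonglongrightarrow> 0"
  proof (rule Lim_null_comparison)
    show "\<forall>\<^sub>F n in sequentially. norm (mnorm n (Y n) - mnorm n (X n)) \<le> mnorm n (X n - Y n)"
      using mnorm_diff_ineq mnorm_minus_commute by (intro always_eventually) (simp, metis)
    show "(\<lambda>n. mnorm n (X n - Y n)) \<longlonglongrightarrow> 0"
      using a by (simp add: uhfrel_def)
  qed
  from tendsto_add[OF this l] have "(\<lambda>n. mnorm n (Y n)) \<longlonglongrightarrow> l"
    by simp
  with l show "lim (\<lambda>n. mnorm n (X n)) = lim (\<lambda>n. mnorm n (Y n))"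
    by (simp add: limI)
qed

lift_definition cscale :: "complex \<Rightarrow> uhf \<Rightarrow> uhf" is "\<lambda>c X n. mscale c (X n)"
proof -
  fix c X X' assume a: "uhfrel X X'"
  have "mnorm n (mscale c (X n) - mscale c (X' n)) = cmod c * mnorm n (X n - X' n)" for n
    by (simp add: mnorm_mscale flip: tmat.scale_right_diff_distrib)
  moreover have "(\<lambda>n. cmod c * mnorm n (X n - X' n)) \<longlonglongrightarrow> cmod c * 0"
    using a by (intro tendsto_intros) (auto simp: uhfrel_def)
  ultimately show "uhfrel (\<lambda>n. mscale c (X n)) (\<lambda>n. mscale c (X' n))"
    using a by (auto simp: uhfrel_def intro: coherent_mscale)
qed

lift_definition ustar :: "uhf \<Rightarrow> uhf" is "\<lambda>X n. mstar (X n)"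
  by (simp add: uhfrel_def coherent_mstar mnorm_mstar flip: mstar_diff)

lemma zero_uhf_abs: "0 = abs_uhf (\<lambda>_. 0)"
  and one_uhf_abs: "1 = abs_uhf mone"
  by (simp_all add: zero_uhf_def one_uhf_def)

lemma coherent_zero: "coherent (\<lambda>_. 0)"
  and coherent_mone: "coherent mone"
  by (auto intro!: coherent_const simp: amp_mone)

lemma minus_uhf_abs: "coherent X \<Longrightarrow> coherent Y \<Longrightarrow> abs_uhf X - abs_uhf Y = abs_uhf (\<lambda>n. X n - Y n)"
  by (simp add: minus_uhf_def uminus_uhf.abs_eq plus_uhf.abs_eq coherent_uminus)

lemmas uhf_abs = plus_uhf.abs_eq minus_uhf_abs uminus_uhf.abs_eq times_uhf.abs_eq
  scaleR_uhf.abs_eq cscale.abs_eq ustar.abs_eq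

lemmas coherent_intros = coherent_zero coherent_mone coherent_add coherent_diff coherent_uminus
  coherent_mmul coherent_mscale coherent_mstar

lemma unorm_tendsto:
  assumes "coherent X"
  shows "(\<lambda>n. mnorm n (X n)) \<longlonglongrightarrow> unorm (abs_uhf X)"
  using coherent_mnorm_Cauchy[OF assms] Cauchy_convergent convergent_LIMSEQ_iff
  by (metis assms unorm.abs_eq uhfrel_refl_iff)

lemma unorm_eqI: "coherent X \<Longrightarrow> (\<lambda>n. mnorm n (X n)) \<longlonglongrightarrow> l \<Longrightarrow> unorm (abs_uhf X) = l"
  using unorm_tendsto LIMSEQ_unique by blast

lemma unorm_cscale: "unorm (cscale c a) = cmod c * unorm a"
proof (cases a rule: uhf_rep)
  case (1 X)
  then show ?thesis
    by (auto simp: uhf_abs mnorm_mscale coherent_mscale intro!: unorm_eqI tendsto_mult_left unorm_tendsto)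
qed

lemma scaleR_cscale: "r *\<^sub>R a = cscale (complex_of_real r) a" for a :: uhf
  by (cases a rule: uhf_rep) (simp add: uhf_abs)

instantiation uhf :: real_normed_algebra_1
begin

definition norm_uhf :: "uhf \<Rightarrow> real" where
  "norm_uhf = unorm"

definition dist_uhf :: "uhf \<Rightarrow> uhf \<Rightarrow> real" where
  "dist_uhf a b = norm (a - b)"

definition sgn_uhf :: "uhf \<Rightarrow> uhf" where
  "sgn_uhf a = a /\<^sub>R norm a"

definition uniformity_uhf :: "(uhf \<times> uhf) filter" where
  "uniformity_uhf = (INF e\<in>{0 <..}. principal {(a, b). dist a b < e})"

definition open_uhf :: "uhf set \<Rightarrow> bool" where
  "open_uhf U \<longleftrightarrow> (\<forall>a\<in>U. \<forall>\<^sub>F (a', b) in uniformity. a' = a \<longrightarrow> b \<in> U)"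

instance
proof
  fix a b c :: uhf and r s :: real and U :: "uhf set"
  obtain X where X: "coherent X" "a = abs_uhf X" by (rule uhf_rep)
  obtain Y where Y: "coherent Y" "b = abs_uhf Y" by (rule uhf_rep)
  obtain Z where Z: "coherent Z" "c = abs_uhf Z" by (rule uhf_rep)
  note XYZ = X Y Z uhf_abs coherent_intros zero_uhf_abs one_uhf_abs
  show "a + b + c = a + (b + c)" by (simp add: XYZ add.assoc)
  show "a + b = b + a" by (simp add: XYZ add.commute)
  show "0 + a = a" by (simp add: XYZ)
  show "- a + a = 0" by (simp add: XYZ)
  show "a - b = a + (- b)" by (simp add: XYZ)
  show "r *\<^sub>R (a + b) = r *\<^sub>R a + r *\<^sub>R b" by (simp add: XYZ tmat.scale_right_distrib)
  show "(r + s) *\<^sub>R a = r *\<^sub>R a + s *\<^sub>R a" by (simp add: XYZ tmat.scale_left_distrib)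
  show "r *\<^sub>R s *\<^sub>R a = (r * s) *\<^sub>R a" by (simp add: XYZ)
  show "1 *\<^sub>R a = a" by (simp add: XYZ)
  show "a * b * c = a * (b * c)" by (simp add: XYZ mmul_assoc)
  show "(a + b) * c = a * c + b * c" by (simp add: XYZ mmul_add_left)
  show "a * (b + c) = a * b + a * c" by (simp add: XYZ mmul_add_right)
  show "r *\<^sub>R a * b = r *\<^sub>R (a * b)" by (simp add: XYZ mmul_mscale_left)
  show "a * r *\<^sub>R b = r *\<^sub>R (a * b)" by (simp add: XYZ mmul_mscale_right)
  show "1 * a = a" by (simp add: XYZ mmul_mone_left coherentD)
  show "a * 1 = a" by (simp add: XYZ mmul_mone_right coherentD)
  show one: "norm (1 :: uhf) = 1"
    unfolding one_uhf_abs by (rule unorm_eqI[folded norm_uhf_def]) (simp_all add: coherent_mone mnorm_mone)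
  have zero: "norm (0 :: uhf) = 0"
    unfolding zero_uhf_abs by (rule unorm_eqI[folded norm_uhf_def]) (simp_all add: coherent_zero)
  show "(0 :: uhf) \<noteq> 1"
    using one zero by auto
  show "norm a = 0 \<longleftrightarrow> a = 0"
  proof
    assume "norm a = 0"
    then have "(\<lambda>n. mnorm n (X n - 0)) \<longlonglongrightarrow> 0"
      using unorm_tendsto[folded norm_uhf_def, OF X(1)] X(2) by simp
    then show "a = 0"
      using abs_uhf_eq_iff[OF X(1) coherent_zero] X(2) by (simp add: zero_uhf_abs)
  qed (simp add: zero)
  show "norm (a + b) \<le> norm a + norm b"
  proof (rule LIMSEQ_le)
    show "(\<lambda>n. mnorm n (X n + Y n)) \<longlonglongrightarrow> norm (a + b)"
      using unorm_tendsto[folded norm_uhf_def, of "\<lambda>n. X n + Y n"] by (simp add: XYZ)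
    show "(\<lambda>n. mnorm n (X n) + mnorm n (Y n)) \<longlonglongrightarrow> norm a + norm b"
      unfolding X Y by (intro tendsto_add unorm_tendsto[folded norm_uhf_def] X Y)
  qed (auto intro: mnorm_triangle)
  show "norm (a * b) \<le> norm a * norm b"
  proof (rule LIMSEQ_le)
    show "(\<lambda>n. mnorm n (mmul n (X n) (Y n))) \<longlonglongrightarrow> norm (a * b)"
      using unorm_tendsto[folded norm_uhf_def, of "\<lambda>n. mmul n (X n) (Y n)"] by (simp add: XYZ)
    show "(\<lambda>n. mnorm n (X n) * mnorm n (Y n)) \<longlonglongrightarrow> norm a * norm b"
      unfolding X Y by (intro tendsto_mult unorm_tendsto[folded norm_uhf_def] X Y)
  qed (auto intro: mnorm_mmul)
  show "norm (r *\<^sub>R a) = \<bar>r\<bar> * norm a"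
    by (simp add: scaleR_cscale unorm_cscale[folded norm_uhf_def])
qed (simp_all add: dist_uhf_def sgn_uhf_def uniformity_uhf_def open_uhf_def)

end

lemmas norm_uhf_tendsto = unorm_tendsto[folded norm_uhf_def]
  and norm_uhf_eqI = unorm_eqI[folded norm_uhf_def]
  and norm_cscale = unorm_cscale[folded norm_uhf_def]

text \<open>
  The embedding of \<open>Mat n\<close> into the limit; \<open>iota n x\<close> is only meaningful for \<open>x\<close> in \<open>Mat n\<close>.
\<close>

definition iota :: "nat \<Rightarrow> tmat \<Rightarrow> uhf" where
  "iota n x = abs_uhf (\<lambda>k. if n \<le> k then amp n k x else 0)"

lemma coherent_iota:
  assumes "x \<in> Mat n"
  shows "coherent (\<lambda>k. if n \<le> k then amp n k x else 0)"
  unfolding coherent_def using assms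
  by (auto intro!: Mat_amp exI[of _ n] simp: amp_amp)

lemma iota_amp: "x \<in> Mat n \<Longrightarrow> n \<le> m \<Longrightarrow> iota m (amp n m x) = iota n x"
  unfolding iota_def
  by (subst abs_uhf_eq_iff)
    (auto intro!: coherent_iota Mat_amp tendsto_eventually eventually_sequentiallyI[of m] simp: amp_amp)

lemma norm_iota: "x \<in> Mat n \<Longrightarrow> norm (iota n x) = mnorm n x"
  unfolding iota_def
  by (rule norm_uhf_eqI)
    (auto intro!: coherent_iota tendsto_eventually eventually_sequentiallyI[of n] simp: mnorm_amp)

lemma iota_add: "x \<in> Mat n \<Longrightarrow> y \<in> Mat n \<Longrightarrow> iota n (x + y) = iota n x + iota n y"
  and iota_diff: "x \<in> Mat n \<Longrightarrow> y \<in> Mat n \<Longrightarrow> iota n (x - y) = iota n x - iota n y"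
  and iota_mmul: "x \<in> Mat n \<Longrightarrow> y \<in> Mat n \<Longrightarrow> iota n (mmul n x y) = iota n x * iota n y"
  and iota_mscale: "x \<in> Mat n \<Longrightarrow> iota n (mscale c x) = cscale c (iota n x)"
  and iota_mstar: "x \<in> Mat n \<Longrightarrow> iota n (mstar x) = ustar (iota n x)"
  and iota_mone: "iota n (mone n) = 1"
proof -
  assume x: "x \<in> Mat n"
  show "iota n (mscale c x) = cscale c (iota n x)" "iota n (mstar x) = ustar (iota n x)"
    using coherent_iota[OF x] x coherent_iota[OF Mat_mscale[OF x]] coherent_iota[OF Mat_mstar[OF x]]
    unfolding iota_def
    by (auto simp: uhf_abs abs_uhf_eq_iff coherent_intros amp_mscale amp_mstar
        intro!: tendsto_eventually eventually_sequentiallyI[of n])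
  assume y: "y \<in> Mat n"
  show "iota n (x + y) = iota n x + iota n y" "iota n (x - y) = iota n x - iota n y"
    "iota n (mmul n x y) = iota n x * iota n y"
    using coherent_iota[OF x] coherent_iota[OF y] x y coherent_iota[OF Mat_add[OF x y]]
      coherent_iota[OF Mat_diff[OF x y]] coherent_iota[OF Mat_mmul[OF x y]]
    unfolding iota_def
    by (auto simp: uhf_abs abs_uhf_eq_iff coherent_intros amp_add amp_diff amp_mmul
        intro!: tendsto_eventually eventually_sequentiallyI[of n])
next
  show "iota n (mone n) = 1"
    using coherent_iota[OF Mat_mone, of n] unfolding iota_def one_uhf_abs
    by (auto simp: abs_uhf_eq_iff coherent_mone amp_mone
        intro!: tendsto_eventually eventually_sequentiallyI[of n])
qed

lemma iota_tendsto:
  assumes "coherent X"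
  shows "(\<lambda>n. iota n (X n)) \<longlonglongrightarrow> abs_uhf X"
proof (rule metric_LIMSEQ_I)
  fix e :: real assume "e > 0"
  then have "e / 2 > 0" by simp
  then obtain N where N: "\<And>n m. n \<ge> N \<Longrightarrow> m \<ge> n \<Longrightarrow> mnorm m (X m - amp n m (X n)) < e / 2"
    using coherentD(2)[OF assms] by metis
  show "\<exists>N. \<forall>n\<ge>N. dist (iota n (X n)) (abs_uhf X) < e"
  proof (intro exI[of _ N] allI impI)
    fix n assume n: "n \<ge> N"
    let ?Y = "\<lambda>k. if n \<le> k then amp n k (X n) else 0"
    have Y: "coherent ?Y"
      using assms by (intro coherent_iota coherentD)
    have "dist (iota n (X n)) (abs_uhf X) = norm (abs_uhf (\<lambda>k. X k - ?Y k))"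
      unfolding iota_def dist_commute[of _ "abs_uhf X"]
      by (simp add: dist_norm minus_uhf_abs[OF assms Y])
    also have "\<dots> \<le> e / 2"
    proof (rule LIMSEQ_le_const2)
      show "(\<lambda>k. mnorm k (X k - ?Y k)) \<longlonglongrightarrow> norm (abs_uhf (\<lambda>k. X k - ?Y k))"
        by (intro norm_uhf_tendsto coherent_diff assms Y)
      show "\<exists>K. \<forall>k\<ge>K. mnorm k (X k - ?Y k) \<le> e / 2"
        using N[OF n] by (intro exI[of _ n]) (auto intro: less_imp_le)
    qed
    also have "\<dots> < e" using \<open>e > 0\<close> by simp
    finally show "dist (iota n (X n)) (abs_uhf X) < e" .
  qed
qed

lemma iota_dense:
  assumes "e > 0"
  shows "\<exists>n. \<exists>x\<in>Mat n. norm (a - iota n x) < e"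
proof -
  obtain X where X: "coherent X" "a = abs_uhf X" by (rule uhf_rep)
  obtain n where "dist (iota n (X n)) a < e"
    using metric_LIMSEQ_D[OF iota_tendsto[OF X(1)] assms] X(2) by blast
  then show ?thesis
    using coherentD(1)[OF X(1)] by (metis dist_commute dist_norm)
qed

instance uhf :: banach
proof
  fix a :: "nat \<Rightarrow> uhf" assume Cau: "Cauchy a"
  have "\<exists>p x. x \<in> Mat p \<and> norm (a i - iota p x) < inverse (real (Suc i))" for i
    using iota_dense[of "inverse (real (Suc i))" "a i"] by auto
  then obtain p x where px: "\<And>i. x i \<in> Mat (p i)" "\<And>i. norm (a i - iota (p i) (x i)) < inverse (real (Suc i))"
    by metis
  define b where "b i = iota (p i) (x i)" for i
  have null: "(\<lambda>i. a i - b i) \<longlonglongrightarrow> 0"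
    by (rule Lim_null_comparison[OF _ LIMSEQ_inverse_real_of_nat])
      (use px(2) in \<open>auto simp: b_def intro!: always_eventually less_imp_le\<close>)
  have Cb: "Cauchy b"
  proof -
    have "\<exists>M. \<forall>i\<ge>M. \<forall>j\<ge>M. norm (b i - b j) < e" if "e > 0" for e
    proof -
      have e: "e / 3 > 0" using that by simp
      obtain M where M: "\<And>i j. i \<ge> M \<Longrightarrow> j \<ge> M \<Longrightarrow> norm (a i - a j) < e / 3"
        using CauchyD[OF Cau e] by blast
      obtain K where K: "\<And>i. i \<ge> K \<Longrightarrow> norm (a i - b i) < e / 3"
        using LIMSEQ_D[OF null e] by auto
      have "norm (b i - b j) < e" if "i \<ge> max M K" "j \<ge> max M K" for i j
      proof -
        have "b i - b j = (a i - a j) + (a j - b j) - (a i - b i)" by simp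
        then have "norm (b i - b j) \<le> norm (a i - a j) + norm (a j - b j) + norm (a i - b i)"
          by (metis norm_triangle_ineq norm_triangle_ineq4 add_mono_thms_linordered_semiring(3) order_trans)
        then show ?thesis
          using M[of i j] K[of i] K[of j] that by simp
      qed
      then show ?thesis by blast
    qed
    then show ?thesis by (rule CauchyI)
  qed
  define q where "q i = (\<Sum>j\<le>i. p j) + i" for i
  have pq: "p i \<le> q i" for i
    unfolding q_def by (rule trans_le_add1, rule member_le_sum) auto
  have qi: "i \<le> q i" for i by (simp add: q_def)
  define s where "s k = (if q 0 \<le> k then Max {i. q i \<le> k} else 0)" for k
  have fin: "finite {i. q i \<le> k}" for k
    by (rule finite_subset[of _ "{..k}"]) (use qi order_trans in auto)
  have qs: "q (s k) \<le> k" if "q 0 \<le> k" for k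
  proof -
    have "Max {i. q i \<le> k} \<in> {i. q i \<le> k}"
      using that by (intro Max_in fin) auto
    then show ?thesis using that by (simp add: s_def)
  qed
  have s_ge: "i \<le> s k" if "q i \<le> k" for i k
  proof -
    have "q 0 \<le> q i" unfolding q_def by (intro add_mono sum_mono2) auto
    then have "q 0 \<le> k" using that by simp
    then show ?thesis
      using that by (auto simp: s_def intro!: Max_ge fin)
  qed
  define Y where "Y k = (if q 0 \<le> k then amp (p (s k)) k (x (s k)) else 0)" for k
  have ps: "p (s k) \<le> k" if "q 0 \<le> k" for k
    using qs[OF that] pq[of "s k"] by simp
  have YM: "Y k \<in> Mat k" for k
    using px ps by (auto simp: Y_def intro: Mat_amp)
  have Yb: "iota k (Y k) = b (s k)" if "q 0 \<le> k" for k
    using iota_amp[OF px(1) ps[OF that]] that by (simp add: Y_def b_def)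
  have Yn: "mnorm m (Y m - amp n m (Y n)) = norm (b (s m) - b (s n))" if "q 0 \<le> n" "n \<le> m" for n m
  proof -
    have "mnorm m (Y m - amp n m (Y n)) = norm (iota m (Y m - amp n m (Y n)))"
      using that YM by (intro norm_iota[symmetric] Mat_diff Mat_amp)
    also have "\<dots> = norm (iota m (Y m) - iota n (Y n))"
      using that YM by (simp add: iota_diff iota_amp Mat_amp)
    finally show ?thesis
      using that Yb by simp
  qed
  have Y: "coherent Y"
    unfolding coherent_def
  proof (intro conjI allI impI YM)
    fix e :: real assume "e > 0"
    then obtain M where M: "\<And>i j. i \<ge> M \<Longrightarrow> j \<ge> M \<Longrightarrow> norm (b i - b j) < e"
      using CauchyD[OF Cb] by blast
    show "\<exists>N. \<forall>n\<ge>N. \<forall>m\<ge>n. mnorm m (Y m - amp n m (Y n)) < e"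
    proof (intro exI[of _ "max (q 0) (q M)"] allI impI)
      fix n m assume "n \<ge> max (q 0) (q M)" "m \<ge> n"
      then show "mnorm m (Y m - amp n m (Y n)) < e"
        using M s_ge by (simp add: Yn)
    qed
  qed
  have s_lim: "filterlim s at_top sequentially"
    unfolding filterlim_at_top eventually_sequentially using s_ge by blast
  have "(\<lambda>k. iota k (Y k)) \<longlonglongrightarrow> abs_uhf Y"
    by (rule iota_tendsto[OF Y])
  then have bs: "(\<lambda>k. b (s k)) \<longlonglongrightarrow> abs_uhf Y"
    by (rule Lim_transform_eventually) (use Yb in \<open>auto intro!: eventually_sequentiallyI\<close>)
  have "b \<longlonglongrightarrow> abs_uhf Y"
  proof (rule metric_LIMSEQ_I)
    fix e :: real assume "e > 0"
    then have "e / 2 > 0" by simp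
    then obtain M where M: "\<And>i j. i \<ge> M \<Longrightarrow> j \<ge> M \<Longrightarrow> dist (b i) (b j) < e / 2"
      using metric_CauchyD[OF Cb] by blast
    obtain K where K: "\<And>k. k \<ge> K \<Longrightarrow> dist (b (s k)) (abs_uhf Y) < e / 2"
      using metric_LIMSEQ_D[OF bs \<open>e / 2 > 0\<close>] by blast
    show "\<exists>N. \<forall>i\<ge>N. dist (b i) (abs_uhf Y) < e"
    proof (intro exI[of _ M] allI impI)
      fix i assume "i \<ge> M"
      let ?k = "max K (q M)"
      have "dist (b i) (b (s ?k)) < e / 2" "dist (b (s ?k)) (abs_uhf Y) < e / 2"
        using M[OF \<open>i \<ge> M\<close> s_ge[of M ?k]] K[of ?k] by (simp_all only: max.cobounded1 max.cobounded2)
      then show "dist (b i) (abs_uhf Y) < e"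
        using dist_triangle[of "b i" "abs_uhf Y" "b (s ?k)"] by simp
    qed
  qed
  from tendsto_add[OF null this] show "convergent a"
    by (auto simp: convergent_def)
qed

lemma cscale_vector_space: "vector_space cscale"
proof
  fix c d :: complex and a b :: uhf
  obtain X where X: "coherent X" "a = abs_uhf X" by (rule uhf_rep)
  obtain Y where Y: "coherent Y" "b = abs_uhf Y" by (rule uhf_rep)
  note XY = X Y uhf_abs coherent_intros
  show "cscale c (a + b) = cscale c a + cscale c b" by (simp add: XY tmat.scale_right_distrib)
  show "cscale (c + d) a = cscale c a + cscale d a" by (simp add: XY tmat.scale_left_distrib)
  show "cscale c (cscale d a) = cscale (c * d) a" by (simp add: XY)
  show "cscale 1 a = a" by (simp add: XY)
qed

lemma cscale_mult_left: "cscale c a * b = cscale c (a * b)"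
  and cscale_mult_right: "a * cscale c b = cscale c (a * b)"
  and ustar_mult: "ustar (a * b) = ustar b * ustar a"
  and ustar_add: "ustar (a + b) = ustar a + ustar b"
  and ustar_cscale: "ustar (cscale c a) = cscale (cnj c) (ustar a)"
  and ustar_ustar: "ustar (ustar a) = a"
  and norm_ustar_mult: "norm (ustar a * a) = (norm a)\<^sup>2"
proof -
  obtain X where X: "coherent X" "a = abs_uhf X" by (rule uhf_rep)
  obtain Y where Y: "coherent Y" "b = abs_uhf Y" by (rule uhf_rep)
  note XY = X Y uhf_abs coherent_intros
  show "cscale c a * b = cscale c (a * b)" by (simp add: XY mmul_mscale_left)
  show "a * cscale c b = cscale c (a * b)" by (simp add: XY mmul_mscale_right)
  show "ustar (a * b) = ustar b * ustar a" by (simp add: XY mstar_mmul)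
  show "ustar (a + b) = ustar a + ustar b" by (simp add: XY mstar_add)
  show "ustar (cscale c a) = cscale (cnj c) (ustar a)" by (simp add: XY mstar_mscale)
  show "ustar (ustar a) = a" by (simp add: XY)
  have "(\<lambda>n. mnorm n (mmul n (mstar (X n)) (X n))) \<longlonglongrightarrow> (norm a)\<^sup>2"
    unfolding mnorm_cstar X(2) by (intro tendsto_power norm_uhf_tendsto X)
  then show "norm (ustar a * a) = (norm a)\<^sup>2"
    using norm_uhf_eqI[of "\<lambda>n. mmul n (mstar (X n)) (X n)"] by (simp add: XY)
qed

section \<open>Completely positive maps\<close>

text \<open>
  Positivity in the algebra of matrices of size \<open>m\<close> over the algebra with carrier \<open>A\<close>, product
  \<open>mul\<close> and involution \<open>star\<close>: the matrix \<open>a\<close> is of the form \<open>b\<^sup>* b\<close>. Only the entries with indices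
  below \<open>m\<close> matter.
\<close>

definition matrix_positive ::
    "'a set \<Rightarrow> ('a \<Rightarrow> 'a \<Rightarrow> 'a) \<Rightarrow> ('a \<Rightarrow> 'a) \<Rightarrow> nat \<Rightarrow> (nat \<Rightarrow> nat \<Rightarrow> 'a::comm_monoid_add) \<Rightarrow> bool" where
  "matrix_positive A mul star m a \<longleftrightarrow>
     (\<exists>b. (\<forall>i<m. \<forall>j<m. b i j \<in> A) \<and>
          (\<forall>i<m. \<forall>j<m. a i j = (\<Sum>k<m. mul (star (b k i)) (b k j))))"

text \<open>Completely positive linear maps into \<open>uhf\<close> from a *-subalgebra \<open>D\<close> of \<open>Mat n\<close>.\<close>

definition completely_positive :: "nat \<Rightarrow> tmat set \<Rightarrow> (tmat \<Rightarrow> uhf) \<Rightarrow> bool" where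
  "completely_positive n D \<phi> \<longleftrightarrow>
     (\<forall>x\<in>D. \<forall>y\<in>D. \<phi> (x + y) = \<phi> x + \<phi> y) \<and>
     (\<forall>c. \<forall>x\<in>D. \<phi> (mscale c x) = cscale c (\<phi> x)) \<and>
     (\<forall>m a. matrix_positive D (mmul n) mstar m a \<longrightarrow>
        matrix_positive UNIV (*) ustar m (\<lambda>i j. \<phi> (a i j)))"

section \<open>The algebras and maps of the proposition\<close>

definition Diag :: "tmat set" where
  "Diag = {d \<in> Mat 1. \<forall>i j. i \<noteq> j \<longrightarrow> d [i] [j] = 0}"

text \<open>The tensor product of \<open>Mat n\<close> and \<open>Diag\<close>, inside \<open>Mat (n + 1)\<close>.\<close>

definition MatD :: "nat \<Rightarrow> tmat set" where
  "MatD n = tmat.span {tensor n x d | x d. x \<in> Mat n \<and> d \<in> Diag}"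

definition alpha :: "nat \<Rightarrow> 3 \<Rightarrow> tmat" where
  "alpha n j = tensor 1 (munit j j) (tpow (munit 2 2) n)"

definition beta :: "nat \<Rightarrow> 3 \<Rightarrow> tmat" where
  "beta k j = tensor 2 (tensor 1 (munit j j) (munit 1 1) + tensor 1 (munit (j + 2) (j + 2)) (munit 3 3))
                       (tpow (munit 2 2) (k - 1))"

definition A_fin :: "nat \<Rightarrow> tmat set" where
  "A_fin n = tmat.span (range (alpha n) \<union>
     {tensor (n - k) x (beta k j) | x k j. 1 \<le> k \<and> k \<le> n \<and> x \<in> Mat (n - k)})"

definition A_inf :: "uhf set" where
  "A_inf = {a. \<exists>s. (\<forall>n. s n \<in> A_fin n) \<and> (\<lambda>n. iota (n + 1) (s n)) \<longlonglongrightarrow> a}"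

text \<open>
  The slice map into \<open>Mat (n + 1)\<close>. On \<open>Mat (n + 1 + m)\<close> it takes the entries at words that end in
  \<open>m\<close> letters \<open>2\<close>; the definition extends this to the limit algebra by continuity, see
  \<open>rho_iota\<close> and \<open>rho_entry_le\<close> below.
\<close>

lift_definition rho :: "nat \<Rightarrow> uhf \<Rightarrow> tmat" is
  "\<lambda>n X u v. if u \<in> words (n + 1) \<and> v \<in> words (n + 1)
     then lim (\<lambda>m. X (n + 1 + m) (u @ replicate m 2) (v @ replicate m 2)) else 0"
proof (intro ext if_cong refl)
  fix n X Y and u v :: "3 list"
  assume a: "uhfrel X Y" and uv: "u \<in> words (n + 1) \<and> v \<in> words (n + 1)"
  let ?f = "\<lambda>X m. X (n + 1 + m) (u @ replicate m 2) (v @ replicate m 2) :: complex"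
  have d: "(\<lambda>m. ?f X m - ?f Y m) \<longlonglongrightarrow> 0"
  proof (rule Lim_null_comparison)
    show "\<forall>\<^sub>F m in sequentially. norm (?f X m - ?f Y m) \<le>
        mnorm (m + (n + 1)) (X (m + (n + 1)) - Y (m + (n + 1)))"
    proof (intro always_eventually allI)
      fix m
      have "cmod ((X (n + 1 + m) - Y (n + 1 + m)) (u @ replicate m 2) (v @ replicate m 2))
          \<le> mnorm (n + 1 + m) (X (n + 1 + m) - Y (n + 1 + m))"
        by (rule mnorm_entry) (use uv in \<open>auto simp: words_def\<close>)
      then show "norm (?f X m - ?f Y m) \<le> mnorm (m + (n + 1)) (X (m + (n + 1)) - Y (m + (n + 1)))"
        by (simp add: add_ac)
    qed
    show "(\<lambda>m. mnorm (m + (n + 1)) (X (m + (n + 1)) - Y (m + (n + 1)))) \<longlonglongrightarrow> 0"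
      using a LIMSEQ_ignore_initial_segment[of "\<lambda>m. mnorm m (X m - Y m)" 0 "n + 1"]
      by (simp add: uhfrel_def)
  qed
  have "?f X \<longlonglongrightarrow> l \<longleftrightarrow> ?f Y \<longlonglongrightarrow> l" for l
    using Lim_transform[OF _ d, of l] Lim_transform2[OF _ d, of l] by blast
  then show "lim (?f X) = lim (?f Y)"
    by (simp add: lim_def)
qed

lemma rho_outside: "u \<notin> words (n + 1) \<or> v \<notin> words (n + 1) \<Longrightarrow> rho n a u v = 0"
  by (cases a rule: uhf_rep) (auto simp: rho.abs_eq)

lemma rho_tendsto:
  assumes X: "coherent X" and uv: "u \<in> words (n + 1)" "v \<in> words (n + 1)"
  shows "(\<lambda>m. X (n + 1 + m) (u @ replicate m 2) (v @ replicate m 2)) \<longlonglongrightarrow> rho n (abs_uhf X) u v"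
proof -
  let ?f = "\<lambda>m. X (n + 1 + m) (u @ replicate m 2) (v @ replicate m 2) :: complex"
  have "Cauchy ?f"
  proof (rule CauchyI')
    fix e :: real assume "e > 0"
    then obtain N where N: "\<And>n m. n \<ge> N \<Longrightarrow> m \<ge> n \<Longrightarrow> mnorm m (X m - amp n m (X n)) < e"
      using coherentD(2)[OF X] by metis
    show "\<exists>M. \<forall>m\<ge>M. \<forall>k>m. dist (?f m) (?f k) < e"
    proof (intro exI[of _ N] allI impI)
      fix m k assume mk: "m \<ge> N" "k > m"
      let ?u = "u @ replicate m 2" and ?v = "v @ replicate m 2"
      have k: "replicate k (2::3) = replicate m 2 @ replicate (k - m) 2"
        using mk by (simp flip: replicate_add)
      have "amp (n + 1 + m) (n + 1 + k) (X (n + 1 + m)) (?u @ replicate (k - m) 2) (?v @ replicate (k - m) 2)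
          = ?f m"
        using uv by (subst amp_entry) (auto simp: words_def)
      then have "dist (?f m) (?f k) =
          cmod ((X (n + 1 + k) - amp (n + 1 + m) (n + 1 + k) (X (n + 1 + m)))
                 (u @ replicate k 2) (v @ replicate k 2))"
        unfolding dist_commute[of "?f m"] by (simp add: dist_norm k)
      also have "\<dots> \<le> mnorm (n + 1 + k) (X (n + 1 + k) - amp (n + 1 + m) (n + 1 + k) (X (n + 1 + m)))"
        by (rule mnorm_entry) (use uv in \<open>auto simp: words_def\<close>)
      also have "\<dots> < e"
        using mk by (intro N) auto
      finally show "dist (?f m) (?f k) < e" .
    qed
  qed
  then have "?f \<longlonglongrightarrow> lim ?f"
    by (simp add: Cauchy_convergent flip: convergent_LIMSEQ_iff)
  then show ?thesis
    using X uv by (simp add: rho.abs_eq)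
qed

lemma rho_iota:
  assumes "x \<in> Mat (n + 1 + m)"
  shows "rho n (iota (n + 1 + m) x) =
    (\<lambda>u v. if u \<in> words (n + 1) \<and> v \<in> words (n + 1)
       then x (u @ replicate m 2) (v @ replicate m 2) else 0)"
proof (intro ext)
  fix u v
  let ?X = "\<lambda>k. if n + 1 + m \<le> k then amp (n + 1 + m) k x else 0"
  show "rho n (iota (n + 1 + m) x) u v = (if u \<in> words (n + 1) \<and> v \<in> words (n + 1)
      then x (u @ replicate m 2) (v @ replicate m 2) else 0)"
  proof (cases "u \<in> words (n + 1) \<and> v \<in> words (n + 1)")
    case True
    have "?X (n + 1 + k) (u @ replicate k 2) (v @ replicate k 2) =
        x (u @ replicate m 2) (v @ replicate m 2)" if "k \<ge> m" for k
    proof -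
      let ?u = "u @ replicate m 2" and ?v = "v @ replicate m 2"
      have k: "replicate k (2::3) = replicate m 2 @ replicate (k - m) 2"
        using that by (simp flip: replicate_add)
      have "amp (n + 1 + m) (n + 1 + k) x (?u @ replicate (k - m) 2) (?v @ replicate (k - m) 2) = x ?u ?v"
        using True by (subst amp_entry) (auto simp: words_def)
      then show ?thesis
        using that by (simp add: k)
    qed
    then have "(\<lambda>k. ?X (n + 1 + k) (u @ replicate k 2) (v @ replicate k 2)) \<longlonglongrightarrow>
        x (u @ replicate m 2) (v @ replicate m 2)"
      by (intro tendsto_eventually eventually_sequentiallyI[of m])
    moreover have "(\<lambda>k. ?X (n + 1 + k) (u @ replicate k 2) (v @ replicate k 2)) \<longlonglongrightarrow>
        rho n (iota (n + 1 + m) x) u v"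
      unfolding iota_def by (rule rho_tendsto[OF coherent_iota[OF assms]]) (use True in auto)
    ultimately have "rho n (iota (n + 1 + m) x) u v = x (u @ replicate m 2) (v @ replicate m 2)"
      using LIMSEQ_unique by blast
    then show ?thesis
      using True by simp
  next
    case False
    then show ?thesis
      using rho_outside[of u n v] by auto
  qed
qed

lemma rho_entry_le: "cmod (rho n a u v - rho n b u v) \<le> norm (a - b)"
proof (cases "u \<in> words (n + 1) \<and> v \<in> words (n + 1)")
  case True
  obtain X where X: "coherent X" "a = abs_uhf X" by (rule uhf_rep)
  obtain Y where Y: "coherent Y" "b = abs_uhf Y" by (rule uhf_rep)
  let ?f = "\<lambda>X m. X (n + 1 + m) (u @ replicate m 2) (v @ replicate m 2) :: complex"
  show ?thesis
  proof (rule LIMSEQ_le)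
    show "(\<lambda>m. cmod (?f X m - ?f Y m)) \<longlonglongrightarrow> cmod (rho n a u v - rho n b u v)"
      unfolding X(2) Y(2) using True X Y by (intro tendsto_intros rho_tendsto) auto
    have "(\<lambda>m. mnorm m (X m - Y m)) \<longlonglongrightarrow> norm (a - b)"
      using norm_uhf_tendsto[OF coherent_diff[OF X(1) Y(1)]] X Y by (simp add: minus_uhf_abs)
    then show "(\<lambda>m. mnorm (m + (n + 1)) (X (m + (n + 1)) - Y (m + (n + 1)))) \<longlonglongrightarrow> norm (a - b)"
      by (rule LIMSEQ_ignore_initial_segment)
    have "cmod (?f X m - ?f Y m) \<le> mnorm (m + (n + 1)) (X (m + (n + 1)) - Y (m + (n + 1)))" for m
    proof -
      have "cmod ((X (n + 1 + m) - Y (n + 1 + m)) (u @ replicate m 2) (v @ replicate m 2))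
          \<le> mnorm (n + 1 + m) (X (n + 1 + m) - Y (n + 1 + m))"
        by (rule mnorm_entry) (use True in \<open>auto simp: words_def\<close>)
      then show ?thesis
        by (simp add: add_ac)
    qed
    then show "\<exists>N. \<forall>m\<ge>N. cmod (?f X m - ?f Y m) \<le> mnorm (m + (n + 1)) (X (m + (n + 1)) - Y (m + (n + 1)))"
      by blast
  qed
next
  case False
  then show ?thesis
    using rho_outside[of u n v] by auto
qed

text \<open>
  The map \<open>\<lambda>\<^sup>(\<^sup>t\<^sup>)\<close> on \<open>Diag\<close>, whose basis elements \<open>alpha 0 j\<close> are the \<open>munit j j\<close>, and its
  ampliation \<open>id \<otimes> \<lambda>\<^sup>(\<^sup>t\<^sup>)\<close> on \<open>MatD n\<close>. The latter uses the decomposition of a member of \<open>MatD n\<close> as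
  the sum over \<open>j\<close> of the tensor products of \<open>\<lambda>u v. x (u @ [j]) (v @ [j])\<close> with \<open>munit j j\<close>;
  see \<open>lam_n_tensor\<close>.
\<close>

definition lam :: "real \<Rightarrow> tmat \<Rightarrow> tmat" where
  "lam t d = (\<Sum>j\<in>UNIV. mscale (d [j] [j])
     (alpha 1 j + mscale (of_real (1 - t)) (beta 1 j) + mscale (of_real (1 - t)) (beta 1 (j + 1))
       + mscale (of_real (2 * t - 1)) (beta 1 (j - 1))))"

definition lam_n :: "real \<Rightarrow> nat \<Rightarrow> tmat \<Rightarrow> tmat" where
  "lam_n t n x = (\<Sum>j\<in>UNIV. tensor n (\<lambda>u v. x (u @ [j]) (v @ [j])) (lam t (munit j j)))"

lemma alpha_0: "alpha 0 j = munit j j"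
proof (intro ext)
  fix u v :: "3 list"
  show "alpha 0 j u v = munit j j u v"
    by (cases u; cases v) (auto simp: alpha_def munit_def mone_def tensor_def words_def)
qed

lemma sum_tmat_apply: "(\<Sum>i\<in>I. f i) u v = (\<Sum>i\<in>I. f i u v)" for f :: "'i \<Rightarrow> tmat"
  by (induction I rule: infinite_finite_induct) auto

lemma lam_munit: "lam t (munit j j) =
    alpha 1 j + mscale (of_real (1 - t)) (beta 1 j) + mscale (of_real (1 - t)) (beta 1 (j + 1))
      + mscale (of_real (2 * t - 1)) (beta 1 (j - 1))"
proof -
  have "mscale (munit j j [i] [i]) x = (if i = j then x else 0)" for i x
    by (simp add: munit_def)
  then show ?thesis
    unfolding lam_def by simp
qed

lemma lam_n_tensor:
  assumes x: "x \<in> Mat n" and d: "d \<in> Diag"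
  shows "lam_n t n (tensor n x d) = tensor n x (lam t d)"
proof -
  have "tensor n x d (u @ [j]) (v @ [j]) = x u v * d [j] [j]" for u v j
  proof (cases "u \<in> words n \<and> v \<in> words n")
    case True
    then show ?thesis by (simp add: tensor_def words_def)
  next
    case False
    then have "drop n (u @ [j]) \<notin> words 1 \<or> drop n (v @ [j]) \<notin> words 1"
      by (auto simp: words_def)
    moreover have "d \<in> Mat 1"
      using d by (simp add: Diag_def)
    ultimately show ?thesis
      using Mat_outside[OF x, of u v] Mat_outside[of d 1] False by (auto simp: tensor_def)
  qed
  then have "lam_n t n (tensor n x d) =
      (\<Sum>j\<in>UNIV. tensor n (\<lambda>u v. x u v * d [j] [j]) (lam t (munit j j)))"
    by (simp add: lam_n_def)
  also have "\<dots> = tensor n x (\<Sum>j\<in>UNIV. mscale (d [j] [j]) (lam t (munit j j)))"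
    by (intro ext) (simp add: tensor_def sum_tmat_apply mscale_def sum_distrib_left mult_ac)
  also have "(\<Sum>j\<in>UNIV. mscale (d [j] [j]) (lam t (munit j j))) = lam t d"
    unfolding lam_munit by (simp add: lam_def)
  finally show ?thesis .
qed

text \<open>\<open>lam_iter t n k\<close> is the composition of \<open>lam_n t n\<close>, \dots, \<open>lam_n t (n + k - 1)\<close> in this order.\<close>

primrec lam_iter :: "real \<Rightarrow> nat \<Rightarrow> nat \<Rightarrow> tmat \<Rightarrow> tmat" where
  "lam_iter t n 0 = id"
| "lam_iter t n (Suc k) = lam_n t (n + k) \<circ> lam_iter t n k"

definition lam_seq :: "real \<Rightarrow> nat \<Rightarrow> tmat \<Rightarrow> nat \<Rightarrow> uhf" where
  "lam_seq t n x k = iota (n + k + 1) (lam_iter t n k x)"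

definition lam_inf :: "real \<Rightarrow> nat \<Rightarrow> tmat \<Rightarrow> uhf" where
  "lam_inf t n x = lim (lam_seq t n x)"

end

theory Submission
  imports Defs
begin

text \<open>
  Every iterate of \<open>x = \<Sum>\<^sub>j x\<^sub>j \<otimes> e\<^sub>j\<^sub>j\<close> is block diagonal with blocks that are convex combinations of the
  \<open>x\<^sub>j\<close>. One application of \<open>\<lambda>\<^sup>(\<^sup>t\<^sup>)\<close> multiplies the oscillation of the weights in the last letter by at
  most \<open>t\<close>, whence convergence at a geometric rate and contractivity. A last letter \<open>2\<close> repeats the
  block, so slicing recovers \<open>x\<close>, and \<open>\<lambda>\<^sub>n(b)\<close> differs from \<open>b \<otimes> e\<^sub>2\<^sub>2\<close> by elements \<open>y \<otimes> \<beta>\<^sup>1\<^sub>i\<close>, which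
  gives \<open>\<lambda>\<^sub>n(\<A>\<^sub>n) \<subseteq> \<A>\<^sub>n\<^sub>+\<^sub>1\<close>.

  For complete positivity, the image of a positive matrix is a limit of matrices whose blocks are
  Gram matrices of uniformly bounded size. After scaling by a constant \<open>K\<close> such a Gram matrix \<open>G\<close> makes
  \<open>1 - G\<close> a contraction, so the powers of the limit \<open>1 - \<phi>(a)/K\<close> are bounded and the binomial series of
  \<open>(1 - x)\<^bsup>1/2\<^esup>\<close> converges to a self-adjoint square root of \<open>\<phi>(a)/K\<close>.
\<close>

section \<open>The coefficients of the iterates\<close>

text \<open>For \<open>x\<close> in \<open>MatD n\<close> this is the coefficient of
  \<open>e_jj\<close> in the last tensor factor.\<close>

definition diag_block :: "tmat \<Rightarrow> 3 \<Rightarrow> tmat" where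
  "diag_block x j = (\<lambda>u v. x (u @ [j]) (v @ [j]))"

text \<open>\<open>kern t l i j\<close> is the coefficient of \<open>e\<^sub>i\<^sub>i \<otimes> e\<^sub>l\<^sub>l\<close> in \<open>\<lambda>\<^sup>(\<^sup>t\<^sup>)(e\<^sub>j\<^sub>j)\<close>.\<close>

definition kern :: "real \<Rightarrow> 3 \<Rightarrow> 3 \<Rightarrow> 3 \<Rightarrow> real" where
  "kern t l i j =
     (if l = 2 then of_bool (i = j)
      else if l = 1 then (1 - t) * of_bool (i = j) + (1 - t) * of_bool (i = j + 1) + (2 * t - 1) * of_bool (i = j - 1)
      else (1 - t) * of_bool (i = j) + (1 - t) * of_bool (i = j - 1) + (2 * t - 1) * of_bool (i = j + 1))"

lemma three_cases: "j = 1 \<or> j = 2 \<or> j = 0" for j :: 3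
  using exhaust_3[of j] by auto

lemma sum_kern: "(\<Sum>j\<in>UNIV. kern t l i j) = 1"
  using three_cases[of l] three_cases[of i] by (auto simp: kern_def sum_3)

lemma kern_nonneg: "1 / 2 \<le> t \<Longrightarrow> t < 1 \<Longrightarrow> 0 \<le> kern t l i j"
  by (auto simp: kern_def)

text \<open>The letter \<open>2\<close> copies \<open>f i\<close>. The letters \<open>1\<close> and
  \<open>3\<close> average with the same three weights, the two neighbours of \<open>i\<close> being
  exchanged.\<close>

lemma sum_kern_mult:
  "(\<Sum>j\<in>UNIV. kern t l i j * f j) =
     (if l = 2 then f i
      else if l = 1 then (1 - t) * f i + (1 - t) * f (i - 1) + (2 * t - 1) * f (i + 1)
      else (1 - t) * f i + (1 - t) * f (i + 1) + (2 * t - 1) * f (i - 1))"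
proof -
  have delta: "(\<Sum>j\<in>UNIV. c * of_bool (i = g j) * f j) = c * f a" if "\<And>j. i = g j \<longleftrightarrow> j = a"
    for g :: "3 \<Rightarrow> 3" and c a
    using sum.delta[of "UNIV :: 3 set" a "\<lambda>j. c * f j"]
    by (simp add: that of_bool_def if_distrib if_distribR cong: if_cong)
  have "i = j + 1 \<longleftrightarrow> j = i - 1" "i = j - 1 \<longleftrightarrow> j = i + 1" "i = j \<longleftrightarrow> j = i" for j
    by (auto simp: algebra_simps)
  note delta[OF this(1)] delta[OF this(2)] delta[OF this(3)] delta[OF this(3), of 1]
  then show ?thesis
    by (simp add: kern_def distrib_right sum.distrib)
qed

text \<open>For a fixed row \<open>i\<close> the sum takes one of three values, according to the
  letter. Each of the two averages keeps mass \<open>1 - t\<close> at \<open>i\<close>, so it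
  differs from \<open>f i\<close> by differences of total weight \<open>t\<close>. The two averages
  differ from each other by \<open>3 * t - 2\<close> times one difference.\<close>

lemma kern_oscillation:
  fixes f :: "3 \<Rightarrow> real"
  assumes t: "1 / 2 \<le> t" "t < 1" and f: "\<And>i j. \<bar>f i - f j\<bar> \<le> d"
  shows "\<bar>(\<Sum>j\<in>UNIV. kern t l i j * f j) - (\<Sum>j\<in>UNIV. kern t l' i j * f j)\<bar> \<le> t * d"
proof -
  let ?P = "(1 - t) * f i + (1 - t) * f (i - 1) + (2 * t - 1) * f (i + 1)"
  let ?Q = "(1 - t) * f i + (1 - t) * f (i + 1) + (2 * t - 1) * f (i - 1)"
  have comb: "\<bar>p * (f i - f a) + q * (f i - f b)\<bar> \<le> t * d" if "p \<ge> 0" "q \<ge> 0" "p + q = t" for p q a b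
  proof -
    have "\<bar>p * (f i - f a) + q * (f i - f b)\<bar> \<le> \<bar>p * (f i - f a)\<bar> + \<bar>q * (f i - f b)\<bar>"
      by (rule abs_triangle_ineq)
    also have "\<dots> \<le> p * d + q * d"
      using that f by (intro add_mono) (auto simp: abs_mult intro: mult_left_mono)
    finally show ?thesis
      using that by (simp flip: distrib_right)
  qed
  have d: "0 \<le> d"
    using f[of i i] by simp
  have "\<bar>f i - ?P\<bar> \<le> t * d"
    using comb[of "1 - t" "2 * t - 1" "i - 1" "i + 1"] t by (simp add: algebra_simps)
  moreover have "\<bar>f i - ?Q\<bar> \<le> t * d"
    using comb[of "1 - t" "2 * t - 1" "i + 1" "i - 1"] t by (simp add: algebra_simps)
  moreover have "\<bar>?P - ?Q\<bar> \<le> t * d"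
  proof -
    have "?P - ?Q = (3 * t - 2) * (f (i + 1) - f (i - 1))"
      by (simp add: algebra_simps)
    then have "\<bar>?P - ?Q\<bar> = \<bar>3 * t - 2\<bar> * \<bar>f (i + 1) - f (i - 1)\<bar>"
      by (simp add: abs_mult)
    \<comment> \<open>\<open>|3 * t - 2|\<close> is at most \<open>t\<close> exactly when
      \<open>t\<close> lies between \<open>1/2\<close> and \<open>1\<close>.\<close>
    also have "\<dots> \<le> t * d"
      using t f[of "i + 1" "i - 1"] by (intro mult_mono) auto
    finally show ?thesis .
  qed
  moreover have "0 \<le> t * d"
    using t d by simp
  ultimately have "\<bar>x - y\<bar> \<le> t * d" if "x \<in> {f i, ?P, ?Q}" "y \<in> {f i, ?P, ?Q}" for x y
    using that by (metis abs_minus_commute cancel_comm_monoid_add_class.diff_cancel abs_zero empty_iff insert_iff)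
  moreover have "(\<Sum>j\<in>UNIV. kern t l i j * f j) \<in> {f i, ?P, ?Q}" for l
    unfolding sum_kern_mult by (simp only: insert_iff split: if_split) simp
  ultimately show ?thesis
    by blast
qed

lemma alpha_1_entry: "alpha 1 j [i, l] [i', l'] = of_bool (i = i' \<and> l = l' \<and> l = 2 \<and> i = j)"
  by (auto simp: alpha_def tensor_def munit_def mone_def words_def)

lemma beta_1_entry:
  "beta 1 j [i, l] [i', l'] = of_bool (i = i' \<and> l = l' \<and> (l = 1 \<and> i = j \<or> l = 3 \<and> i = j + 2))"
  by (auto simp: beta_def tensor_def munit_def mone_def words_def)

lemma lam_munit_entry:
  "lam t (munit j j) [i, l] [i', l'] = of_bool (i = i' \<and> l = l') * of_real (kern t l i j)"
proof (cases "i = i' \<and> l = l'")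
  case True
  \<comment> \<open>Modulo \<open>3\<close>, the shift \<open>j + 2\<close> in the second summand of
    \<open>beta\<close> sends \<open>j\<close>, \<open>j + 1\<close>, \<open>j - 1\<close> to
    \<open>j - 1\<close>, \<open>j\<close>, \<open>j + 1\<close>, which are the rows that
    \<open>kern\<close> lists for the letter \<open>3\<close>.\<close>
  have "i = 3 + j \<longleftrightarrow> i = j" "i = j + 1 + 2 \<longleftrightarrow> i = j" "i = j - 1 + 2 \<longleftrightarrow> i = j + 1" "i = j + 2 \<longleftrightarrow> i = j - 1"
    using three_cases[of j] by auto
  then show ?thesis
    using True three_cases[of l]
    by (simp only: lam_munit kern_def alpha_1_entry beta_1_entry mscale_def plus_fun_apply) auto
next
  case False
  then show ?thesis
    by (simp only: lam_munit alpha_1_entry beta_1_entry mscale_def plus_fun_apply) auto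
qed

section \<open>Weights of the blocks of an iterate\<close>

text \<open>
  A member of the domain is \<open>\<Sum>\<^sub>j x\<^sub>j \<otimes> e\<^sub>j\<^sub>j\<close>, and its \<open>k\<close>-th iterate is block diagonal with the block
  \<open>\<Sum>\<^sub>j weight t k w j \<cdot> x\<^sub>j\<close> at the word \<open>w\<close> of length \<open>k + 1\<close> (see \<open>lam_iter_eq_level\<close>).
\<close>

primrec weight :: "real \<Rightarrow> nat \<Rightarrow> 3 list \<Rightarrow> 3 \<Rightarrow> real" where
  "weight t 0 w j = of_bool (w = [j])"
| "weight t (Suc k) w j =
     (\<Sum>i\<in>UNIV. kern t (last w) (last (butlast w)) i * weight t k (butlast (butlast w) @ [i]) j)"

text \<open>The recursion in usable form: the new letter \<open>l\<close> selects the kernel, the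
  previous letter \<open>i\<close> selects its row, and only that previous letter is averaged
  over.\<close>

lemma weight_Suc_snoc:
  "weight t (Suc k) (w @ [i, l]) j = (\<Sum>i'\<in>UNIV. kern t l i i' * weight t k (w @ [i']) j)"
  by (simp add: butlast_append)

lemma weight_nonneg: "1 / 2 \<le> t \<Longrightarrow> t < 1 \<Longrightarrow> 0 \<le> weight t k w j"
  by (induction k arbitrary: w) (auto intro!: sum_nonneg mult_nonneg_nonneg kern_nonneg)

lemma words_Suc_snocE:
  assumes "w \<in> words (Suc k)"
  obtains w' i where "w = w' @ [i]" "w' \<in> words k"
  using assms by (cases w rule: rev_cases) (auto simp: words_def)

lemma sum_weight: "w \<in> words (Suc k) \<Longrightarrow> (\<Sum>j\<in>UNIV. weight t k w j) = 1"
proof (induction k arbitrary: w)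
  case 0
  then obtain i where "w = [i]"
    by (auto simp: words_def length_Suc_conv)
  then show ?case by simp
next
  case (Suc k)
  from Suc.prems obtain w' l where w: "w = w' @ [l]" "w' \<in> words (Suc k)"
    by (rule words_Suc_snocE)
  from w(2) obtain w'' i where w': "w' = w'' @ [i]" "w'' \<in> words k"
    by (rule words_Suc_snocE)
  have "(\<Sum>j\<in>UNIV. weight t (Suc k) w j) =
      (\<Sum>i'\<in>UNIV. kern t l i i' * (\<Sum>j\<in>UNIV. weight t k (w'' @ [i']) j))"
    using w w' by (simp add: weight_Suc_snoc sum_distrib_left del: weight.simps) (rule sum.swap)
  also have "\<dots> = 1"
    using w' by (subst Suc.IH) (auto simp: words_def sum_kern)
  finally show ?case .
qed

text \<open>The two words share all but the last letter, so the recursion compares two kernels with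
  the same row \<open>last w\<close>, and \<open>kern_oscillation\<close> gains a factor
  \<open>t\<close> at each level.\<close>

lemma weight_oscillation:
  assumes t: "1 / 2 \<le> t" "t < 1"
  shows "\<bar>weight t k (w @ [i]) j - weight t k (w @ [i']) j\<bar> \<le> t ^ k"
proof (induction k arbitrary: w i i')
  case 0
  then show ?case by simp
next
  case (Suc k)
  show ?case
    using kern_oscillation[OF t, of "\<lambda>a. weight t k (butlast w @ [a]) j" "t ^ k" i "last w" i'] Suc.IH
    by simp
qed

text \<open>The new weight is a \<open>kern\<close>-average of weights at words that differ from
  \<open>w @ [i]\<close> in the last letter only, so it moves by at most their oscillation.\<close>

lemma weight_step:
  assumes t: "1 / 2 \<le> t" "t < 1"
  shows "\<bar>weight t (Suc k) (w @ [i, l]) j - weight t k (w @ [i]) j\<bar> \<le> t ^ k"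
proof -
  have "weight t (Suc k) (w @ [i, l]) j - weight t k (w @ [i]) j =
      (\<Sum>i'\<in>UNIV. kern t l i i' * (weight t k (w @ [i']) j - weight t k (w @ [i]) j))"
    by (simp add: weight_Suc_snoc right_diff_distrib sum_subtractf sum_kern
        flip: sum_distrib_right del: weight.simps)
  also have "\<bar>\<dots>\<bar> \<le> (\<Sum>i'\<in>UNIV. kern t l i i' * t ^ k)"
    by (rule order_trans[OF sum_abs], intro sum_mono)
      (auto simp: abs_mult kern_nonneg[OF t] intro!: mult_left_mono weight_oscillation[OF t])
  finally show ?thesis
    by (simp add: sum_kern flip: sum_distrib_right)
qed

section \<open>Block diagonal matrices\<close>

text \<open>The sum over words \<open>w\<close> of length \<open>r\<close> of \<open>F w\<close>
  \<otimes> \<open>e_ww\<close>; the label of a block is the tail of the word. Entries of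
  \<open>F w\<close> are cut to words of length \<open>n\<close>, so the result always lies in
  \<open>Mat (n + r)\<close>.\<close>

definition blk :: "nat \<Rightarrow> nat \<Rightarrow> (3 list \<Rightarrow> tmat) \<Rightarrow> tmat" where
  "blk n r F = (\<lambda>u v. if u \<in> words (n + r) \<and> v \<in> words (n + r) \<and> drop n u = drop n v
     then F (drop n u) (take n u) (take n v) else 0)"

lemma Mat_blk [simp]: "blk n r F \<in> Mat (n + r)"
  by (auto simp: blk_def Mat_def)

lemma blk_entry:
  assumes "u \<in> words n" "v \<in> words n" "w \<in> words r" "w' \<in> words r"
  shows "blk n r F (u @ w) (v @ w') = (if w = w' then F w u v else 0)"
  using assms by (auto simp: blk_def words_def)

lemma words_append: "u \<in> words n \<Longrightarrow> w \<in> words r \<Longrightarrow> u @ w \<in> words (n + r)"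
  by (simp add: words_def)

lemma words_appendE:
  assumes "u \<in> words (n + r)"
  obtains a c where "u = a @ c" "a \<in> words n" "c \<in> words r"
  using words_splitE[OF assms, of n] by auto

lemma blk_eqI:
  assumes "x \<in> Mat (n + r)"
    and "\<And>u v w w'. u \<in> words n \<Longrightarrow> v \<in> words n \<Longrightarrow> w \<in> words r \<Longrightarrow> w' \<in> words r \<Longrightarrow>
      x (u @ w) (v @ w') = (if w = w' then F w u v else 0)"
  shows "x = blk n r F"
proof (rule Mat_eqI[OF assms(1) Mat_blk])
  fix u v assume "u \<in> words (n + r)" "v \<in> words (n + r)"
  then show "x u v = blk n r F u v"
    by (elim words_appendE) (simp add: assms(2) blk_entry)
qed

lemma blk_cong:
  "(\<And>w u v. w \<in> words r \<Longrightarrow> u \<in> words n \<Longrightarrow> v \<in> words n \<Longrightarrow> F w u v = G w u v) \<Longrightarrow> blk n r F = blk n r G"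
  by (intro blk_eqI Mat_blk) (simp add: blk_entry)

lemma blk_diff: "blk n r F - blk n r G = blk n r (\<lambda>w. F w - G w)"
  and blk_add: "blk n r F + blk n r G = blk n r (\<lambda>w. F w + G w)"
  and blk_mscale: "mscale c (blk n r F) = blk n r (\<lambda>w. mscale c (F w))"
  and blk_zero: "blk n r (\<lambda>_. 0) = 0"
  by (auto simp: blk_def mscale_def fun_eq_iff)

lemma blk_mstar: "mstar (blk n r F) = blk n r (\<lambda>w. mstar (F w))"
  by (auto simp: blk_def mstar_def fun_eq_iff)

lemma blk_mone: "blk n r (\<lambda>_. mone n) = mone (n + r)"
  by (rule blk_eqI[symmetric, OF Mat_mone]) (auto simp: mone_def words_def)

lemma blk_mmul: "mmul (n + r) (blk n r F) (blk n r G) = blk n r (\<lambda>w. mmul n (F w) (G w))"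
proof (rule blk_eqI)
  fix u v w w' assume m: "u \<in> words n" "v \<in> words n" "w \<in> words r" "w' \<in> words r"
  have "mmul (n + r) (blk n r F) (blk n r G) (u @ w) (v @ w') =
     (\<Sum>a\<in>words n. \<Sum>b\<in>words r. if b = w then if w = w' then F w u a * G w a v else 0 else 0)"
    unfolding mmul_def sum_words_add using m
    by (intro sum.cong refl) (auto simp: blk_entry)
  then show "mmul (n + r) (blk n r F) (blk n r G) (u @ w) (v @ w') =
      (if w = w' then mmul n (F w) (G w) u v else 0)"
    using m by (simp add: mmul_def)
qed (intro Mat_mmul Mat_blk)

text \<open>Tensoring with the identity on \<open>s\<close> further factors lengthens the labels,
  and the blocks ignore the added letters.\<close>

lemma amp_blk: "amp (n + r) (n + (r + s)) (blk n r F) = blk n (r + s) (\<lambda>w. F (take r w))"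
proof (rule blk_eqI)
  fix u v w w' assume m: "u \<in> words n" "v \<in> words n" "w \<in> words (r + s)" "w' \<in> words (r + s)"
  obtain a c where w: "w = a @ c" "a \<in> words r" "c \<in> words s"
    using words_appendE[OF m(3)] .
  obtain a' c' where w': "w' = a' @ c'" "a' \<in> words r" "c' \<in> words s"
    using words_appendE[OF m(4)] .
  have "amp (n + r) (n + (r + s)) (blk n r F) ((u @ a) @ c) ((v @ a') @ c') =
      (if c = c' \<and> c \<in> words (n + (r + s) - (n + r)) then blk n r F (u @ a) (v @ a') else 0)"
    by (rule amp_entry) (use m w w' in \<open>auto intro: words_append\<close>)
  then show "amp (n + r) (n + (r + s)) (blk n r F) (u @ w) (v @ w') =
      (if w = w' then F (take r w) u v else 0)"
    using m w w' by (auto simp: blk_entry words_def)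
qed (auto intro: Mat_amp)

lemma amp_blk_Suc:
  "amp (n + r) (n + Suc r) (blk n r F) = blk n (Suc r) (\<lambda>w. F (take r w))"
  using amp_blk[of n r 1 F] by simp

section \<open>Norms of block diagonal matrices and of blocks\<close>

lemma vnorm_append: "(vnorm (n + r) \<xi>)\<^sup>2 = (\<Sum>c\<in>words r. (vnorm n (\<lambda>a. \<xi> (a @ c)))\<^sup>2)"
  using vnorm_split[of n "n + r" \<xi>] by simp

lemma mapp_blk:
  assumes "u \<in> words n" "w \<in> words r"
  shows "mapp (n + r) (blk n r F) \<xi> (u @ w) = mapp n (F w) (\<lambda>a. \<xi> (a @ w)) u"
proof -
  have "mapp (n + r) (blk n r F) \<xi> (u @ w) =
     (\<Sum>a\<in>words n. \<Sum>b\<in>words r. if b = w then F w u a * \<xi> (a @ w) else 0)"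
    unfolding mapp_def sum_words_add using assms by (intro sum.cong refl) (auto simp: blk_entry)
  then show ?thesis
    using assms by (simp add: mapp_def)
qed

text \<open>Cutting a vector according to its last \<open>r\<close> letters gives orthogonal pieces
  on which the blocks act separately, so the bound does not grow with the number of blocks.\<close>

lemma mnorm_blk_le:
  assumes C: "0 \<le> C" and F: "\<And>w. w \<in> words r \<Longrightarrow> mnorm n (F w) \<le> C"
  shows "mnorm (n + r) (blk n r F) \<le> C"
proof (rule mnorm_least[OF C])
  fix \<xi>
  have "(vnorm (n + r) (mapp (n + r) (blk n r F) \<xi>))\<^sup>2 =
      (\<Sum>w\<in>words r. (vnorm n (mapp n (F w) (\<lambda>a. \<xi> (a @ w))))\<^sup>2)"
    unfolding vnorm_append by (intro sum.cong refl arg_cong[of _ _ "\<lambda>x. x\<^sup>2"])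
      (auto simp: vnorm_def mapp_blk intro: L2_set_cong)
  also have "\<dots> \<le> (\<Sum>w\<in>words r. (C * vnorm n (\<lambda>a. \<xi> (a @ w)))\<^sup>2)"
    by (intro sum_mono power_mono order_trans[OF mnorm_bound] mult_right_mono F) auto
  also have "\<dots> = (C * vnorm (n + r) \<xi>)\<^sup>2"
    by (simp add: power_mult_distrib vnorm_append sum_distrib_left)
  finally show "vnorm (n + r) (mapp (n + r) (blk n r F) \<xi>) \<le> C * vnorm (n + r) \<xi>"
    by (rule power2_le_imp_le) (simp add: C)
qed

text \<open>A crude bound, applied to blocks of the fixed size \<open>n\<close>, where it turns
  entrywise bounds on powers into a norm bound uniform in the level.\<close>

lemma mnorm_le_sum_entries: "mnorm n x \<le> (\<Sum>u\<in>words n. \<Sum>v\<in>words n. cmod (x u v))"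
proof (rule mnorm_least)
  fix \<xi>
  have "vnorm n (mapp n x \<xi>) \<le> (\<Sum>u\<in>words n. cmod (mapp n x \<xi> u))"
    unfolding vnorm_def by (rule L2_set_le_sum) auto
  also have "\<dots> \<le> (\<Sum>u\<in>words n. \<Sum>v\<in>words n. cmod (x u v) * vnorm n \<xi>)"
    unfolding mapp_def
    by (intro sum_mono order_trans[OF norm_sum]) (auto simp: norm_mult intro!: mult_left_mono vnorm_ge)
  finally show "vnorm n (mapp n x \<xi>) \<le> (\<Sum>u\<in>words n. \<Sum>v\<in>words n. cmod (x u v)) * vnorm n \<xi>"
    by (simp add: sum_distrib_right)
qed (simp add: sum_nonneg)

text \<open>The block is the compression of \<open>x\<close> to vectors supported on words ending in
  \<open>j\<close>; \<open>\<zeta>\<close> is the isometric extension of \<open>\<xi>\<close> by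
  zero.\<close>

lemma mnorm_diag_block_le: "mnorm n (diag_block x j) \<le> mnorm (n + 1) x"
proof (rule mnorm_least)
  fix \<xi> :: "3 list \<Rightarrow> complex"
  define \<zeta> where "\<zeta> w = (if drop n w = [j] then \<xi> (take n w) else 0)" for w
  have z: "\<zeta> (a @ c) = (if c = [j] then \<xi> a else 0)" if "a \<in> words n" for a c
    using that by (auto simp: \<zeta>_def words_def)
  have j: "[j] \<in> words 1"
    by (simp add: words_def)
  have "(vnorm n (\<lambda>a. \<zeta> (a @ c)))\<^sup>2 = (if c = [j] then (vnorm n \<xi>)\<^sup>2 else 0)" for c
    unfolding vnorm_power2 by (simp add: z)
  then have "(vnorm (n + 1) \<zeta>)\<^sup>2 = (vnorm n \<xi>)\<^sup>2"
    unfolding vnorm_append using j by simp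
  then have nz: "vnorm (n + 1) \<zeta> = vnorm n \<xi>"
    by (simp add: power2_eq_iff_nonneg)
  have "mapp (n + 1) x \<zeta> (u @ [j]) = mapp n (diag_block x j) \<xi> u" if "u \<in> words n" for u
  proof -
    have "mapp (n + 1) x \<zeta> (u @ [j]) =
        (\<Sum>a\<in>words n. \<Sum>b\<in>words 1. if b = [j] then x (u @ [j]) (a @ [j]) * \<xi> a else 0)"
      unfolding mapp_def sum_words_add by (intro sum.cong refl) (auto simp: z)
    then show ?thesis
      using j by (simp add: mapp_def diag_block_def)
  qed
  then have "(vnorm n (mapp n (diag_block x j) \<xi>))\<^sup>2 =
      (vnorm n (\<lambda>u. mapp (n + 1) x \<zeta> (u @ [j])))\<^sup>2"
    unfolding vnorm_power2 by simp
  also have "\<dots> \<le> (\<Sum>c\<in>words 1. (vnorm n (\<lambda>a. mapp (n + 1) x \<zeta> (a @ c)))\<^sup>2)"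
    using member_le_sum[of "[j]" "words 1" "\<lambda>c. (vnorm n (\<lambda>a. mapp (n + 1) x \<zeta> (a @ c)))\<^sup>2"] j by simp
  also have "\<dots> = (vnorm (n + 1) (mapp (n + 1) x \<zeta>))\<^sup>2"
    by (simp only: vnorm_append)
  finally have "vnorm n (mapp n (diag_block x j) \<xi>) \<le> vnorm (n + 1) (mapp (n + 1) x \<zeta>)"
    by (rule power2_le_imp_le) simp
  also have "\<dots> \<le> mnorm (n + 1) x * vnorm n \<xi>"
    using mnorm_bound[of "n + 1" x \<zeta>] nz by simp
  finally show "vnorm n (mapp n (diag_block x j) \<xi>) \<le> mnorm (n + 1) x * vnorm n \<xi>" .
qed simp

section \<open>Convergence and contractivity\<close>

lemma blk_1_eq: "x = blk n 1 (\<lambda>w. diag_block x (hd w))"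
  if "x \<in> Mat (n + 1)" "\<And>u v i j. i \<noteq> j \<Longrightarrow> x (u @ [i]) (v @ [j]) = 0"
  by (rule blk_eqI) (use that in \<open>auto simp: words_def diag_block_def length_Suc_conv\<close>)

lemma Mat_munit [simp]: "munit i j \<in> Mat 1"
  by (auto simp: munit_def Mat_def words_def)

lemma munit_Diag: "munit j j \<in> Diag"
  by (auto simp: Diag_def munit_def Mat_def words_def)

lemma Mat_diag_block: "x \<in> Mat (n + 1) \<Longrightarrow> diag_block x j \<in> Mat n"
  by (fastforce simp: Mat_def diag_block_def words_def)

lemma block_decomp:
  assumes x: "x \<in> Mat (n + 1)" and "\<And>u v i j. i \<noteq> j \<Longrightarrow> x (u @ [i]) (v @ [j]) = 0"
  shows "x = (\<Sum>j\<in>UNIV. tensor n (diag_block x j) (munit j j))"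
proof (rule Mat_eqI[of _ "n + 1"])
  show "(\<Sum>j\<in>UNIV. tensor n (diag_block x j) (munit j j)) \<in> Mat (n + 1)"
    unfolding sum_3 by (intro Mat_add Mat_tensor Mat_diag_block x) (auto simp: munit_def Mat_def words_def)
  fix u v assume "u \<in> words (n + 1)" "v \<in> words (n + 1)"
  then obtain u' i v' i' where "u = u' @ [i]" "u' \<in> words n" "v = v' @ [i']" "v' \<in> words n"
    by (metis words_Suc_snocE Suc_eq_plus1)
  then show "x u v = (\<Sum>j\<in>UNIV. tensor n (diag_block x j) (munit j j)) u v"
    using assms by (cases "i = i'"; cases "i = 1"; cases "i = 2"; cases "i' = 1"; cases "i' = 2")
      (use exhaust_3[of i] exhaust_3[of i'] in \<open>auto simp: sum_tmat_apply tensor_def munit_def words_def diag_block_def sum_3\<close>)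
qed (use x in simp)

text \<open>Replaces the span by a condition on entries that closure properties can check directly:
  different last letters are not coupled. Conversely, such a matrix is rebuilt from its blocks by
  \<open>block_decomp\<close>.\<close>

lemma MatD_iff:
  "x \<in> MatD n \<longleftrightarrow> x \<in> Mat (n + 1) \<and> (\<forall>u v i j. i \<noteq> j \<longrightarrow> x (u @ [i]) (v @ [j]) = 0)"
proof
  let ?E = "{x \<in> Mat (n + 1). \<forall>u v i j. i \<noteq> j \<longrightarrow> x (u @ [i]) (v @ [j]) = 0}"
  have "MatD n \<subseteq> ?E"
    unfolding MatD_def
  proof (rule tmat.span_minimal)
    show "tmat.subspace ?E"
      by (rule tmat.subspaceI) (auto intro: Mat_add Mat_mscale[unfolded mscale_def] simp: mscale_def)
    show "{tensor n x d |x d. x \<in> Mat n \<and> d \<in> Diag} \<subseteq> ?E"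
    proof safe
      fix x d assume x: "x \<in> Mat n" and d: "d \<in> Diag"
      then have d1: "d \<in> Mat 1" and d2: "\<And>i j. i \<noteq> j \<Longrightarrow> d [i] [j] = 0"
        by (auto simp: Diag_def)
      show "tensor n x d \<in> Mat (n + 1)"
        by (rule Mat_tensor[OF x d1])
      fix u v :: "3 list" and i j :: 3 assume "i \<noteq> j"
      show "tensor n x d (u @ [i]) (v @ [j]) = 0"
      proof (cases "length u = n \<and> length v = n")
        case True
        then show ?thesis using d2[OF \<open>i \<noteq> j\<close>] by (simp add: tensor_def)
      next
        \<comment> \<open>The condition ranges over lists of every length; at wrong lengths the
          entry vanishes because the product lies in \<open>Mat (n + 1)\<close>.\<close>
        case False
        then show ?thesis
          by (intro Mat_outside[OF Mat_tensor[OF x d1]]) (auto simp: words_def)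
      qed
    qed
  qed
  then show "x \<in> Mat (n + 1) \<and> (\<forall>u v i j. i \<noteq> j \<longrightarrow> x (u @ [i]) (v @ [j]) = 0)" if "x \<in> MatD n"
    using that by auto
  assume x: "x \<in> Mat (n + 1) \<and> (\<forall>u v i j. i \<noteq> j \<longrightarrow> x (u @ [i]) (v @ [j]) = 0)"
  have comp: "diag_block x j \<in> Mat n" for j
    using x by (fastforce simp: Mat_def diag_block_def words_def)
  have "x = (\<Sum>j\<in>UNIV. tensor n (diag_block x j) (munit j j))"
    using x by (intro block_decomp) auto
  also have "\<dots> \<in> MatD n"
    unfolding MatD_def
    by (intro tmat.span_sum tmat.span_base) (use comp munit_Diag in blast)
  finally show "x \<in> MatD n" .
qed

lemma MatD_decomp: "x \<in> MatD n \<Longrightarrow> x = (\<Sum>j\<in>UNIV. tensor n (diag_block x j) (munit j j))"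
  by (rule block_decomp) (auto simp: MatD_iff)

lemma MatD_blk: "x \<in> MatD n \<Longrightarrow> x = blk n 1 (\<lambda>w. diag_block x (hd w))"
  by (rule blk_1_eq) (auto simp: MatD_iff)

lemma blk_MatD: "blk n (Suc r) F \<in> MatD (n + r)"
  using Mat_blk[of n "Suc r" F] by (auto simp: MatD_iff blk_def drop_Cons' words_def)

section \<open>Closed form of the iterates\<close>

definition level :: "real \<Rightarrow> nat \<Rightarrow> nat \<Rightarrow> tmat \<Rightarrow> tmat" where
  "level t n k x = blk n (Suc k) (\<lambda>w. \<Sum>j\<in>UNIV. mscale (of_real (weight t k w j)) (diag_block x j))"

lemma Mat_tpow: "x \<in> Mat 1 \<Longrightarrow> tpow x n \<in> Mat n"
  by (induction n) (use Mat_tensor[of x 1] in auto)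

lemma Mat_alpha: "alpha n j \<in> Mat (n + 1)"
  unfolding alpha_def using Mat_tensor[OF Mat_munit Mat_tpow[OF Mat_munit], of j j 2 2 n] by simp

lemma Mat_beta:
  assumes "1 \<le> k"
  shows "beta k j \<in> Mat (k + 1)"
proof -
  have "tensor 1 (munit j j) (munit 1 1) + tensor 1 (munit (j + 2) (j + 2)) (munit 3 3) \<in> Mat (1 + 1)"
    by (intro Mat_add Mat_tensor Mat_munit)
  from Mat_tensor[OF this Mat_tpow[OF Mat_munit], of 2 2 "k - 1"] show ?thesis
    using assms by (simp add: beta_def numeral_2_eq_2)
qed

lemma Mat_lam: "lam t d \<in> Mat 2"
  unfolding lam_def sum_3 using Mat_alpha[of 1] Mat_beta[of 1]
  by (intro Mat_add Mat_mscale) (simp_all add: numeral_2_eq_2)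

lemma lam_n_entry:
  assumes "u \<in> words n" "v \<in> words n"
  shows "lam_n t n x (u @ [i, l]) (v @ [i', l']) =
    of_bool (i = i' \<and> l = l') * (\<Sum>j\<in>UNIV. of_real (kern t l i j) * x (u @ [j]) (v @ [j]))"
  using assms
  by (auto simp: lam_n_def sum_tmat_apply tensor_def lam_munit_entry words_def sum_distrib_left mult_ac)

lemma Mat_lam_n: "x \<in> Mat (n + 1) \<Longrightarrow> lam_n t n x \<in> Mat (n + 2)"
  unfolding lam_n_def sum_3
  by (intro Mat_add Mat_tensor Mat_lam Mat_diag_block[unfolded diag_block_def])

text \<open>By \<open>lam_n_entry\<close> a further step averages over the last letter of the block
  label with the kernel of the new letter, which is the recursion of \<open>weight\<close>. At the
  start the weights are indicators and the blocks are those of \<open>x\<close>.\<close>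

lemma lam_iter_eq_level:
  assumes x: "x \<in> MatD n"
  shows "lam_iter t n k x = level t n k x"
proof (induction k)
  case 0
  have "level t n 0 x = blk n 1 (\<lambda>w. diag_block x (hd w))"
    unfolding level_def One_nat_def
    by (rule blk_cong) (auto simp: sum_tmat_apply mscale_def words_def length_Suc_conv
      of_bool_def if_distrib if_distribR cong: if_cong)
  then show ?case
    using MatD_blk[OF x] by simp
next
  case (Suc k)
  let ?F = "\<lambda>k w. \<Sum>j\<in>UNIV. mscale (of_real (weight t k w j)) (diag_block x j)"
  have M: "blk n (Suc k) F \<in> Mat (n + k + 1)" for F
    using Mat_blk[of n "Suc k"] by simp
  have "lam_n t (n + k) (blk n (Suc k) (?F k)) = blk n (Suc (Suc k)) (?F (Suc k))"
  proof (rule blk_eqI)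
    show "lam_n t (n + k) (blk n (Suc k) (?F k)) \<in> Mat (n + Suc (Suc k))"
      using Mat_lam_n[OF M] by (simp add: numeral_2_eq_2)
    fix u v w w' assume m: "u \<in> words n" "v \<in> words n" "w \<in> words (Suc (Suc k))" "w' \<in> words (Suc (Suc k))"
    \<comment> \<open>\<open>l\<close> is the letter added by this step, \<open>i\<close> the last
      letter before it, and \<open>a\<close> the part of the label that the step leaves
      alone.\<close>
    from m(3) obtain a i l where w: "w = a @ [i, l]" "a \<in> words k"
      by (metis words_Suc_snocE append.assoc append_Cons append_Nil)
    from m(4) obtain a' i' l' where w': "w' = a' @ [i', l']" "a' \<in> words k"
      by (metis words_Suc_snocE append.assoc append_Cons append_Nil)
    have "lam_n t (n + k) (blk n (Suc k) (?F k)) ((u @ a) @ [i, l]) ((v @ a') @ [i', l']) =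
      of_bool (i = i' \<and> l = l') * (\<Sum>j\<in>UNIV. of_real (kern t l i j) *
         blk n (Suc k) (?F k) ((u @ a) @ [j]) ((v @ a') @ [j]))"
      by (rule lam_n_entry) (use m w w' in \<open>auto intro: words_append\<close>)
    also have "\<dots> = of_bool (i = i' \<and> l = l') * (\<Sum>j\<in>UNIV. of_real (kern t l i j) *
         (if a = a' then ?F k (a @ [j]) u v else 0))"
    proof -
      have "blk n (Suc k) (?F k) ((u @ a) @ [j]) ((v @ a') @ [j]) =
          (if a = a' then ?F k (a @ [j]) u v else 0)" for j
        using blk_entry[OF m(1,2), of "a @ [j]" "Suc k" "a' @ [j]"] w w' by (simp add: words_def)
      then show ?thesis by simp
    qed
    also have "(\<Sum>j\<in>UNIV. of_real (kern t l i j) * (if a = a' then ?F k (a @ [j]) u v else 0)) =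
       (if a = a' then ?F (Suc k) (a @ [i, l]) u v else 0)"
      unfolding sum_tmat_apply mscale_def weight_Suc_snoc
      by (simp add: sum_distrib_left sum_distrib_right mult_ac) (rule impI, rule sum.swap)
    finally show "lam_n t (n + k) (blk n (Suc k) (?F k)) (u @ w) (v @ w') =
        (if w = w' then ?F (Suc k) w u v else 0)"
      using w w' by auto
  qed
  then show ?case
    using Suc by (simp add: level_def)
qed

lemma Mat_level [simp]: "level t n k x \<in> Mat (n + Suc k)"
  unfolding level_def by (rule Mat_blk)

lemma lam_seq_eq: "x \<in> MatD n \<Longrightarrow> lam_seq t n x k = iota (n + Suc k) (level t n k x)"
  by (simp add: lam_seq_def lam_iter_eq_level)

section \<open>Norm estimates for the iterates and their limit\<close>

lemma mnorm_sum_le: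
  fixes f :: "'i \<Rightarrow> tmat"
  assumes "finite I"
  shows "mnorm n (sum f I) \<le> (\<Sum>i\<in>I. mnorm n (f i))"
  using assms
proof induction
  case empty
  show "mnorm n (sum f {}) \<le> (\<Sum>i\<in>{}. mnorm n (f i))" by simp
next
  case (insert i I)
  then show "mnorm n (sum f (insert i I)) \<le> (\<Sum>i\<in>insert i I. mnorm n (f i))"
    using mnorm_triangle[of n "f i" "sum f I"] by simp
qed

text \<open>Amplified to a common level, both terms are block diagonal over the same words, and by
  \<open>weight_step\<close> the coefficients differ by at most \<open>t ^ k\<close>. The norm is
  controlled block by block, so the growing number of words costs nothing.\<close>

lemma lam_seq_step:
  assumes t: "1 / 2 \<le> t" "t < 1" and x: "x \<in> MatD n"
  shows "norm (lam_seq t n x (Suc k) - lam_seq t n x k) \<le> (\<Sum>j\<in>UNIV. mnorm n (diag_block x j)) * t ^ k"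
proof -
  let ?d = "\<lambda>w j. weight t (Suc k) w j - weight t k (take (Suc k) w) j"
  let ?F = "\<lambda>k w. \<Sum>j\<in>UNIV. mscale (of_real (weight t k w j)) (diag_block x j)"
  have "amp (n + Suc k) (n + Suc (Suc k)) (level t n k x) = blk n (Suc (Suc k)) (\<lambda>w. ?F k (take (Suc k) w))"
    unfolding level_def by (rule amp_blk_Suc)
  moreover have "iota (n + Suc k) (level t n k x) =
      iota (n + Suc (Suc k)) (amp (n + Suc k) (n + Suc (Suc k)) (level t n k x))"
    by (rule iota_amp[symmetric, OF Mat_level]) simp
  ultimately have "lam_seq t n x (Suc k) - lam_seq t n x k =
      iota (n + Suc (Suc k)) (blk n (Suc (Suc k)) (\<lambda>w. ?F (Suc k) w - ?F k (take (Suc k) w)))"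
    unfolding lam_seq_eq[OF x] by (simp only: level_def blk_diff[symmetric] iota_diff[OF Mat_blk Mat_blk])
  then have "norm (lam_seq t n x (Suc k) - lam_seq t n x k) =
      mnorm (n + Suc (Suc k)) (blk n (Suc (Suc k)) (\<lambda>w. ?F (Suc k) w - ?F k (take (Suc k) w)))"
    by (simp only: norm_iota[OF Mat_blk])
  also have "\<dots> \<le> (\<Sum>j\<in>UNIV. mnorm n (diag_block x j)) * t ^ k"
  proof (rule mnorm_blk_le)
    show "0 \<le> (\<Sum>j\<in>UNIV. mnorm n (diag_block x j)) * t ^ k"
      using t by (intro mult_nonneg_nonneg sum_nonneg) auto
    fix w :: "3 list" assume "w \<in> words (Suc (Suc k))"
    then obtain a i l where w: "w = a @ [i, l]" "a \<in> words k"
      by (metis words_Suc_snocE append.assoc append_Cons append_Nil)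
    have d: "\<bar>?d w j\<bar> \<le> t ^ k" for j
      using weight_step[OF t, of k a i l j] w by (simp add: words_def del: weight.simps)
    have "?F (Suc k) w - ?F k (take (Suc k) w) = (\<Sum>j\<in>UNIV. mscale (of_real (?d w j)) (diag_block x j))"
      by (simp add: tmat.scale_left_diff_distrib sum_subtractf del: weight.simps)
    then have "mnorm n (?F (Suc k) w - ?F k (take (Suc k) w)) \<le> (\<Sum>j\<in>UNIV. \<bar>?d w j\<bar> * mnorm n (diag_block x j))"
      by (simp only:) (rule order_trans[OF mnorm_sum_le[OF finite]], simp add: mnorm_mscale del: weight.simps of_real_diff)
    also have "\<dots> \<le> (\<Sum>j\<in>UNIV. mnorm n (diag_block x j)) * t ^ k"
      unfolding sum_distrib_right by (intro sum_mono, subst mult.commute, intro mult_left_mono d mnorm_nonneg)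
    finally show "mnorm n (?F (Suc k) w - ?F k (take (Suc k) w)) \<le> (\<Sum>j\<in>UNIV. mnorm n (diag_block x j)) * t ^ k" .
  qed
  finally show ?thesis .
qed

text \<open>The increments are dominated by a geometric series, and the sequence is recovered from
  them by telescoping.\<close>

lemma lam_seq_convergent:
  assumes t: "1 / 2 \<le> t" "t < 1" and x: "x \<in> MatD n"
  shows "convergent (lam_seq t n x)"
proof -
  have "summable (\<lambda>k. lam_seq t n x (Suc k) - lam_seq t n x k)"
    by (rule summable_comparison_test'[OF summable_mult[OF summable_geometric], where N = 0])
      (use t lam_seq_step[OF t x] in auto)
  then have "convergent (\<lambda>k. (\<Sum>i<k. lam_seq t n x (Suc i) - lam_seq t n x i) + lam_seq t n x 0)"
    by (intro convergent_add convergent_const) (simp add: summable_iff_convergent)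
  then show ?thesis
    by (simp add: sum_lessThan_telescope)
qed

lemma lam_seq_tendsto:
  "1 / 2 \<le> t \<Longrightarrow> t < 1 \<Longrightarrow> x \<in> MatD n \<Longrightarrow> lam_seq t n x \<longlonglongrightarrow> lam_inf t n x"
  unfolding lam_inf_def using lam_seq_convergent convergent_LIMSEQ_iff by blast

text \<open>Every block of an iterate is a convex combination of the blocks of \<open>x\<close>,
  which are compressions of \<open>x\<close>; the bound then passes to the limit.\<close>

lemma norm_lam_inf_le:
  assumes t: "1 / 2 \<le> t" "t < 1" and x: "x \<in> MatD n"
  shows "norm (lam_inf t n x) \<le> mnorm (n + 1) x"
proof (rule LIMSEQ_le_const2[OF tendsto_norm[OF lam_seq_tendsto[OF t x]]])
  have "norm (lam_seq t n x k) \<le> mnorm (n + 1) x" for k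
  proof -
    have "norm (lam_seq t n x k) = mnorm (n + Suc k) (level t n k x)"
      by (simp only: lam_seq_eq[OF x] norm_iota[OF Mat_level])
    also have "\<dots> \<le> mnorm (n + 1) x"
      unfolding level_def
    proof (rule mnorm_blk_le)
      fix w :: "3 list" assume w: "w \<in> words (Suc k)"
      have "mnorm n (\<Sum>j\<in>UNIV. mscale (of_real (weight t k w j)) (diag_block x j)) \<le>
          (\<Sum>j\<in>UNIV. weight t k w j * mnorm (n + 1) x)"
        by (intro order_trans[OF mnorm_sum_le[OF finite]] sum_mono)
          (auto simp: mnorm_mscale weight_nonneg[OF t] simp del: add_Suc_right One_nat_def intro!: mult_left_mono mnorm_diag_block_le)
      then show "mnorm n (\<Sum>j\<in>UNIV. mscale (of_real (weight t k w j)) (diag_block x j)) \<le> mnorm (n + 1) x"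
        by (simp add: sum_weight[OF w] flip: sum_distrib_right)
    qed simp
    finally show ?thesis .
  qed
  then show "\<exists>N. \<forall>k\<ge>N. norm (lam_seq t n x k) \<le> mnorm (n + 1) x"
    by blast
qed

section \<open>Slices and the algebras \<open>\<A>\<^sub>n\<close>\<close>

lemma lam_iter_MatD: "x \<in> MatD n \<Longrightarrow> lam_iter t n k x \<in> MatD (n + k)"
  by (simp add: lam_iter_eq_level level_def blk_MatD)

text \<open>\<open>kern t 2 i\<close> is the indicator of \<open>i\<close>, so a final letter
  \<open>2\<close>, the one that the slice map reads, repeats the entries of
  \<open>x\<close>.\<close>

lemma lam_n_entry_2:
  assumes x: "x \<in> MatD n" and uv: "u \<in> words (n + 1)" "v \<in> words (n + 1)"
  shows "lam_n t n x (u @ [2]) (v @ [2]) = x u v"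
proof -
  obtain u' i v' i' where u: "u = u' @ [i]" "u' \<in> words n" and v: "v = v' @ [i']" "v' \<in> words n"
    using uv by (metis words_Suc_snocE Suc_eq_plus1)
  have "complex_of_real (kern t 2 i j) * c = (if i = j then c else 0)" for j c
    by (simp add: kern_def)
  then have "lam_n t n x (u' @ [i, 2]) (v' @ [i', 2]) = of_bool (i = i') * x (u' @ [i]) (v' @ [i])"
    by (simp add: lam_n_entry[OF u(2) v(2)])
  moreover have "i \<noteq> i' \<Longrightarrow> x (u' @ [i]) (v' @ [i']) = 0"
    using x by (simp add: MatD_iff)
  ultimately show ?thesis
    using u v by auto
qed

lemma lam_iter_entry_2:
  assumes x: "x \<in> MatD n" and uv: "u \<in> words (n + 1)" "v \<in> words (n + 1)"
  shows "lam_iter t n k x (u @ replicate k 2) (v @ replicate k 2) = x u v"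
proof (induction k)
  case (Suc k)
  have "lam_n t (n + k) (lam_iter t n k x) ((u @ replicate k 2) @ [2]) ((v @ replicate k 2) @ [2]) =
      lam_iter t n k x (u @ replicate k 2) (v @ replicate k 2)"
    by (rule lam_n_entry_2[OF lam_iter_MatD[OF x]]) (use uv in \<open>auto simp: words_def\<close>)
  then show ?case
    using Suc by (simp only: append_assoc replicate_append_same replicate_Suc lam_iter.simps o_apply)
qed simp

lemma rho_lam_seq:
  assumes x: "x \<in> MatD n"
  shows "rho n (lam_seq t n x k) = x"
proof (intro ext)
  fix u v
  have "lam_iter t n k x \<in> Mat (n + 1 + k)"
    using lam_iter_MatD[OF x, of t k] by (simp add: MatD_iff)
  from rho_iota[OF this] have "rho n (lam_seq t n x k) u v =
      (if u \<in> words (n + 1) \<and> v \<in> words (n + 1)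
       then lam_iter t n k x (u @ replicate k 2) (v @ replicate k 2) else 0)"
    by (simp add: lam_seq_def)
  also have "\<dots> = x u v"
    using x lam_iter_entry_2[OF x] Mat_outside[of x "n + 1" u v] by (auto simp: MatD_iff)
  finally show "rho n (lam_seq t n x k) u v = x u v" .
qed

text \<open>Every finite stage already slices back to \<open>x\<close>, and the entries of
  \<open>rho\<close> are norm continuous by \<open>rho_entry_le\<close>.\<close>

lemma rho_lam_inf:
  assumes t: "1 / 2 \<le> t" "t < 1" and x: "x \<in> MatD n"
  shows "rho n (lam_inf t n x) = x"
proof (intro ext)
  fix u v
  have "(\<lambda>k. norm (lam_seq t n x k - lam_inf t n x)) \<longlonglongrightarrow> 0"
    using lam_seq_tendsto[OF t x] by (simp add: LIM_zero tendsto_norm_zero)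
  moreover have "norm (x u v - rho n (lam_inf t n x) u v) \<le> norm (lam_seq t n x k - lam_inf t n x)" for k
    using rho_entry_le[of n "lam_seq t n x k" u v "lam_inf t n x"] by (simp add: rho_lam_seq[OF x])
  ultimately have "norm (x u v - rho n (lam_inf t n x) u v) \<le> 0"
    by (intro LIMSEQ_le_const) auto
  then show "rho n (lam_inf t n x) u v = x u v" by simp
qed

section \<open>Invariance of the algebras under the maps\<close>

definition diagonal :: "tmat \<Rightarrow> bool" where
  "diagonal x \<longleftrightarrow> (\<forall>u v. u \<noteq> v \<longrightarrow> x u v = 0)"

lemma take_drop_neq: "u \<noteq> v \<Longrightarrow> take n u \<noteq> take n v \<or> drop n u \<noteq> drop n v"
  by (metis append_take_drop_id)

lemma diagonal_tensor: "diagonal x \<Longrightarrow> diagonal y \<Longrightarrow> diagonal (tensor n x y)"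
  unfolding diagonal_def tensor_def
proof (intro allI impI)
  fix u v :: "3 list"
  assume "\<forall>u v. u \<noteq> v \<longrightarrow> x u v = 0" "\<forall>u v. u \<noteq> v \<longrightarrow> y u v = 0" "u \<noteq> v"
  then show "x (take n u) (take n v) * y (drop n u) (drop n v) = 0"
    using take_drop_neq[OF \<open>u \<noteq> v\<close>, of n] by auto
qed

lemma diagonal_munit: "diagonal (munit j j)"
  and diagonal_mone: "diagonal (mone n)"
  and diagonal_add: "diagonal x \<Longrightarrow> diagonal y \<Longrightarrow> diagonal (x + y)"
  by (auto simp: diagonal_def munit_def mone_def)

lemma diagonal_tpow: "diagonal x \<Longrightarrow> diagonal (tpow x n)"
  by (induction n) (auto intro: diagonal_tensor diagonal_mone)

lemma diagonal_alpha: "diagonal (alpha n j)" and diagonal_beta: "diagonal (beta k j)"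
  unfolding alpha_def beta_def
  by (intro diagonal_tensor diagonal_munit diagonal_tpow diagonal_add)+

text \<open>The last letter falls into the right factor, which is diagonal and hence couples no two
  different letters. This places the generators of \<open>A_fin n\<close>, built from
  \<open>alpha\<close> and \<open>beta\<close>, in \<open>MatD n\<close>.\<close>

lemma tensor_MatD:
  assumes x: "x \<in> Mat n" and y: "y \<in> Mat (k + 1)" "diagonal y"
  shows "tensor n x y \<in> MatD (n + k)"
proof -
  have M: "tensor n x y \<in> Mat (n + k + 1)"
    using Mat_tensor[OF x y(1)] by (simp add: add.assoc)
  moreover have "tensor n x y (u @ [i]) (v @ [j]) = 0" if "i \<noteq> j" for u v i j
  proof (cases "u @ [i] \<in> words (n + k + 1) \<and> v @ [j] \<in> words (n + k + 1)")
    case True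
    then show ?thesis
      using y(2) that by (simp add: diagonal_def tensor_def words_def)
  next
    case False
    then show ?thesis
      using Mat_outside[OF M] by blast
  qed
  ultimately show ?thesis
    by (auto simp: MatD_iff)
qed

lemma A_fin_subset_MatD: "A_fin n \<subseteq> MatD n"
proof -
  have "alpha n j \<in> MatD n" for j
  proof -
    \<comment> \<open>\<open>alpha n j\<close> has no left factor; the unit of \<open>Mat 0\<close>
      supplies one.\<close>
    have "tensor 0 (mone 0) (alpha n j) \<in> MatD (0 + n)"
      by (intro tensor_MatD Mat_mone Mat_alpha diagonal_alpha)
    moreover have "tensor 0 (mone 0) (alpha n j) = alpha n j"
      by (simp add: tensor_def mone_def words_def)
    ultimately show ?thesis by simp
  qed
  moreover have "tensor (n - k) x (beta k j) \<in> MatD n" if "1 \<le> k" "k \<le> n" "x \<in> Mat (n - k)" for x k j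
    using tensor_MatD[OF that(3) Mat_beta[OF that(1)] diagonal_beta] that by simp
  moreover have "tmat.subspace (MatD n)"
    unfolding MatD_def by (rule tmat.subspace_span)
  ultimately show ?thesis
    unfolding A_fin_def by (intro tmat.span_minimal) blast+
qed

lemma tensor_assoc: "tensor n x (tensor m y z) = tensor (n + m) (tensor n x y) z"
  by (simp add: tensor_def fun_eq_iff take_drop add.commute mult.assoc)

lemma tensor_mone_0: "x \<in> Mat n \<Longrightarrow> tensor n x (mone 0) = x"
  using amp_self[of x n] by (simp add: amp_def)

text \<open>\<open>tpow\<close> adds factors on the left, whereas the next level appends one on the
  right.\<close>

lemma tpow_Suc_right:
  assumes "x \<in> Mat 1"
  shows "tpow x (Suc n) = tensor n (tpow x n) x"
proof (induction n)
  case 0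
  then show ?case
    using tensor_mone_0[OF assms] by (simp add: tensor_def mone_def words_def)
next
  case (Suc n)
  have "tpow x (Suc (Suc n)) = tensor 1 x (tensor n (tpow x n) x)"
    using Suc by simp
  then show ?case
    by (simp only: tensor_assoc tpow.simps plus_1_eq_Suc)
qed

lemma tensor_add_left: "tensor n (x + y) z = tensor n x z + tensor n y z"
  and tensor_add_right: "tensor n z (x + y) = tensor n z x + tensor n z y"
  and tensor_mscale_left: "tensor n (mscale c x) z = mscale c (tensor n x z)"
  and tensor_mscale_right: "tensor n z (mscale c x) = mscale c (tensor n z x)"
  and tensor_zero_left: "tensor n 0 z = 0"
  by (auto simp: tensor_def mscale_def fun_eq_iff algebra_simps)

lemma A_fin_alpha: "alpha n j \<in> A_fin n"
  and A_fin_beta: "1 \<le> k \<Longrightarrow> k \<le> n \<Longrightarrow> x \<in> Mat (n - k) \<Longrightarrow> tensor (n - k) x (beta k j) \<in> A_fin n"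
  unfolding A_fin_def by (rule tmat.span_base; blast)+

text \<open>Appending \<open>e_22\<close> sends generators to generators: \<open>alpha n j\<close>
  becomes \<open>alpha (n + 1) j\<close> and \<open>beta k j\<close> becomes
  \<open>beta (k + 1) j\<close>, with the same left factor \<open>x\<close> since
  \<open>n - k\<close> is unchanged.\<close>

lemma tensor_munit_22_A_fin:
  assumes "b \<in> A_fin n"
  shows "tensor (n + 1) b (munit 2 2) \<in> A_fin (n + 1)"
proof -
  have "A_fin n \<subseteq> {b. tensor (n + 1) b (munit 2 2) \<in> A_fin (n + 1)}"
    unfolding A_fin_def[of n]
  proof (rule tmat.span_minimal)
    show "tmat.subspace {b. tensor (n + 1) b (munit 2 2) \<in> A_fin (n + 1)}"
      unfolding A_fin_def
      by (rule tmat.subspaceI)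
        (auto simp: tensor_add_left tensor_mscale_left tensor_zero_left
          intro: tmat.span_zero tmat.span_add tmat.span_scale)
    have "tensor (n + 1) (alpha n j) (munit 2 2) = alpha (n + 1) j" for j
      using tensor_assoc[of 1 "munit j j" n "tpow (munit 2 2) n" "munit 2 2"] tpow_Suc_right[OF Mat_munit, of 2 2 n]
      by (simp add: alpha_def)
    then have a: "tensor (n + 1) (alpha n j) (munit 2 2) \<in> A_fin (n + 1)" for j
      by (simp only: A_fin_alpha)
    have b: "tensor (n + 1) (tensor (n - k) x (beta k j)) (munit 2 2) \<in> A_fin (n + 1)"
      if "1 \<le> k" "k \<le> n" "x \<in> Mat (n - k)" for x k j
    proof -
      let ?G = "tensor 1 (munit j j) (munit 1 1) + tensor 1 (munit (j + 2) (j + 2)) (munit 3 3)"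
      have "tensor (n + 1) (tensor (n - k) x (beta k j)) (munit 2 2) =
          tensor (n - k) x (tensor (k + 1) (beta k j) (munit 2 2))"
        using that by (simp add: tensor_assoc)
      also have "tensor (k + 1) (beta k j) (munit 2 2) = tensor 2 ?G (tensor (k - 1) (tpow (munit 2 2) (k - 1)) (munit 2 2))"
        using that by (simp add: tensor_assoc beta_def)
      also have "\<dots> = beta (k + 1) j"
        using tpow_Suc_right[OF Mat_munit, of 2 2 "k - 1"] that by (simp add: beta_def)
      finally have e: "tensor (n + 1) (tensor (n - k) x (beta k j)) (munit 2 2) = tensor (n + 1 - (k + 1)) x (beta (k + 1) j)"
        by simp
      show ?thesis
        unfolding e using that by (intro A_fin_beta) auto
    qed
    show "range (alpha n) \<union> {tensor (n - k) x (beta k j) |x k j. 1 \<le> k \<and> k \<le> n \<and> x \<in> Mat (n - k)}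
        \<subseteq> {b. tensor (n + 1) b (munit 2 2) \<in> A_fin (n + 1)}"
      using a b by blast
  qed
  then show ?thesis
    using assms by blast
qed

text \<open>As \<open>alpha 1 j\<close> is \<open>e_jj\<close> \<otimes> \<open>e_22\<close>, the
  \<alpha>-terms add up to \<open>b\<close> \<otimes> \<open>e_22\<close>. The other terms are
  multiples of generators of \<open>A_fin (n + 1)\<close> with \<open>k = 1\<close>, whose left
  factor may be any member of \<open>Mat n\<close>.\<close>

lemma lam_n_A_fin:
  assumes b: "b \<in> A_fin n"
  shows "lam_n t n b \<in> A_fin (n + 1)"
proof -
  have bD: "b \<in> MatD n"
    using b A_fin_subset_MatD by blast
  have M: "diag_block b j \<in> Mat n" for j
    using bD by (intro Mat_diag_block) (simp add: MatD_iff)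
  have B: "tensor n (diag_block b j) (beta 1 i) \<in> A_fin (n + 1)" for i j
  proof -
    have "tensor (n + 1 - 1) (diag_block b j) (beta 1 i) \<in> A_fin (n + 1)"
      using M by (intro A_fin_beta) auto
    then show ?thesis by simp
  qed
  have "alpha 1 j = tensor 1 (munit j j) (munit 2 2)" for j
    using tensor_mone_0[OF Mat_munit, of 2 2] by (simp add: alpha_def)
  then have "lam_n t n b = (\<Sum>j\<in>UNIV. tensor (n + 1) (tensor n (diag_block b j) (munit j j)) (munit 2 2)
      + mscale (of_real (1 - t)) (tensor n (diag_block b j) (beta 1 j))
      + mscale (of_real (1 - t)) (tensor n (diag_block b j) (beta 1 (j + 1)))
      + mscale (of_real (2 * t - 1)) (tensor n (diag_block b j) (beta 1 (j - 1))))"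
    by (simp only: lam_n_def lam_munit tensor_add_right tensor_mscale_right tensor_assoc flip: diag_block_def)
  also have "\<dots> = tensor (n + 1) (\<Sum>j\<in>UNIV. tensor n (diag_block b j) (munit j j)) (munit 2 2) +
     (\<Sum>j\<in>UNIV. mscale (of_real (1 - t)) (tensor n (diag_block b j) (beta 1 j))
      + mscale (of_real (1 - t)) (tensor n (diag_block b j) (beta 1 (j + 1)))
      + mscale (of_real (2 * t - 1)) (tensor n (diag_block b j) (beta 1 (j - 1))))"
    unfolding sum_3 tensor_add_left by (simp only: ac_simps)
  also have "(\<Sum>j\<in>UNIV. tensor n (diag_block b j) (munit j j)) = b"
    by (rule MatD_decomp[OF bD, symmetric])
  finally have eq: "lam_n t n b = tensor (n + 1) b (munit 2 2) +
     (\<Sum>j\<in>UNIV. mscale (of_real (1 - t)) (tensor n (diag_block b j) (beta 1 j))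
      + mscale (of_real (1 - t)) (tensor n (diag_block b j) (beta 1 (j + 1)))
      + mscale (of_real (2 * t - 1)) (tensor n (diag_block b j) (beta 1 (j - 1))))" .
  have sub: "tmat.subspace (A_fin (n + 1))"
    unfolding A_fin_def by (rule tmat.subspace_span)
  show ?thesis
    unfolding eq
    by (intro tmat.subspace_add[OF sub] tmat.subspace_sum[OF sub] tmat.subspace_scale[OF sub]
        B tensor_munit_22_A_fin[OF b])
qed

lemma lam_iter_A_fin: "b \<in> A_fin n \<Longrightarrow> lam_iter t n k b \<in> A_fin (n + k)"
  by (induction k) (use lam_n_A_fin in auto)

lemma lam_inf_A_fin:
  assumes t: "1 / 2 \<le> t" "t < 1" and b: "b \<in> A_fin n"
  shows "lam_inf t n b \<in> A_inf"
proof -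
  \<comment> \<open>\<open>A_inf\<close> indexes its sequences by the level \<open>N\<close>, where
    the iterate with index \<open>N - n\<close> lives; the value \<open>0\<close> below level
    \<open>n\<close> does not affect the limit.\<close>
  define s where "s N = (if n \<le> N then lam_iter t n (N - n) b else 0)" for N
  have "s N \<in> A_fin N" for N
    using lam_iter_A_fin[OF b, of t "N - n"] by (auto simp: s_def A_fin_def tmat.span_zero)
  moreover have "(\<lambda>N. iota (N + 1) (s N)) \<longlonglongrightarrow> lam_inf t n b"
  proof (rule LIMSEQ_offset[where k = n])
    have "lam_seq t n b \<longlonglongrightarrow> lam_inf t n b"
      using lam_seq_tendsto[OF t] b A_fin_subset_MatD by blast
    moreover have "iota (k + n + 1) (s (k + n)) = lam_seq t n b k" for k
      by (simp add: s_def lam_seq_def add.commute)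
    ultimately show "(\<lambda>k. iota (k + n + 1) (s (k + n))) \<longlonglongrightarrow> lam_inf t n b"
      by presburger
  qed
  ultimately show ?thesis
    by (auto simp: A_inf_def)
qed

section \<open>Square roots of matrices with power-bounded defect\<close>

lemma sum_of_bool_mult:
  fixes f :: "'i \<Rightarrow> 'a::semiring_1"
  assumes "finite I" "p \<in> I"
  shows "(\<Sum>s\<in>I. of_bool (p = s) * f s) = f p"
proof -
  have "(\<Sum>s\<in>I. of_bool (p = s) * f s) = (\<Sum>s\<in>I. if p = s then f s else 0)"
    by (intro sum.cong) auto
  then show ?thesis
    using assms by simp
qed

section \<open>The binomial series with exponent 1/2\<close>

text \<open>The power series coefficients of \<open>(1 - x)\<^bsup>1/2\<^esup>\<close>.\<close>

definition sqrt_coeff :: "nat \<Rightarrow> real" where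
  "sqrt_coeff k = pochhammer (- 1 / 2) k / fact k"

lemma sqrt_coeff_gbinomial: "sqrt_coeff k = (- 1) ^ k * (1 / 2 gchoose k)"
  by (simp add: sqrt_coeff_def gbinomial_pochhammer)

text \<open>All coefficients but the zeroth are nonpositive, and the partial sums have a nonnegative
  closed form, so the sums of absolute values stay below \<open>2\<close>. The series thus converges
  absolutely even at \<open>x = 1\<close>.\<close>

lemma summable_sqrt_coeff: "summable (\<lambda>k. \<bar>sqrt_coeff k\<bar>)"
proof (rule bounded_imp_summable)
  fix m
  have neg: "\<bar>sqrt_coeff k\<bar> = of_bool (0 = k) * 2 - sqrt_coeff k" for k
  proof (cases k)
    case (Suc k')
    have "0 \<le> pochhammer (1 / 2 :: real) k'"
      by (rule pochhammer_nonneg) simp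
    then have "sqrt_coeff k \<le> 0"
      by (simp add: sqrt_coeff_def Suc pochhammer_rec del: fact_Suc)
    then show ?thesis
      by (simp add: Suc)
  qed (simp add: sqrt_coeff_def)
  have "0 \<le> pochhammer (1 / 2 :: real) m / fact m"
    by (intro divide_nonneg_nonneg pochhammer_nonneg) auto
  also have "\<dots> = (- 1) ^ m * (1 / 2 - 1 gchoose m)"
    by (simp add: gbinomial_pochhammer)
  also have "\<dots> = (\<Sum>k\<le>m. sqrt_coeff k)"
    using gbinomial_sum_lower_neg[of "1 / 2 :: real" m] by (simp add: sqrt_coeff_gbinomial mult.commute)
  finally have "0 \<le> (\<Sum>k\<le>m. sqrt_coeff k)" .
  moreover have "(\<Sum>k\<le>m. \<bar>sqrt_coeff k\<bar>) = 2 - (\<Sum>k\<le>m. sqrt_coeff k)"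
    by (simp only: neg sum_subtractf sum_of_bool_mult[OF finite_atMost] atMost_iff zero_le)
  ultimately show "(\<Sum>k\<le>m. \<bar>sqrt_coeff k\<bar>) \<le> 2"
    by simp
qed simp

text \<open>The square of the series is \<open>1 - x\<close>, by Vandermonde's identity for
  \<open>1/2 + 1/2 = 1\<close>.\<close>

lemma sqrt_coeff_convolution:
  "(\<Sum>i\<le>k. sqrt_coeff i * sqrt_coeff (k - i)) = (if k = 0 then 1 else if k = 1 then - 1 else 0)"
proof -
  have "(\<Sum>i\<le>k. sqrt_coeff i * sqrt_coeff (k - i)) =
      (\<Sum>i\<le>k. (- 1) ^ k * ((1 / 2 gchoose i) * (1 / 2 gchoose (k - i))))"
  proof (rule sum.cong)
    fix i assume "i \<in> {..k}"
    then have "(- 1 :: real) ^ k = (- 1) ^ i * (- 1) ^ (k - i)"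
      by (simp flip: power_add)
    then show "sqrt_coeff i * sqrt_coeff (k - i) = (- 1) ^ k * ((1 / 2 gchoose i) * (1 / 2 gchoose (k - i)))"
      by (simp add: sqrt_coeff_gbinomial)
  qed simp
  also have "\<dots> = (- 1) ^ k * ((1 / 2 + 1 / 2) gchoose k :: real)"
    using gbinomial_Vandermonde[of "1 / 2 :: real" "1 / 2" k]
    by (simp add: sum_distrib_left[symmetric] atMost_atLeast0)
  also have "((1 / 2 + 1 / 2) gchoose k :: real) = of_nat (1 choose k)"
    by (simp add: binomial_gbinomial)
  finally show ?thesis
    by (cases "k \<le> 1") (auto simp: le_Suc_eq)
qed

section \<open>Matrix powers, square roots and power bounds\<close>

primrec mpow :: "'i set \<Rightarrow> ('i \<Rightarrow> 'i \<Rightarrow> 'a::ring_1) \<Rightarrow> nat \<Rightarrow> 'i \<Rightarrow> 'i \<Rightarrow> 'a" where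
  "mpow I C 0 p q = of_bool (p = q)"
| "mpow I C (Suc r) p q = (\<Sum>s\<in>I. C p s * mpow I C r s q)"

lemma mpow_add:
  assumes "finite I" "p \<in> I"
  shows "(\<Sum>s\<in>I. mpow I C i p s * mpow I C j s q) = mpow I C (i + j) p q"
  using assms(2)
proof (induction i arbitrary: p)
  case 0
  then show ?case
    by (simp only: mpow.simps sum_of_bool_mult[OF assms(1)] add_0)
next
  case (Suc i)
  have "(\<Sum>s\<in>I. mpow I C (Suc i) p s * mpow I C j s q) =
      (\<Sum>s\<in>I. \<Sum>s'\<in>I. C p s' * (mpow I C i s' s * mpow I C j s q))"
    by (simp add: sum_distrib_right mult.assoc)
  also have "\<dots> = (\<Sum>s'\<in>I. C p s' * (\<Sum>s\<in>I. mpow I C i s' s * mpow I C j s q))"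
    unfolding sum_distrib_left by (rule sum.swap)
  finally show ?case
    using Suc.IH by simp
qed

lemma mpow_1: "finite I \<Longrightarrow> q \<in> I \<Longrightarrow> mpow I C (Suc 0) p q = C p q"
  by (simp add: of_bool_def if_distrib cong: if_cong)

lemma mpow_Suc_right:
  assumes "finite I" "p \<in> I" "q \<in> I"
  shows "mpow I C (Suc r) p q = (\<Sum>s\<in>I. mpow I C r p s * C s q)"
  using mpow_add[OF assms(1,2), of C r "Suc 0" q] mpow_1[OF assms(1,3), of C]
  by (simp del: mpow.simps)

text \<open>The coefficients are absolutely summable, so a bound on the entries of all powers makes
  the series converge entrywise. The Cauchy product then collapses to \<open>1 - C\<close> by
  \<open>sqrt_coeff_convolution\<close>.\<close>

lemma mpow_sqrt:
  fixes C :: "'i \<Rightarrow> 'i \<Rightarrow> 'a::{real_normed_algebra_1, banach}"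
  assumes I: "finite I" and M: "\<And>r p q. p \<in> I \<Longrightarrow> q \<in> I \<Longrightarrow> norm (mpow I C r p q) \<le> M"
  defines "S \<equiv> \<lambda>p q. \<Sum>r. sqrt_coeff r *\<^sub>R mpow I C r p q"
  assumes pq: "p \<in> I" "q \<in> I"
  shows "summable (\<lambda>r. norm (sqrt_coeff r *\<^sub>R mpow I C r p q))"
    and "(\<Sum>s\<in>I. S p s * S s q) = of_bool (p = q) - C p q"
proof -
  have sm: "summable (\<lambda>r. norm (sqrt_coeff r *\<^sub>R mpow I C r p q))" if "p \<in> I" "q \<in> I" for p q
  proof (rule summable_comparison_test'[where N = 0])
    show "summable (\<lambda>r. \<bar>sqrt_coeff r\<bar> * M)"
      by (intro summable_mult2 summable_sqrt_coeff)
    show "norm (norm (sqrt_coeff r *\<^sub>R mpow I C r p q)) \<le> \<bar>sqrt_coeff r\<bar> * M" for r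
      using M[OF that] by (simp add: mult_left_mono)
  qed
  then show "summable (\<lambda>r. norm (sqrt_coeff r *\<^sub>R mpow I C r p q))"
    using pq .
  have "(\<lambda>k. \<Sum>s\<in>I. \<Sum>i\<le>k. (sqrt_coeff i *\<^sub>R mpow I C i p s) * (sqrt_coeff (k - i) *\<^sub>R mpow I C (k - i) s q))
      sums (\<Sum>s\<in>I. S p s * S s q)"
    unfolding S_def by (intro sums_sum Cauchy_product_sums sm pq)
  moreover have "(\<Sum>s\<in>I. \<Sum>i\<le>k. (sqrt_coeff i *\<^sub>R mpow I C i p s) * (sqrt_coeff (k - i) *\<^sub>R mpow I C (k - i) s q)) =
      (if k = 0 then 1 else if k = 1 then - 1 else 0) *\<^sub>R mpow I C k p q" for k
  proof -
    have "(\<Sum>s\<in>I. \<Sum>i\<le>k. (sqrt_coeff i *\<^sub>R mpow I C i p s) * (sqrt_coeff (k - i) *\<^sub>R mpow I C (k - i) s q)) =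
        (\<Sum>i\<le>k. (sqrt_coeff i * sqrt_coeff (k - i)) *\<^sub>R (\<Sum>s\<in>I. mpow I C i p s * mpow I C (k - i) s q))"
      unfolding scaleR_sum_right by (subst sum.swap) (simp add: mult.commute)
    also have "\<dots> = (\<Sum>i\<le>k. (sqrt_coeff i * sqrt_coeff (k - i)) *\<^sub>R mpow I C k p q)"
      by (intro sum.cong refl) (simp add: mpow_add[OF I pq(1)])
    also have "\<dots> = (\<Sum>i\<le>k. sqrt_coeff i * sqrt_coeff (k - i)) *\<^sub>R mpow I C k p q"
      by (simp add: scaleR_sum_left)
    finally show ?thesis
      by (simp only: sqrt_coeff_convolution)
  qed
  moreover have "(\<lambda>k. (if k = 0 then 1 else if k = 1 then - 1 else 0) *\<^sub>R mpow I C k p q) sums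
      (\<Sum>k\<in>{0, 1}. (if k = 0 then 1 else if k = 1 then - 1 else 0) *\<^sub>R mpow I C k p q)"
    by (rule sums_finite) auto
  ultimately have "(\<Sum>s\<in>I. S p s * S s q) =
      (\<Sum>k\<in>{0, 1}. (if k = 0 then 1 else if k = 1 then - 1 else 0) *\<^sub>R mpow I C k p q)"
    by (simp only: sums_iff) 
  then show "(\<Sum>s\<in>I. S p s * S s q) = of_bool (p = q) - C p q"
    using mpow_1[OF I pq(2), of C p] by (simp del: mpow.simps(2))
qed

text \<open>\<open>K\<close> dominates the squared Frobenius norm of \<open>B\<close>. Expanding the
  square gives the cross term \<open>- 2 * H / K\<close>, while Cauchy-Schwarz bounds the quadratic
  term by \<open>H / K\<close>; the sum is at most \<open>- H / K\<close>.\<close>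

lemma gram_contraction:
  fixes B :: "'l \<Rightarrow> 'i \<Rightarrow> complex" and \<xi> :: "'i \<Rightarrow> complex"
  assumes fin: "finite I" "finite L" and K: "0 < K" "(\<Sum>l\<in>L. \<Sum>i\<in>I. (cmod (B l i))\<^sup>2) \<le> K"
  shows "(\<Sum>i\<in>I. (cmod (\<Sum>j\<in>I. (of_bool (i = j) - (\<Sum>l\<in>L. cnj (B l i) * B l j) / of_real K) * \<xi> j))\<^sup>2)
    \<le> (\<Sum>i\<in>I. (cmod (\<xi> i))\<^sup>2)"
proof -
  \<comment> \<open>\<open>\<eta>\<close> is \<open>B\<close> applied to \<open>\<xi>\<close>,
    \<open>\<zeta>\<close> is the Gram matrix applied to \<open>\<xi>\<close>, and \<open>H\<close>
    is the squared length of \<open>\<eta>\<close>.\<close>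
  define \<eta> where "\<eta> l = (\<Sum>j\<in>I. B l j * \<xi> j)" for l
  define \<zeta> where "\<zeta> i = (\<Sum>l\<in>L. cnj (B l i) * \<eta> l)" for i
  define H where "H = (\<Sum>l\<in>L. (cmod (\<eta> l))\<^sup>2)"
  have H: "0 \<le> H"
    by (simp add: H_def sum_nonneg)
  have "(\<Sum>j\<in>I. (of_bool (i = j) - (\<Sum>l\<in>L. cnj (B l i) * B l j) / of_real K) * \<xi> j) = \<xi> i - \<zeta> i / of_real K"
    if "i \<in> I" for i
  proof -
    have "(\<Sum>j\<in>I. (\<Sum>l\<in>L. cnj (B l i) * B l j) / of_real K * \<xi> j) = \<zeta> i / of_real K"
      unfolding \<zeta>_def \<eta>_def sum_divide_distrib sum_distrib_left sum_distrib_right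
      by (subst sum.swap) (simp add: mult.assoc)
    then show ?thesis
      by (simp only: left_diff_distrib sum_subtractf sum_of_bool_mult[OF fin(1) that])
  qed
  then have "(\<Sum>i\<in>I. (cmod (\<Sum>j\<in>I. (of_bool (i = j) - (\<Sum>l\<in>L. cnj (B l i) * B l j) / of_real K) * \<xi> j))\<^sup>2) =
      (\<Sum>i\<in>I. (cmod (\<xi> i - \<zeta> i / of_real K))\<^sup>2)"
    by simp
  also have "\<dots> = (\<Sum>i\<in>I. (cmod (\<xi> i))\<^sup>2 - 2 / K * Re (cnj (\<xi> i) * \<zeta> i) + (cmod (\<zeta> i))\<^sup>2 / K\<^sup>2)"
  proof (intro sum.cong refl)
    fix i
    have e: "(cmod (\<xi> i - \<zeta> i / of_real K))\<^sup>2 = (Re (\<xi> i) - Re (\<zeta> i) / K)\<^sup>2 + (Im (\<xi> i) - Im (\<zeta> i) / K)\<^sup>2"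
      by (simp add: cmod_power2)
    show "(cmod (\<xi> i - \<zeta> i / of_real K))\<^sup>2 =
        (cmod (\<xi> i))\<^sup>2 - 2 / K * Re (cnj (\<xi> i) * \<zeta> i) + (cmod (\<zeta> i))\<^sup>2 / K\<^sup>2"
      unfolding e cmod_power2[of "\<xi> i"] cmod_power2[of "\<zeta> i"]
      using K(1) by (simp add: power2_eq_square field_simps)
  qed
  also have "\<dots> = (\<Sum>i\<in>I. (cmod (\<xi> i))\<^sup>2) - 2 / K * (\<Sum>i\<in>I. Re (cnj (\<xi> i) * \<zeta> i)) + (\<Sum>i\<in>I. (cmod (\<zeta> i))\<^sup>2) / K\<^sup>2"
    by (simp only: sum.distrib sum_subtractf sum_distrib_left sum_divide_distrib)
  also have "(\<Sum>i\<in>I. Re (cnj (\<xi> i) * \<zeta> i)) = H"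
  proof -
    have cnj_eta: "cnj (\<eta> l) = (\<Sum>j\<in>I. cnj (B l j) * cnj (\<xi> j))" for l
      by (simp add: \<eta>_def)
    have "(\<Sum>i\<in>I. cnj (\<xi> i) * \<zeta> i) = (\<Sum>l\<in>L. cnj (\<eta> l) * \<eta> l)"
      unfolding \<zeta>_def sum_distrib_left
      by (subst sum.swap) (simp add: cnj_eta sum_distrib_left sum_distrib_right mult_ac)
    also have "\<dots> = of_real H"
      unfolding H_def of_real_sum
      by (intro sum.cong refl) (metis complex_norm_square mult.commute of_real_power)
    finally show ?thesis
      by (metis Re_sum Re_complex_of_real)
  qed
  also have "(\<Sum>i\<in>I. (cmod (\<zeta> i))\<^sup>2) \<le> K * H"
  proof -
    have "(cmod (\<zeta> i))\<^sup>2 \<le> (\<Sum>l\<in>L. (cmod (B l i))\<^sup>2) * H" for i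
    proof -
      have "cmod (\<zeta> i) \<le> (\<Sum>l\<in>L. cmod (B l i) * cmod (\<eta> l))"
        unfolding \<zeta>_def by (rule order_trans[OF norm_sum]) (simp add: norm_mult)
      then have "(cmod (\<zeta> i))\<^sup>2 \<le> (\<Sum>l\<in>L. cmod (B l i) * cmod (\<eta> l))\<^sup>2"
        by (rule power_mono) simp
      also have "\<dots> \<le> (\<Sum>l\<in>L. (cmod (B l i))\<^sup>2) * H"
        unfolding H_def by (rule Cauchy_Schwarz_ineq_sum)
      finally show ?thesis .
    qed
    then have "(\<Sum>i\<in>I. (cmod (\<zeta> i))\<^sup>2) \<le> (\<Sum>i\<in>I. \<Sum>l\<in>L. (cmod (B l i))\<^sup>2) * H"
      unfolding sum_distrib_right[of _ _ H] by (intro sum_mono)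
    also have "(\<Sum>i\<in>I. \<Sum>l\<in>L. (cmod (B l i))\<^sup>2) = (\<Sum>l\<in>L. \<Sum>i\<in>I. (cmod (B l i))\<^sup>2)"
      by (rule sum.swap)
    also have "\<dots> * H \<le> K * H"
      using K(2) H by (rule mult_right_mono)
    finally show ?thesis .
  qed
  finally have "(\<Sum>i\<in>I. (cmod (\<Sum>j\<in>I. (of_bool (i = j) - (\<Sum>l\<in>L. cnj (B l i) * B l j) / of_real K) * \<xi> j))\<^sup>2)
      \<le> (\<Sum>i\<in>I. (cmod (\<xi> i))\<^sup>2) - 2 / K * H + K * H / K\<^sup>2"
    by (simp add: divide_right_mono)
  also have "\<dots> \<le> (\<Sum>i\<in>I. (cmod (\<xi> i))\<^sup>2)"
    using K(1) H by (simp add: power2_eq_square field_simps)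
  finally show ?thesis .
qed

text \<open>Column \<open>j\<close> of a power of \<open>T\<close> is that power applied to a unit
  vector, so its length stays at most \<open>1\<close>.\<close>

lemma mpow_contraction_entry_le:
  fixes T :: "'i \<Rightarrow> 'i \<Rightarrow> complex"
  assumes fin: "finite I"
    and T: "\<And>\<xi>. (\<Sum>i\<in>I. (cmod (\<Sum>j\<in>I. T i j * \<xi> j))\<^sup>2) \<le> (\<Sum>i\<in>I. (cmod (\<xi> i))\<^sup>2)"
    and ij: "i \<in> I" "j \<in> I"
  shows "cmod (mpow I T r i j) \<le> 1"
proof -
  have "(\<Sum>i\<in>I. (cmod (mpow I T r i j))\<^sup>2) \<le> 1"
  proof (induction r)
    case 0
    have "(\<Sum>i\<in>I. (cmod (mpow I T 0 i j))\<^sup>2) = (\<Sum>i\<in>I. if i = j then 1 else 0)"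
      by (intro sum.cong) auto
    then show ?case
      using fin by simp
  next
    case (Suc r)
    then show ?case
      using T[of "\<lambda>s. mpow I T r s j"] by simp
  qed
  then have "(cmod (mpow I T r i j))\<^sup>2 \<le> 1"
    using member_le_sum[of i I "\<lambda>i. (cmod (mpow I T r i j))\<^sup>2"] fin ij by simp
  then show ?thesis
    by (simp add: abs_square_le_1)
qed

section \<open>Complete positivity\<close>

lemma norm_ustar: "norm (ustar a) = norm a"
proof (cases a rule: uhf_rep)
  case (1 X)
  then have "(\<lambda>n. mnorm n (mstar (X n))) \<longlonglongrightarrow> norm a"
    using norm_uhf_tendsto[of X] by (simp add: mnorm_mstar)
  then show ?thesis
    using 1 norm_uhf_eqI[of "\<lambda>n. mstar (X n)"] by (simp add: ustar.abs_eq coherent_mstar)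
qed

lemma bounded_linear_ustar: "bounded_linear ustar"
  by (rule bounded_linear_intro[where K = 1])
    (simp_all add: ustar_add scaleR_cscale ustar_cscale norm_ustar)

lemma bounded_linear_cscale: "bounded_linear (cscale c)"
proof (rule bounded_linear_intro[where K = "cmod c"])
  interpret vector_space cscale
    by (rule cscale_vector_space)
  show "cscale c (x + y) = cscale c x + cscale c y" for x y
    by (rule scale_right_distrib)
  show "cscale c (r *\<^sub>R x) = r *\<^sub>R cscale c x" for r x
    by (simp add: scaleR_cscale mult.commute)
qed (simp add: norm_cscale)

section \<open>The *-algebra \<open>MatD n\<close> and linearity of the limit map\<close>

lemma MatD_add: "x \<in> MatD n \<Longrightarrow> y \<in> MatD n \<Longrightarrow> x + y \<in> MatD n"
  and MatD_mscale: "x \<in> MatD n \<Longrightarrow> mscale c x \<in> MatD n"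
  and MatD_sum: "(\<And>i. i \<in> I \<Longrightarrow> f i \<in> MatD n) \<Longrightarrow> sum f I \<in> MatD n"
  unfolding MatD_def by (fact tmat.span_add, fact tmat.span_scale, rule tmat.span_sum)

lemma MatD_mstar: "x \<in> MatD n \<Longrightarrow> mstar x \<in> MatD n"
  by (auto simp: MatD_iff Mat_mstar mstar_def intro: Mat_mstar[unfolded mstar_def])

text \<open>Members of \<open>MatD n\<close> multiply block by block.\<close>

lemma mmul_snoc_entry:
  assumes "x \<in> MatD n" "y \<in> MatD n"
  shows "mmul (n + 1) x y (u @ [i]) (v @ [j]) =
    of_bool (i = j) * mmul n (diag_block x i) (diag_block y j) u v"
proof -
  have "words 1 = (\<lambda>a. [a]) ` (UNIV :: 3 set)"
    by (auto simp: words_def length_Suc_conv)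
  then have w1: "(\<Sum>b\<in>words 1. f b) = (\<Sum>a\<in>UNIV. f [a])" for f :: "3 list \<Rightarrow> complex"
    by (simp add: sum.reindex inj_on_def)
  have e: "x (u @ [i]) (w @ [a]) * y (w @ [a]) (v @ [j]) =
      of_bool (i = a) * (of_bool (i = j) * (x (u @ [i]) (w @ [a]) * y (w @ [a]) (v @ [j])))" for w a
    using assms by (cases "i = a"; cases "i = j") (simp_all add: MatD_iff)
  have "mmul (n + 1) x y (u @ [i]) (v @ [j]) =
      (\<Sum>w\<in>words n. \<Sum>a\<in>UNIV. x (u @ [i]) (w @ [a]) * y (w @ [a]) (v @ [j]))"
    unfolding mmul_def sum_words_add w1 ..
  also have "\<dots> = (\<Sum>w\<in>words n. of_bool (i = j) * (x (u @ [i]) (w @ [i]) * y (w @ [i]) (v @ [j])))"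
    by (subst e, subst sum_of_bool_mult) simp_all
  also have "\<dots> = of_bool (i = j) * mmul n (diag_block x i) (diag_block y j) u v"
    by (simp add: mmul_def diag_block_def sum_distrib_left of_bool_def)
  finally show ?thesis .
qed

lemma MatD_mmul:
  assumes "x \<in> MatD n" "y \<in> MatD n"
  shows "mmul (n + 1) x y \<in> MatD n"
  unfolding MatD_iff
proof (intro conjI allI impI)
  show "mmul (n + 1) x y \<in> Mat (n + 1)"
    using assms by (intro Mat_mmul) (auto simp: MatD_iff)
qed (simp add: mmul_snoc_entry[OF assms, simplified])

text \<open>The closed form \<open>level\<close> is additive in \<open>x\<close>, hence so is the
  limit. Scalars and adjoints are handled likewise, the adjoint because the weights are
  real.\<close>

lemma lam_inf_add:
  assumes t: "1 / 2 \<le> t" "t < 1" and x: "x \<in> MatD n" and y: "y \<in> MatD n"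
  shows "lam_inf t n (x + y) = lam_inf t n x + lam_inf t n y"
proof (rule LIMSEQ_unique[OF lam_seq_tendsto[OF t MatD_add[OF x y]]])
  have "level t n k (x + y) = level t n k x + level t n k y" for k
    unfolding level_def blk_add
    by (rule blk_cong) (simp add: sum_tmat_apply mscale_def diag_block_def sum.distrib distrib_left)
  then have "lam_seq t n (x + y) k = lam_seq t n x k + lam_seq t n y k" for k
    unfolding lam_seq_eq[OF x] lam_seq_eq[OF y] lam_seq_eq[OF MatD_add[OF x y]]
    by (simp only: iota_add[OF Mat_level Mat_level])
  then show "lam_seq t n (x + y) \<longlonglongrightarrow> lam_inf t n x + lam_inf t n y"
    using tendsto_add[OF lam_seq_tendsto[OF t x] lam_seq_tendsto[OF t y]] by presburger
qed

lemma lam_inf_mscale: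
  assumes t: "1 / 2 \<le> t" "t < 1" and x: "x \<in> MatD n"
  shows "lam_inf t n (mscale c x) = cscale c (lam_inf t n x)"
proof (rule LIMSEQ_unique[OF lam_seq_tendsto[OF t MatD_mscale[OF x]]])
  have "level t n k (mscale c x) = mscale c (level t n k x)" for k
    unfolding level_def blk_mscale
    by (rule blk_cong) (simp add: sum_tmat_apply mscale_def diag_block_def sum_distrib_left mult_ac)
  then have "lam_seq t n (mscale c x) k = cscale c (lam_seq t n x k)" for k
    unfolding lam_seq_eq[OF x] lam_seq_eq[OF MatD_mscale[OF x]]
    by (simp only: iota_mscale[OF Mat_level])
  then show "lam_seq t n (mscale c x) \<longlonglongrightarrow> cscale c (lam_inf t n x)"
    using bounded_linear.tendsto[OF bounded_linear_cscale lam_seq_tendsto[OF t x]] by presburger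
qed

lemma lam_inf_mstar:
  assumes t: "1 / 2 \<le> t" "t < 1" and x: "x \<in> MatD n"
  shows "lam_inf t n (mstar x) = ustar (lam_inf t n x)"
proof (rule LIMSEQ_unique[OF lam_seq_tendsto[OF t MatD_mstar[OF x]]])
  have "level t n k (mstar x) = mstar (level t n k x)" for k
    unfolding level_def blk_mstar
    by (rule blk_cong) (simp add: sum_tmat_apply mscale_def diag_block_def mstar_def)
  then have "lam_seq t n (mstar x) k = ustar (lam_seq t n x k)" for k
    unfolding lam_seq_eq[OF x] lam_seq_eq[OF MatD_mstar[OF x]]
    by (simp only: iota_mstar[OF Mat_level])
  then show "lam_seq t n (mstar x) \<longlonglongrightarrow> ustar (lam_inf t n x)"
    using bounded_linear.tendsto[OF bounded_linear_ustar lam_seq_tendsto[OF t x]] by presburger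
qed

section \<open>Powers of matrices over the limit algebra\<close>

lemma iota_zero: "iota n 0 = 0"
  using norm_iota[OF Mat_zero, of n] by simp

lemma iota_sum:
  assumes "finite I" "\<And>i. i \<in> I \<Longrightarrow> f i \<in> Mat n"
  shows "iota n (sum f I) = (\<Sum>i\<in>I. iota n (f i)) \<and> sum f I \<in> Mat n"
  using assms
proof (induction I)
  case empty
  show "iota n (sum f {}) = (\<Sum>i\<in>{}. iota n (f i)) \<and> sum f {} \<in> Mat n"
    by (simp add: iota_zero)
next
  case (insert i I)
  then show "iota n (sum f (insert i I)) = (\<Sum>i\<in>insert i I. iota n (f i)) \<and> sum f (insert i I) \<in> Mat n"
    using iota_add[of "f i" n "sum f I"] Mat_add[of "f i" n "sum f I"] by simp
qed

lemma blk_sum: "(\<Sum>i\<in>I. blk n r (F i)) = blk n r (\<lambda>w. \<Sum>i\<in>I. F i w)"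
  by (intro ext) (auto simp: sum_tmat_apply blk_def)

text \<open>A matrix over the block diagonal algebra is a family, indexed by the labels
  \<open>w\<close>, of scalar matrices with rows and columns \<open>(p, u)\<close>; its powers are
  taken separately for each \<open>w\<close>.\<close>

lemma mpow_iota_blk:
  fixes T :: "3 list \<Rightarrow> 'p \<times> 3 list \<Rightarrow> 'p \<times> 3 list \<Rightarrow> complex"
  assumes I: "finite I"
    and C: "\<And>p q. p \<in> I \<Longrightarrow> q \<in> I \<Longrightarrow> C p q = iota (n + r) (blk n r (\<lambda>w u v. T w (p, u) (q, v)))"
    and pq: "p \<in> I" "q \<in> I"
  shows "mpow I C i p q = iota (n + r) (blk n r (\<lambda>w u v. mpow (I \<times> words n) (T w) i (p, u) (q, v)))"
  using pq(1)
proof (induction i arbitrary: p)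
  case 0
  show ?case
  proof (cases "p = q")
    case True
    have e: "blk n r (\<lambda>w u v. mpow (I \<times> words n) (T w) 0 (p, u) (q, v)) = mone (n + r)"
      unfolding blk_mone[symmetric] by (rule blk_cong) (simp add: True mone_def)
    show ?thesis
      unfolding e iota_mone by (simp add: True)
  next
    case False
    have e: "blk n r (\<lambda>w u v. mpow (I \<times> words n) (T w) 0 (p, u) (q, v)) = 0"
      by (rule trans[OF blk_cong blk_zero]) (simp add: False)
    show ?thesis
      unfolding e iota_zero by (simp add: False)
  qed
next
  case (Suc i)
  let ?G = "\<lambda>s w. mmul n (\<lambda>u v. T w (p, u) (s, v)) (\<lambda>u v. mpow (I \<times> words n) (T w) i (s, u) (q, v))"
  have G: "C p s * mpow I C i s q = iota (n + r) (blk n r (?G s))" if s: "s \<in> I" for s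
    unfolding C[OF Suc.prems s] Suc.IH[OF s] blk_mmul[symmetric]
    by (rule iota_mmul[OF Mat_blk Mat_blk, symmetric])
  have "mpow I C (Suc i) p q = (\<Sum>s\<in>I. iota (n + r) (blk n r (?G s)))"
    unfolding mpow.simps by (rule sum.cong[OF refl G])
  also have "\<dots> = iota (n + r) (\<Sum>s\<in>I. blk n r (?G s))"
    using iota_sum[OF I, of "\<lambda>s. blk n r (?G s)" "n + r"] by (metis Mat_blk)
  also have "(\<Sum>s\<in>I. blk n r (?G s)) = blk n r (\<lambda>w. \<Sum>s\<in>I. ?G s w)"
    by (rule blk_sum)
  also have "\<dots> = blk n r (\<lambda>w u v. mpow (I \<times> words n) (T w) (Suc i) (p, u) (q, v))"
    by (rule blk_cong) (simp add: sum_tmat_apply mmul_def sum.cartesian_product split_beta)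
  finally show ?case .
qed

text \<open>Entries of powers are polynomials in the entries, so power bounds pass to
  limits.\<close>

lemma mpow_tendsto:
  fixes C :: "nat \<Rightarrow> 'i \<Rightarrow> 'i \<Rightarrow> 'a::real_normed_algebra_1"
  assumes "\<And>p q. p \<in> I \<Longrightarrow> q \<in> I \<Longrightarrow> (\<lambda>r. C r p q) \<longlonglongrightarrow> D p q" and "p \<in> I" "q \<in> I"
  shows "(\<lambda>r. mpow I (C r) i p q) \<longlonglongrightarrow> mpow I D i p q"
  using assms(2)
  by (induction i arbitrary: p) (use assms(1,3) in \<open>auto intro!: tendsto_intros\<close>)

lemma weight_le_1:
  assumes "1 / 2 \<le> t" "t < 1" "w \<in> words (Suc k)"
  shows "weight t k w j \<le> 1"
  using member_le_sum[of j UNIV "weight t k w"] weight_nonneg[OF assms(1,2)] sum_weight[OF assms(3)] by simp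

lemma mstar_sum: "mstar (\<Sum>i\<in>I. f i) = (\<Sum>i\<in>I. mstar (f i))"
  by (intro ext) (simp add: mstar_def sum_tmat_apply)

text \<open>The block at \<open>w\<close> is the weighted sum over \<open>j\<close> of the Gram
  matrices of the \<open>j\<close>-th blocks of \<open>b\<close>. Nonnegative weights have square
  roots, and stacking the scaled rows under the index \<open>(j, l, x)\<close> gives a single Gram
  matrix.\<close>

lemma level_gram:
  fixes r :: nat
  assumes b: "\<And>l p. l < m \<Longrightarrow> p < m \<Longrightarrow> b l p \<in> MatD n"
    and a: "\<And>p q. p < m \<Longrightarrow> q < m \<Longrightarrow> a p q = (\<Sum>l<m. mmul (n + 1) (mstar (b l p)) (b l q))"
    and t: "1 / 2 \<le> t" "t < 1" and pq: "p < m" "q < m"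
  defines "B \<equiv> \<lambda>w (j, l, x) (p, u). of_real (sqrt (weight t r w j)) * b l p (x @ [j]) (u @ [j])"
  shows "level t n r (a p q) = blk n (Suc r) (\<lambda>w u v.
    \<Sum>l\<in>UNIV \<times> {..<m} \<times> words n. cnj (B w l (p, u)) * B w l (q, v))"
  unfolding level_def
proof (rule blk_cong)
  fix w u v :: "3 list" assume w: "w \<in> words (Suc r)"
  have sq: "complex_of_real (sqrt (weight t r w j)) * complex_of_real (sqrt (weight t r w j)) = of_real (weight t r w j)" for j
    using weight_nonneg[OF t, of r w j] by (simp flip: of_real_mult)
  have "diag_block (a p q) j u v = (\<Sum>l<m. \<Sum>x\<in>words n. cnj (b l p (x @ [j]) (u @ [j])) * b l q (x @ [j]) (v @ [j]))" for j
  proof -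
    have "diag_block (a p q) j u v = (\<Sum>l<m. mmul (n + 1) (mstar (b l p)) (b l q) (u @ [j]) (v @ [j]))"
      by (simp only: a[OF pq] diag_block_def sum_tmat_apply)
    also have "\<dots> = (\<Sum>l<m. mmul n (diag_block (mstar (b l p)) j) (diag_block (b l q) j) u v)"
      using b pq by (intro sum.cong refl, subst mmul_snoc_entry) (auto intro: MatD_mstar)
    finally show ?thesis
      by (simp add: mmul_def diag_block_def mstar_def)
  qed
  then have "(\<Sum>j\<in>UNIV. mscale (of_real (weight t r w j)) (diag_block (a p q) j)) u v =
      (\<Sum>j\<in>UNIV. \<Sum>l<m. \<Sum>x\<in>words n. of_real (weight t r w j) * (cnj (b l p (x @ [j]) (u @ [j])) * b l q (x @ [j]) (v @ [j])))"
    by (simp only: sum_tmat_apply mscale_def sum_distrib_left)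
  also have "\<dots> = (\<Sum>j\<in>UNIV. \<Sum>l<m. \<Sum>x\<in>words n. cnj (B w (j, l, x) (p, u)) * B w (j, l, x) (q, v))"
    unfolding B_def by (intro sum.cong refl) (simp add: sq[symmetric] mult_ac del: of_real_mult)
  also have "\<dots> = (\<Sum>l\<in>UNIV \<times> {..<m} \<times> words n. cnj (B w l (p, u)) * B w l (q, v))"
    by (simp add: sum.cartesian_product split_beta)
  finally show "(\<Sum>j\<in>UNIV. mscale (of_real (weight t r w j)) (diag_block (a p q) j)) u v =
      (\<Sum>l\<in>UNIV \<times> {..<m} \<times> words n. cnj (B w l (p, u)) * B w l (q, v))" .
qed

lemma lam_inf_matrix_positive:
  assumes t: "1 / 2 \<le> t" "t < 1" and pos: "matrix_positive (MatD n) (mmul (n + 1)) mstar m a"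
  shows "matrix_positive UNIV (*) ustar m (\<lambda>i j. lam_inf t n (a i j))"
proof -
  interpret star: bounded_linear ustar
    by (rule bounded_linear_ustar)
  from pos obtain b where b: "\<And>l p. l < m \<Longrightarrow> p < m \<Longrightarrow> b l p \<in> MatD n"
    and a: "\<And>p q. p < m \<Longrightarrow> q < m \<Longrightarrow> a p q = (\<Sum>l<m. mmul (n + 1) (mstar (b l p)) (b l q))"
    unfolding matrix_positive_def by blast
  have aD: "a p q \<in> MatD n" if "p < m" "q < m" for p q
    unfolding a[OF that] using b that by (intro MatD_sum MatD_mmul MatD_mstar) auto
  have astar: "mstar (a p q) = a q p" if "p < m" "q < m" for p q
    using that by (simp add: a mstar_sum mstar_mmul)
  define I where "I = {..<m}"
  define J where "J = I \<times> words n"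
  define L :: "(3 \<times> nat \<times> 3 list) set" where "L = UNIV \<times> {..<m} \<times> words n"
  have fin: "finite I" "finite J" "finite L"
    by (simp_all add: I_def J_def L_def)
  define B where "B r w = (\<lambda>(j, l, x) (p, u). complex_of_real (sqrt (weight t r w j)) * b l p (x @ [j]) (u @ [j]))" for r w
  define K where "K = 1 + (\<Sum>(j, l, x)\<in>L. \<Sum>(p, u)\<in>J. (cmod (b l p (x @ [j]) (u @ [j])))\<^sup>2)"
    \<comment> \<open>bounds the squared Frobenius norm of \<open>B r w\<close> for all \<open>r\<close> and \<open>w\<close>, as the weights are at most \<open>1\<close>\<close>
  have K: "0 < K"
    unfolding K_def by (intro add_pos_nonneg sum_nonneg) (auto intro!: sum_nonneg)
  have BK: "(\<Sum>l\<in>L. \<Sum>i\<in>J. (cmod (B r w l i))\<^sup>2) \<le> K" if "w \<in> words (Suc r)" for r w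
  proof -
    have "(\<Sum>l\<in>L. \<Sum>i\<in>J. (cmod (B r w l i))\<^sup>2) \<le> (\<Sum>(j, l, x)\<in>L. \<Sum>(p, u)\<in>J. (cmod (b l p (x @ [j]) (u @ [j])))\<^sup>2)"
      using weight_nonneg[OF t] weight_le_1[OF t that]
      by (intro sum_mono) (auto simp: B_def norm_mult power_mult_distrib intro!: sum_mono mult_left_le_one_le)
    then show ?thesis
      by (simp add: K_def)
  qed
  define T where "T r w i j = of_bool (i = j) - (\<Sum>l\<in>L. cnj (B r w l i) * B r w l j) / of_real K" for r w i j
  \<comment> \<open>\<open>D\<close> is the identity minus the image matrix over \<open>K\<close>.
    \<open>C r\<close> is its approximant from the iterate with index \<open>r\<close>, and
    \<open>C_eq\<close> shows that its blocks are the contractions \<open>T r w\<close>.\<close>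
  define D where "D p q = of_bool (p = q) - lam_inf t n (a p q) /\<^sub>R K" for p q
  define C where "C r p q = of_bool (p = q) - lam_seq t n (a p q) r /\<^sub>R K" for r p q
  have C_eq: "C r p q = iota (n + Suc r) (blk n (Suc r) (\<lambda>w u v. T r w (p, u) (q, v)))"
    if "p \<in> I" "q \<in> I" for r p q
  proof -
    have pq: "p < m" "q < m"
      using that by (auto simp: I_def)
    have "level t n r (a p q) = blk n (Suc r) (\<lambda>w u v. \<Sum>l\<in>L. cnj (B r w l (p, u)) * B r w l (q, v))"
      unfolding B_def L_def by (rule level_gram[OF b a t pq])
    then have lam: "lam_seq t n (a p q) r =
        iota (n + Suc r) (blk n (Suc r) (\<lambda>w u v. \<Sum>l\<in>L. cnj (B r w l (p, u)) * B r w l (q, v)))"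
      by (simp only: lam_seq_eq[OF aD[OF pq]])
    have one: "of_bool (p = q) = iota (n + Suc r) (blk n (Suc r) (\<lambda>w u v. of_bool ((p, u) = (q, v))))"
    proof (cases "p = q")
      case True
      have e: "blk n (Suc r) (\<lambda>w u v. of_bool ((p, u) = (q, v))) = blk n (Suc r) (\<lambda>_. mone n)"
        by (rule blk_cong) (simp add: True mone_def)
      show ?thesis
        unfolding e blk_mone iota_mone by (simp add: True)
    next
      case False
      have e: "blk n (Suc r) (\<lambda>w u v. of_bool ((p, u) = (q, v))) = 0"
        by (rule trans[OF blk_cong blk_zero]) (simp add: False)
      show ?thesis
        unfolding e iota_zero by (simp add: False)
    qed
    have sc: "lam_seq t n (a p q) r /\<^sub>R K = iota (n + Suc r) (blk n (Suc r) (\<lambda>w u v.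
        (\<Sum>l\<in>L. cnj (B r w l (p, u)) * B r w l (q, v)) / of_real K))"
      unfolding lam scaleR_cscale iota_mscale[OF Mat_blk, symmetric] blk_mscale
      by (simp add: mscale_def divide_inverse mult.commute)
    have "C r p q = iota (n + Suc r) (blk n (Suc r) (\<lambda>w u v. of_bool ((p, u) = (q, v)))
        - blk n (Suc r) (\<lambda>w u v. (\<Sum>l\<in>L. cnj (B r w l (p, u)) * B r w l (q, v)) / of_real K))"
      unfolding C_def one sc by (rule iota_diff[OF Mat_blk Mat_blk, symmetric])
    also have "blk n (Suc r) (\<lambda>w u v. of_bool ((p, u) = (q, v)))
        - blk n (Suc r) (\<lambda>w u v. (\<Sum>l\<in>L. cnj (B r w l (p, u)) * B r w l (q, v)) / of_real K) =
        blk n (Suc r) (\<lambda>w u v. T r w (p, u) (q, v))"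
      unfolding blk_diff by (rule blk_cong) (simp add: T_def)
    finally show ?thesis .
  qed
  \<comment> \<open>Powers of contractions have entries of modulus at most \<open>1\<close>, and
    each block has this many entries. The bound depends neither on the level \<open>r\<close> nor on
    the exponent \<open>i\<close>.\<close>
  define M where "M = real (card (words n) * card (words n))"
  have CM: "norm (mpow I (C r) i p q) \<le> M" if pq: "p \<in> I" "q \<in> I" for r i p q
  proof -
    have "mpow I (C r) i p q =
        iota (n + Suc r) (blk n (Suc r) (\<lambda>w u v. mpow (I \<times> words n) (T r w) i (p, u) (q, v)))"
      by (rule mpow_iota_blk[OF fin(1) C_eq pq])
    then have "norm (mpow I (C r) i p q) =
        mnorm (n + Suc r) (blk n (Suc r) (\<lambda>w u v. mpow J (T r w) i (p, u) (q, v)))"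
      by (simp only: norm_iota[OF Mat_blk] J_def)
    also have "\<dots> \<le> M"
    proof (rule mnorm_blk_le)
      fix w :: "3 list" assume w: "w \<in> words (Suc r)"
      have "(\<Sum>i\<in>J. (cmod (\<Sum>j\<in>J. T r w i j * \<xi> j))\<^sup>2) \<le> (\<Sum>i\<in>J. (cmod (\<xi> i))\<^sup>2)" for \<xi>
        unfolding T_def by (rule gram_contraction[OF fin(2,3) K BK[OF w]])
      then have "cmod (mpow J (T r w) i (p, u) (q, v)) \<le> 1" if "u \<in> words n" "v \<in> words n" for u v
        using mpow_contraction_entry_le[OF fin(2), of "T r w" "(p, u)" "(q, v)" i] pq that by (simp add: J_def)
      then have "(\<Sum>u\<in>words n. \<Sum>v\<in>words n. cmod (mpow J (T r w) i (p, u) (q, v))) \<le> (\<Sum>u\<in>words n. \<Sum>v\<in>words n. 1)"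
        by (intro sum_mono)
      then show "mnorm n (\<lambda>u v. mpow J (T r w) i (p, u) (q, v)) \<le> M"
        using mnorm_le_sum_entries[of n "\<lambda>u v. mpow J (T r w) i (p, u) (q, v)"] by (simp add: M_def)
    qed (simp add: M_def)
    finally show ?thesis .
  qed
  have CD: "(\<lambda>r. C r p q) \<longlonglongrightarrow> D p q" if "p \<in> I" "q \<in> I" for p q
    unfolding C_def D_def using that
    by (intro tendsto_intros lam_seq_tendsto[OF t] aD) (auto simp: I_def)
  \<comment> \<open>The uniform bound survives the limit in \<open>r\<close>, so
    \<open>mpow_sqrt\<close> applies to \<open>D\<close>.\<close>
  have DM: "norm (mpow I D i p q) \<le> M" if "p \<in> I" "q \<in> I" for i p q
    using CM that by (intro LIMSEQ_le_const2[OF tendsto_norm[OF mpow_tendsto[where C = C]]] CD) auto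
  have Dstar: "ustar (D p q) = D q p" if "p \<in> I" "q \<in> I" for p q
  proof -
    have pq: "p < m" "q < m"
      using that by (auto simp: I_def)
    have "ustar 1 = (1 :: uhf)"
      using ustar_mult[of 1 "ustar 1"] ustar_ustar[of 1] by simp
    moreover have "ustar (lam_inf t n (a p q)) = lam_inf t n (a q p)"
      using lam_inf_mstar[OF t aD[OF pq]] astar[OF pq] by simp
    ultimately show ?thesis
      unfolding D_def star.diff star.scaleR
      by (cases "p = q") (auto simp: star.zero)
  qed
  \<comment> \<open>The adjoint reverses products, so the left recursion for powers turns into
    \<open>mpow_Suc_right\<close>.\<close>
  have Dpow_star: "ustar (mpow I D i p q) = mpow I D i q p" if "p \<in> I" "q \<in> I" for i p q
    using that
  proof (induction i arbitrary: p q)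
    case 0
    have "ustar 1 = (1 :: uhf)"
      using ustar_mult[of 1 "ustar 1"] ustar_ustar[of 1] by simp
    then show ?case
      by (cases "p = q") (auto simp: star.zero)
  next
    case (Suc i)
    have "ustar (mpow I D (Suc i) p q) = (\<Sum>s\<in>I. mpow I D i q s * D s p)"
      unfolding mpow.simps star.sum ustar_mult
      by (intro sum.cong refl) (simp add: Suc Dstar)
    then show ?case
      by (simp only: mpow_Suc_right[OF fin(1) Suc.prems(2,1)])
  qed
  \<comment> \<open>\<open>S\<close> is the square root of \<open>1 - D\<close>, that is, of the
    image matrix divided by \<open>K\<close>.\<close>
  define S where "S p q = (\<Sum>r. sqrt_coeff r *\<^sub>R mpow I D r p q)" for p q
  have Sstar: "ustar (S p q) = S q p" if "p \<in> I" "q \<in> I" for p q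
  proof -
    have "summable (\<lambda>r. sqrt_coeff r *\<^sub>R mpow I D r p q)"
      by (rule summable_norm_cancel, rule mpow_sqrt(1)[OF fin(1) DM that])
    then show ?thesis
      unfolding S_def
      by (simp add: star.suminf star.scaleR
          Dpow_star that)
  qed
  have SS: "(\<Sum>s\<in>I. S p s * S s q) = lam_inf t n (a p q) /\<^sub>R K" if "p \<in> I" "q \<in> I" for p q
    using mpow_sqrt(2)[OF fin(1) DM that] by (simp add: S_def D_def)
  show ?thesis
    unfolding matrix_positive_def
  \<comment> \<open>As \<open>S\<close> is self-adjoint, its square is a Gram matrix; the factor
    \<open>sqrt K\<close> undoes the scaling.\<close>
  proof (intro exI[of _ "\<lambda>p q. sqrt K *\<^sub>R S p q"] conjI allI impI)
    fix p q assume pq: "p < m" "q < m"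
    have "(\<Sum>s<m. ustar (sqrt K *\<^sub>R S s p) * (sqrt K *\<^sub>R S s q)) = (\<Sum>s\<in>I. K *\<^sub>R (S p s * S s q))"
      unfolding I_def using pq K
      by (intro sum.cong refl) (simp add: star.scaleR Sstar I_def)
    also have "\<dots> = lam_inf t n (a p q)"
      using SS[of p q] pq K by (simp add: I_def flip: scaleR_sum_right)
    finally show "lam_inf t n (a p q) = (\<Sum>s<m. ustar (sqrt K *\<^sub>R S s p) * (sqrt K *\<^sub>R S s q))" ..
  qed simp
qed

lemma completely_positive_lam_inf:
  assumes "1 / 2 \<le> t" "t < 1"
  shows "completely_positive (n + 1) (MatD n) (lam_inf t n)"
  unfolding completely_positive_def
  using lam_inf_add[OF assms] lam_inf_mscale[OF assms] lam_inf_matrix_positive[OF assms] by blast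

theorem proposition2p20:
  fixes t :: real
  assumes "1 / 2 \<le> t" and "t < 1"
  shows "(\<forall>n. \<forall>x\<in>MatD n. convergent (lam_seq t n x)) \<and>
    (\<forall>n. completely_positive (n + 1) (MatD n) (lam_inf t n) \<and>
         (\<forall>x\<in>MatD n. norm (lam_inf t n x) \<le> mnorm (n + 1) x) \<and>
         lam_inf t n ` A_fin n \<subseteq> A_inf) \<and>
    (\<forall>n. \<forall>b\<in>A_fin n. rho n (lam_inf t n b) = b)"
  using lam_seq_convergent[OF assms] completely_positive_lam_inf[OF assms] norm_lam_inf_le[OF assms]
    lam_inf_A_fin[OF assms] rho_lam_inf[OF assms] A_fin_subset_MatD
  by (intro conjI allI ballI) blast+

end
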